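(* Under the moment assumption on $\bm{\Sigma}_a,\bm{\Sigma}_b,\bm{\Sigma}_c,\bm{\Sigma}_d$ stated in the context, with $$M=\frac{1}{p^2\sqrt{n_an_bn_cn_d}}\,\mathrm{tr}\left(\bm{T}_a(n_a)\bm{T}_b(n_b)\bm{T}_c(n_c)\bm{T}_d(n_d)\right),$$ it holds that $$M-\mathrm{E}[M]\Rightarrow N(0,\ \sigma_{ab}\sigma_{ad}\sigma_{bc}\sigma_{cd})$$ as $p\to\infty$ with $n_a,n_b,n_c,n_d\asymp p^{\delta}$, $0<\delta<1$.
   Context: Let $p$ be a positive integer tending to infinity. For each $p$ let $n_a,n_b,n_c,n_d$ be positive integers (depending on $p$) and $\bm{\Sigma}_a,\bm{\Sigma}_b,\bm{\Sigma}_c,\bm{\Sigma}_d$ be $p\times p$ (symmetric) positive definite matrices (depending on $p$). The notation $n\asymp p^\delta$ means that $n/p^\delta$ is bounded above and bounded away from zero by positive constants; $\delta\in(0,1)$ is fixed. $\bm{T}_a(n_a)\sim W_p(n_a,\bm{\Sigma}_a)$, $\bm{T}_b(n_b)\sim W_p(n_b,\bm{\Sigma}_b)$, $\bm{T}_c(n_c)\sim W_p(n_c,\bm{\Sigma}_c)$, $\bm{T}_d(n_d)\sim W_p(n_d,\bm{\Sigma}_d)$ are independent, where $W_p(n,\bm{\Sigma})$ is the $p$-dimensional Wishart distribution with $n$ degrees of freedom and matrix parameter $\bm{\Sigma}$, i.e. the law of $\sum_{i=1}^n \bm{v}_i\bm{v}_i'$ for i.i.d. $\bm{v}_i\sim N_p(\bm{0}_p,\bm{\Sigma})$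 ($'$ denotes transpose). $\Rightarrow$ denotes convergence in distribution. Moment assumption: as $p\to\infty$ with $n_a,n_b,n_c,n_d\asymp p^{\delta}$, $0<\delta<1$, for every $k\in\{2,\dots,16\}$ and all indices $i_1,\dots,i_k\in\{a,b,c,d\}$, the limit $$\sigma_{i_1\cdots i_k}=\lim_{p\to\infty}\frac{\mathrm{tr}(\bm{\Sigma}_{i_1}\bm{\Sigma}_{i_2}\cdots\bm{\Sigma}_{i_k})}{p}$$ exists, with $\sigma_{i_1i_2}\in(0,\infty)$ when $k=2$ and $\sigma_{i_1\cdots i_k}\in(-\infty,\infty)$ when $3\le k\le 16$. *)

theory Defs
  imports
    "HOL-Probability.Probability"
    "Jordan_Normal_Form.Determinant"
    "Jordan_Normal_Form.Gauss_Jordan_Elimination"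
begin

text \<open>
  The dimension \<open>p\<close> varies, so matrices are taken from \<^theory>\<open>Jordan_Normal_Form.Matrix\<close>.
  Several constants there (\<open>vec\<close>, \<open>det\<close>) share their names with constants of
  HOL-Analysis and are therefore written with qualified names.
\<close>

datatype label = La | Lb | Lc | Ld

definition mat_trace :: "real mat \<Rightarrow> real" where
  "mat_trace A = (\<Sum>i<dim_row A. A $$ (i, i))"

definition pos_def_mat :: "nat \<Rightarrow> real mat \<Rightarrow> bool" where
  "pos_def_mat p A \<longleftrightarrow> A \<in> carrier_mat p p \<and> transpose_mat A = A \<and>
     (\<forall>x \<in> carrier_vec p. x \<noteq> 0\<^sub>v p \<longrightarrow> scalar_prod x (A *\<^sub>v x) > 0)"

text \<open>The product \<open>S i\<^sub>1 * \<dots> * S i\<^sub>k\<close> of \<open>p \<times> p\<close> matrices along a word of indices.\<close>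

definition mat_word :: "nat \<Rightarrow> (label \<Rightarrow> real mat) \<Rightarrow> label list \<Rightarrow> real mat" where
  "mat_word p S w = foldr (\<lambda>i A. S i * A) w (1\<^sub>m p)"

text \<open>The \<open>p \<times> p\<close> matrices with the sigma-algebra generated by the entries.\<close>

definition mat_borel :: "nat \<Rightarrow> real mat measure" where
  "mat_borel p = vimage_algebra (carrier_mat p p)
     (\<lambda>A. \<lambda>rs \<in> {..<p} \<times> {..<p}. A $$ rs)
     (\<Pi>\<^sub>M rs \<in> {..<p} \<times> {..<p}. borel)"

text \<open>
  The distribution \<open>N\<^sub>p(0, S)\<close> for positive definite \<open>S\<close>, given by its Lebesgue density;
  a vector is represented by the family of its coordinates indexed by \<open>{..<p}\<close>.
  The inverse \<open>the (mat_inverse S)\<close> exists whenever \<open>S\<close> is positive definite.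
\<close>

definition mv_normal :: "nat \<Rightarrow> real mat \<Rightarrow> (nat \<Rightarrow> real) measure" where
  "mv_normal p S = density (\<Pi>\<^sub>M r \<in> {..<p}. lborel)
     (\<lambda>x. ennreal (exp (- (scalar_prod (Matrix.vec p x) (the (mat_inverse S) *\<^sub>v Matrix.vec p x) / 2))
            / sqrt ((2 * pi) ^ p * Determinant.det S)))"

text \<open>
  The Wishart distribution \<open>W\<^sub>p(n, S)\<close>: the law of \<open>\<Sum>i<n. v\<^sub>i v\<^sub>i'\<close>, whose \<open>(r, s)\<close> entry is
  \<open>\<Sum>i<n. v\<^sub>i(r) v\<^sub>i(s)\<close>, for independent \<open>v\<^sub>i\<close> with law \<open>N\<^sub>p(0, S)\<close>.
\<close>

definition wishart :: "nat \<Rightarrow> nat \<Rightarrow> real mat \<Rightarrow> real mat measure" where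
  "wishart p n S = distr (\<Pi>\<^sub>M i \<in> {..<n}. mv_normal p S) (mat_borel p)
     (\<lambda>v. Matrix.mat p p (\<lambda>(r, s). \<Sum>i<n. v i r * v i s))"

definition trace_stat :: "nat \<Rightarrow> (label \<Rightarrow> nat) \<Rightarrow> (label \<Rightarrow> real mat) \<Rightarrow> real" where
  "trace_stat p n T = mat_trace (T La * T Lb * T Lc * T Ld)
     / (real p ^ 2 * sqrt (real (n La) * real (n Lb) * real (n Lc) * real (n Ld)))"

end

theory Submission
  imports Defs "HOL-Real_Asymp.Real_Asymp"
begin

text \<open>
  Condition on \<open>T\<^sub>b, T\<^sub>c, T\<^sub>d\<close> and put \<open>Q = T\<^sub>b T\<^sub>c T\<^sub>d\<close>. Then \<open>tr (T\<^sub>a Q)\<close> is a sum of \<open>n\<^sub>a\<close> i.i.d. Gaussian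
  quadratic forms, with mean \<open>n\<^sub>a tr (\<Sigma>\<^sub>a Q)\<close> and variance \<open>n\<^sub>a (tr (\<Sigma>\<^sub>a Q \<Sigma>\<^sub>a Q) + tr (\<Sigma>\<^sub>a Q \<Sigma>\<^sub>a Q'))\<close>; since the
  fourth central moment of a Gaussian quadratic form is bounded by its squared variance, the
  conditional characteristic function is close to a Gaussian one. After normalization the conditional
  mean is asymptotically constant, \<open>tr (\<Sigma>\<^sub>a Q \<Sigma>\<^sub>a Q)\<close> is negligible, and the remaining term
  \<open>tr (\<Sigma>\<^sub>a Q \<Sigma>\<^sub>a Q') = tr (T\<^sub>b G T\<^sub>b \<Sigma>\<^sub>a)\<close> with \<open>G = T\<^sub>c T\<^sub>d \<Sigma>\<^sub>a T\<^sub>d T\<^sub>c\<close> concentrates: integrating out one Wishart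
  matrix at a time, \<open>tr (T G T H)\<close> may be replaced by \<open>n tr (\<Sigma> G) tr (\<Sigma> H)\<close> up to an error that is small
  in \<open>L\<^sup>1\<close> and involves only first moments of the remaining matrices, because \<open>tr (G\<^sup>2) \<le> (tr G)\<^sup>2\<close> for
  positive semidefinite \<open>G\<close>. All errors are powers of \<open>n/p\<close> and \<open>1/n\<close>.
\<close>

section \<open>Matrices and quadratic forms\<close>

text \<open>The moment assumption controls only normalized traces of words in the \<Sigma>'s, not
  operator norms, so every error has to end up as a product of such traces. This shapes the
  estimates: a positive semidefinite matrix is carried with an explicit factor, G = Z Z', so that
  its inequalities come from Cauchy-Schwarz alone, and the conditional limit theorem is made linear
  in the conditional variance, because only the mean of that variance is under control. The four
  traces of the limit appear one peeling at a time: T_b yields tr (\<Sigma>_b \<Sigma>_a), T_c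
  yields tr (\<Sigma>_c \<Sigma>_b), T_d yields both tr (\<Sigma>_d \<Sigma>_a) and tr (\<Sigma>_d
  \<Sigma>_c). The other variance term is tr (T_b X T_b X) with X = T_c T_d \<Sigma>_a; its diagonal
  part n_b (tr (\<Sigma>_b X))^2 has only relative size n_c n_d / p^2. On the side of distributions,
  the density of N(0, \<Sigma>) has to be turned into the law of L g with g standard Gaussian and L
  L' = \<Sigma>; after that every trace is a polynomial in independent standard normals, and
  integrability is automatic.\<close>

text \<open>
  A \<open>p \<times> p\<close> matrix is represented by a function whose values outside \<open>{..<p} \<times> {..<p}\<close> are irrelevant;
  identities such as associativity then hold without carrier assumptions.
\<close>

definition mm :: "nat \<Rightarrow> (nat \<Rightarrow> nat \<Rightarrow> real) \<Rightarrow> (nat \<Rightarrow> nat \<Rightarrow> real) \<Rightarrow> nat \<Rightarrow> nat \<Rightarrow> real" where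
  "mm p A B = (\<lambda>r s. \<Sum>t<p. A r t * B t s)"

definition tr :: "nat \<Rightarrow> (nat \<Rightarrow> nat \<Rightarrow> real) \<Rightarrow> real" where
  "tr p A = (\<Sum>r<p. A r r)"

definition tp :: "(nat \<Rightarrow> nat \<Rightarrow> real) \<Rightarrow> nat \<Rightarrow> nat \<Rightarrow> real" where
  "tp A = (\<lambda>r s. A s r)"

definition bil :: "nat \<Rightarrow> (nat \<Rightarrow> nat \<Rightarrow> real) \<Rightarrow> (nat \<Rightarrow> real) \<Rightarrow> (nat \<Rightarrow> real) \<Rightarrow> real" where
  "bil p A x y = (\<Sum>r<p. \<Sum>s<p. x r * A r s * y s)"

definition lin :: "nat \<Rightarrow> (nat \<Rightarrow> nat \<Rightarrow> real) \<Rightarrow> (nat \<Rightarrow> real) \<Rightarrow> nat \<Rightarrow> real" where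
  "lin p L g = (\<lambda>r\<in>{..<p}. \<Sum>s<p. L r s * g s)"

lemma mm_assoc: "mm p (mm p A B) C = mm p A (mm p B C)"
proof (intro ext)
  fix r s
  have "mm p (mm p A B) C r s = (\<Sum>t<p. \<Sum>u<p. A r u * B u t * C t s)"
    by (simp add: mm_def sum_distrib_right)
  also have "\<dots> = (\<Sum>u<p. \<Sum>t<p. A r u * B u t * C t s)" by (rule sum.swap)
  also have "\<dots> = mm p A (mm p B C) r s"
    by (simp add: mm_def sum_distrib_left mult.assoc)
  finally show "mm p (mm p A B) C r s = mm p A (mm p B C) r s" .
qed

lemma tr_comm: "tr p (mm p A B) = tr p (mm p B A)"
  unfolding tr_def mm_def by (subst sum.swap) (simp add: mult.commute)

lemma tp_mm: "tp (mm p A B) = mm p (tp B) (tp A)"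
  by (simp add: tp_def mm_def mult.commute)

lemma tp_tp [simp]: "tp (tp A) = A"
  by (simp add: tp_def)

lemma tr_mm: "tr p (mm p A B) = (\<Sum>r<p. \<Sum>s<p. A r s * B s r)"
  by (simp add: tr_def mm_def)

lemma tr_mm_tp: "tr p (mm p A (tp B)) = (\<Sum>r<p. \<Sum>s<p. A r s * B r s)"
  by (simp add: tr_def mm_def tp_def)

lemma tr_mm_tp_nonneg: "0 \<le> tr p (mm p A (tp A))"
  by (simp add: tr_mm_tp sum_nonneg)

lemma bil_commute: "bil p A x y = bil p (tp A) y x"
  unfolding bil_def tp_def by (subst sum.swap) (simp add: mult_ac)

lemma bil_lin: "bil p A (lin p L g) (lin p M h) = bil p (mm p (tp L) (mm p A M)) g h"
proof -
  have "bil p A (lin p L g) (lin p M h)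
      = (\<Sum>r<p. \<Sum>s<p. \<Sum>t<p. \<Sum>u<p. g t * (L r t * A r s * M s u) * h u)"
    by (simp add: bil_def lin_def sum_distrib_left sum_distrib_right mult_ac)
  also have "\<dots> = (\<Sum>r<p. \<Sum>t<p. \<Sum>s<p. \<Sum>u<p. g t * (L r t * A r s * M s u) * h u)"
    by (intro sum.cong refl sum.swap)
  also have "\<dots> = (\<Sum>t<p. \<Sum>r<p. \<Sum>u<p. \<Sum>s<p. g t * (L r t * A r s * M s u) * h u)"
    by (subst sum.swap) (intro sum.cong refl sum.swap)
  also have "\<dots> = (\<Sum>t<p. \<Sum>u<p. \<Sum>r<p. \<Sum>s<p. g t * (L r t * A r s * M s u) * h u)"
    by (intro sum.cong refl sum.swap)
  also have "\<dots> = bil p (mm p (tp L) (mm p A M)) g h"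
    by (simp add: bil_def mm_def tp_def sum_distrib_left sum_distrib_right mult_ac)
  finally show ?thesis .
qed

text \<open>Cauchy-Schwarz for the Frobenius inner product tr (A B').\<close>

lemma tr_mm_tp_CS:
  "\<bar>tr p (mm p A (tp B))\<bar> \<le> sqrt (tr p (mm p A (tp A))) * sqrt (tr p (mm p B (tp B)))"
proof -
  have "(\<Sum>x\<in>{..<p}\<times>{..<p}. case_prod A x * case_prod B x)\<^sup>2
      \<le> (\<Sum>x\<in>{..<p}\<times>{..<p}. (case_prod A x)\<^sup>2) * (\<Sum>x\<in>{..<p}\<times>{..<p}. (case_prod B x)\<^sup>2)"
    by (rule Cauchy_Schwarz_ineq_sum)
  then have "(tr p (mm p A (tp B)))\<^sup>2 \<le> tr p (mm p A (tp A)) * tr p (mm p B (tp B))"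
    by (simp add: tr_mm_tp sum.cartesian_product power2_eq_square case_prod_beta')
  then have "sqrt ((tr p (mm p A (tp B)))\<^sup>2) \<le> sqrt (tr p (mm p A (tp A)) * tr p (mm p B (tp B)))"
    by (rule real_sqrt_le_mono)
  then show ?thesis by (simp add: real_sqrt_mult)
qed

text \<open>The case B = A' of Cauchy-Schwarz; A and A' have the same Frobenius norm.\<close>

lemma tr_square_le: "\<bar>tr p (mm p A A)\<bar> \<le> tr p (mm p A (tp A))"
proof -
  have "\<bar>tr p (mm p A (tp (tp A)))\<bar> \<le> sqrt (tr p (mm p A (tp A))) * sqrt (tr p (mm p (tp A) (tp (tp A))))"
    by (rule tr_mm_tp_CS)
  then show ?thesis by (simp add: tr_comm[of p "tp A" A] tr_mm_tp_nonneg)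
qed

text \<open>Entrywise G_rs^2 \<le> G_rr G_ss, by Cauchy-Schwarz on the rows of \<open>Z\<close>;
  summation gives the bound without eigenvalues.\<close>

lemma tr_gram_square_le:
  assumes "G = mm p Z (tp Z)"
  shows "tr p (mm p G (tp G)) \<le> (tr p G)\<^sup>2"
proof -
  have "(\<Sum>x\<in>{..<p}. Z r x * Z s x)\<^sup>2 \<le> G r r * G s s" for r s
    using Cauchy_Schwarz_ineq_sum[of "Z r" "Z s" "{..<p}"]
    by (simp add: assms mm_def tp_def power2_eq_square)
  then have "G r s * G r s \<le> G r r * G s s" for r s
    by (simp add: assms mm_def tp_def power2_eq_square)
  then have "tr p (mm p G (tp G)) \<le> (\<Sum>r<p. \<Sum>s<p. G r r * G s s)"
    unfolding tr_mm_tp by (intro sum_mono)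
  also have "\<dots> = (tr p G)\<^sup>2" by (simp add: tr_def power2_eq_square sum_product)
  finally show ?thesis .
qed

section \<open>Moments of standard Gaussian vectors\<close>

text \<open>Unlike integrability, this class is closed under products as well as sums, so
  integrability of any polynomial in Gaussian entries reduces to introduction rules.\<close>

definition all_moments :: "'a measure \<Rightarrow> ('a \<Rightarrow> real) \<Rightarrow> bool" where
  "all_moments M f \<longleftrightarrow> f \<in> borel_measurable M \<and> (\<forall>k. integrable M (\<lambda>x. \<bar>f x\<bar> ^ k))"

lemma all_moments_measurable: "all_moments M f \<Longrightarrow> f \<in> borel_measurable M"
  by (simp add: all_moments_def)

lemma all_moments_integrable: "all_moments M f \<Longrightarrow> integrable M f"
proof -
  assume f: "all_moments M f"
  then have "integrable M (\<lambda>x. \<bar>f x\<bar> ^ 1)" unfolding all_moments_def by blast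
  then have "integrable M (\<lambda>x. norm (f x))" by simp
  then show "integrable M f"
    by (rule integrable_norm_cancel) (use f in \<open>simp add: all_moments_def\<close>)
qed

lemma (in prob_space) all_moments_const: "all_moments M (\<lambda>_. c)"
  by (simp add: all_moments_def)

lemma all_moments_add:
  assumes "all_moments M f" "all_moments M g"
  shows "all_moments M (\<lambda>x. f x + g x)"
  unfolding all_moments_def
proof (intro conjI allI)
  have [measurable]: "f \<in> borel_measurable M" "g \<in> borel_measurable M"
    using assms by (auto simp: all_moments_def)
  show "(\<lambda>x. f x + g x) \<in> borel_measurable M" by simp
  fix k
  show "integrable M (\<lambda>x. \<bar>f x + g x\<bar> ^ k)"
  proof (rule Bochner_Integration.integrable_bound)
    show "integrable M (\<lambda>x. 2 ^ k * (\<bar>f x\<bar> ^ k + \<bar>g x\<bar> ^ k))"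
      using assms by (auto simp: all_moments_def)
    have "\<bar>a + b\<bar> ^ k \<le> 2 ^ k * (\<bar>a\<bar> ^ k + \<bar>b\<bar> ^ k)" for a b :: real
    proof -
      have "\<bar>a + b\<bar> ^ k \<le> (2 * max \<bar>a\<bar> \<bar>b\<bar>) ^ k" by (intro power_mono) auto
      also have "\<dots> = 2 ^ k * max \<bar>a\<bar> \<bar>b\<bar> ^ k" by (simp add: power_mult_distrib)
      also have "max \<bar>a\<bar> \<bar>b\<bar> ^ k \<le> \<bar>a\<bar> ^ k + \<bar>b\<bar> ^ k" by (simp add: max_def)
      finally show ?thesis by simp
    qed
    then show "AE x in M. norm (\<bar>f x + g x\<bar> ^ k) \<le> norm (2 ^ k * (\<bar>f x\<bar> ^ k + \<bar>g x\<bar> ^ k))"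
      by simp
  qed simp
qed

lemma all_moments_mult:
  assumes "all_moments M f" "all_moments M g"
  shows "all_moments M (\<lambda>x. f x * g x)"
  unfolding all_moments_def
proof (intro conjI allI)
  have [measurable]: "f \<in> borel_measurable M" "g \<in> borel_measurable M"
    using assms by (auto simp: all_moments_def)
  show "(\<lambda>x. f x * g x) \<in> borel_measurable M" by simp
  fix k
  show "integrable M (\<lambda>x. \<bar>f x * g x\<bar> ^ k)"
  proof (rule Bochner_Integration.integrable_bound)
    show "integrable M (\<lambda>x. \<bar>f x\<bar> ^ (2 * k) + \<bar>g x\<bar> ^ (2 * k))"
      using assms by (auto simp: all_moments_def)
    have "\<bar>a * b\<bar> ^ k \<le> \<bar>a\<bar> ^ (2 * k) + \<bar>b\<bar> ^ (2 * k)" for a b :: real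
    proof -
      have "2 * (\<bar>a\<bar> ^ k * \<bar>b\<bar> ^ k) \<le> (\<bar>a\<bar> ^ k)\<^sup>2 + (\<bar>b\<bar> ^ k)\<^sup>2"
        using sum_squares_bound[of "\<bar>a\<bar> ^ k" "\<bar>b\<bar> ^ k"] by simp
      moreover have "0 \<le> \<bar>a\<bar> ^ k * \<bar>b\<bar> ^ k" by simp
      ultimately have "\<bar>a\<bar> ^ k * \<bar>b\<bar> ^ k \<le> (\<bar>a\<bar> ^ k)\<^sup>2 + (\<bar>b\<bar> ^ k)\<^sup>2" by linarith
      then show ?thesis by (simp add: abs_mult power_mult_distrib power_mult[symmetric] mult.commute)
    qed
    then show "AE x in M. norm (\<bar>f x * g x\<bar> ^ k) \<le> norm (\<bar>f x\<bar> ^ (2 * k) + \<bar>g x\<bar> ^ (2 * k))"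
      by simp
  qed simp
qed

lemma (in prob_space) all_moments_sum:
  "(\<And>i. i \<in> I \<Longrightarrow> all_moments M (f i)) \<Longrightarrow> all_moments M (\<lambda>x. \<Sum>i\<in>I. f i x)"
  by (induction I rule: infinite_finite_induct)
    (auto intro: all_moments_add all_moments_const)

lemma (in prob_space) all_moments_power:
  "all_moments M f \<Longrightarrow> all_moments M (\<lambda>x. f x ^ k)"
  by (induction k) (auto intro: all_moments_mult all_moments_const)

lemma (in prob_space) all_moments_diff:
  assumes "all_moments M f" "all_moments M g"
  shows "all_moments M (\<lambda>x. f x - g x)"
  using all_moments_add[OF assms(1) all_moments_mult[OF all_moments_const[of "-1"] assms(2)]]
  by simp

lemma (in prob_space) all_moments_bil:
  "(\<And>r. r < p \<Longrightarrow> all_moments M (\<lambda>\<omega>. x \<omega> r)) \<Longrightarrow> (\<And>r. r < p \<Longrightarrow> all_moments M (\<lambda>\<omega>. y \<omega> r)) \<Longrightarrow>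
    all_moments M (\<lambda>\<omega>. bil p m (x \<omega>) (y \<omega>))"
  unfolding bil_def by (intro all_moments_sum all_moments_mult all_moments_const) auto

lemmas (in prob_space) all_moments_intros =
  all_moments_const all_moments_add all_moments_mult all_moments_sum all_moments_power
  all_moments_diff all_moments_bil

text \<open>Moments are pulled back along a map with image measure \<open>N\<close>; the uses are
  coordinate projections of product measures and \<open>half_sum\<close>.\<close>

lemma all_moments_distr:
  assumes "X \<in> measurable M N" "distr M N X = N" "all_moments N f"
  shows "all_moments M (\<lambda>x. f (X x))"
proof -
  have "integrable N (\<lambda>x. \<bar>f x\<bar> ^ k)" "f \<in> borel_measurable N" for k
    using assms(3) by (auto simp: all_moments_def)
  then have "integrable M (\<lambda>x. \<bar>f (X x)\<bar> ^ k)" for k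
    using integrable_distr[OF assms(1), of "\<lambda>x. \<bar>f x\<bar> ^ k"] assms(2) by simp
  then show ?thesis
    using assms(1,3) unfolding all_moments_def by (auto intro: measurable_compose)
qed

section \<open>Standard Gaussian vectors: moments of linear and quadratic forms\<close>

definition gauss :: "nat \<Rightarrow> (nat \<Rightarrow> real) measure" where
  "gauss p = (\<Pi>\<^sub>M r\<in>{..<p}. std_normal_distribution)"

lemma prob_space_std_normal: "prob_space std_normal_distribution"
  using real_dist_normal_dist by (simp add: real_distribution_def)

interpretation std_normal: prob_space std_normal_distribution
  by (rule prob_space_std_normal)

interpretation std_normal_pair: pair_prob_space std_normal_distribution std_normal_distribution
  ..

interpretation std_normals: product_prob_space "\<lambda>_. std_normal_distribution" "I :: nat set" for I
  by unfold_locales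

lemma prob_space_gauss: "prob_space (gauss p)"
  unfolding gauss_def by (rule prob_space_PiM) (rule prob_space_std_normal)

interpretation gauss: prob_space "gauss p" for p
  by (rule prob_space_gauss)

lemma sets_gauss: "sets (gauss p) = sets (\<Pi>\<^sub>M r\<in>{..<p}. borel)"
  unfolding gauss_def by (intro sets_PiM_cong) auto

lemma measurable_gauss_component [measurable]: "r < p \<Longrightarrow> (\<lambda>g. g r) \<in> borel_measurable (gauss p)"
  unfolding gauss_def by measurable

lemma all_moments_std_normal: "all_moments std_normal_distribution (\<lambda>x. x)"
  unfolding all_moments_def
proof (intro conjI allI)
  show "(\<lambda>x. x) \<in> borel_measurable std_normal_distribution" by simp
  show "integrable std_normal_distribution (\<lambda>x. \<bar>x\<bar> ^ k)" for k
    unfolding power_abs[symmetric] by (rule integrable_abs) (rule integrable_std_normal_distribution_moment)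
qed

lemma all_moments_gauss: "r < p \<Longrightarrow> all_moments (gauss p) (\<lambda>g. g r)"
  unfolding gauss_def
  by (rule all_moments_distr[where X = "\<lambda>g. g r" and N = std_normal_distribution])
    (blast intro: all_moments_std_normal std_normals.PiM_component measurable_component_singleton)+

definition std_moment :: "nat \<Rightarrow> real" where
  "std_moment k = (LINT x|std_normal_distribution. x ^ k)"

lemma std_moment_simps [simp]:
  "std_moment 0 = 1" "std_moment (Suc 0) = 0" "std_moment (Suc (Suc 0)) = 1"
  "std_moment (Suc (Suc (Suc (Suc 0)))) = 3"
proof -
  show "std_moment 0 = 1"
    using std_normal.prob_space by (simp add: std_moment_def)
  show "std_moment (Suc 0) = 0"
    unfolding std_moment_def by (rule integral_std_normal_distribution_moment_odd) simp
  show "std_moment (Suc (Suc 0)) = 1"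
    unfolding std_moment_def
    using std_normal_distribution_even_moments(1)[of 1] by (simp add: fact_numeral numeral_2_eq_2)
  have "std_moment (2 * 2) = 3"
    unfolding std_moment_def std_normal_distribution_even_moments(1) by (simp add: fact_numeral)
  then show "std_moment (Suc (Suc (Suc (Suc 0)))) = 3"
    by (simp add: eval_nat_numeral)
qed

lemma integral_gauss_monomial:
  "(LINT g|gauss p. (\<Prod>r<p. g r ^ c r)) = (\<Prod>r<p. std_moment (c r))"
  unfolding gauss_def std_moment_def
  by (rule std_normals.product_integral_prod)
    (auto intro: integrable_std_normal_distribution_moment)

lemma prod_power_indicator:
  fixes g :: "nat \<Rightarrow> real"
  assumes "i < p"
  shows "(\<Prod>r<p. g r ^ (if r = i then 1 else 0)) = g i"
proof -
  have "(\<Prod>r<p. g r ^ (if r = i then 1 else 0)) = (\<Prod>r<p. if r = i then g r else 1)"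
    by (intro prod.cong) auto
  then show ?thesis using assms by simp
qed

lemma gauss_moment2:
  assumes "i < p" "j < p"
  shows "(LINT g|gauss p. g i * g j) = (if i = j then 1 else 0)"
proof -
  let ?c = "\<lambda>r. (if r = i then 1 else 0) + (if r = j then 1 else 0 :: nat)"
  have "g i * g j = (\<Prod>r<p. g r ^ ?c r)" for g :: "nat \<Rightarrow> real"
    unfolding power_add prod.distrib prod_power_indicator[OF assms(1)] prod_power_indicator[OF assms(2)] ..
  then have *: "(LINT g|gauss p. g i * g j) = (\<Prod>r<p. std_moment (?c r))"
    by (simp only: integral_gauss_monomial)
  show ?thesis
  proof (cases "i = j")
    case True
    then have "(\<Prod>r<p. std_moment (?c r)) = 1" by (intro prod.neutral) auto
    with * True show ?thesis by simp
  next
    case False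
    then have "(\<Prod>r<p. std_moment (?c r)) = 0" using assms by (intro prod_zero bexI[of _ i]) auto
    with * False show ?thesis by simp
  qed
qed

text \<open>Isserlis' formula. The exponent \<open>?c r\<close> counts how often \<open>r\<close>
  occurs among the four indices. Either the indices pair off, or one of them is isolated and its
  first moment 0 annihilates the product.\<close>

lemma gauss_moment4:
  assumes "i < p" "j < p" "k < p" "l < p"
  shows "(LINT g|gauss p. g i * g j * g k * g l)
    = (if i = j then 1 else 0) * (if k = l then 1 else 0) + (if i = k then 1 else 0) * (if j = l then 1 else 0)
      + (if i = l then 1 else 0) * (if j = k then 1 else 0)"
proof -
  let ?c = "\<lambda>r. (if r = i then 1 else 0) + (if r = j then 1 else 0) + (if r = k then 1 else 0)
    + (if r = l then 1 else 0 :: nat)"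
  have "g i * g j * g k * g l = (\<Prod>r<p. g r ^ ?c r)" for g :: "nat \<Rightarrow> real"
    unfolding power_add prod.distrib prod_power_indicator[OF assms(1)] prod_power_indicator[OF assms(2)]
      prod_power_indicator[OF assms(3)] prod_power_indicator[OF assms(4)] ..
  then have *: "(LINT g|gauss p. g i * g j * g k * g l) = (\<Prod>r<p. std_moment (?c r))"
    by (simp only: integral_gauss_monomial)
  consider "i = j" "k = l" "i = k" | "i = j" "k = l" "i \<noteq> k" | "i = k" "j = l" "i \<noteq> j" | "i = l" "j = k" "i \<noteq> j"
    | "i \<noteq> j" "i \<noteq> k" "i \<noteq> l" | "j \<noteq> i" "j \<noteq> k" "j \<noteq> l" | "k \<noteq> i" "k \<noteq> j" "k \<noteq> l" | "l \<noteq> i" "l \<noteq> j" "l \<noteq> k"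
    by metis
  then show ?thesis
  proof cases
    case 1
    then have "(\<Prod>r<p. std_moment (?c r)) = (\<Prod>r<p. if r = i then 3 else 1)"
      by (intro prod.cong) auto
    with * 1 assms show ?thesis by simp
  next
    case 2
    then have "(\<Prod>r<p. std_moment (?c r)) = 1" by (intro prod.neutral) auto
    with * 2 show ?thesis by simp
  next
    case 3
    then have "(\<Prod>r<p. std_moment (?c r)) = 1" by (intro prod.neutral) auto
    with * 3 show ?thesis by simp
  next
    case 4
    then have "(\<Prod>r<p. std_moment (?c r)) = 1" by (intro prod.neutral) auto
    with * 4 show ?thesis by simp
  next
    case 5
    then have "(\<Prod>r<p. std_moment (?c r)) = 0" using assms by (intro prod_zero bexI[of _ i]) auto
    with * 5 show ?thesis by simp
  next
    case 6
    then have "(\<Prod>r<p. std_moment (?c r)) = 0" using assms by (intro prod_zero bexI[of _ j]) auto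
    with * 6 show ?thesis by simp
  next
    case 7
    then have "(\<Prod>r<p. std_moment (?c r)) = 0" using assms by (intro prod_zero bexI[of _ k]) auto
    with * 7 show ?thesis by simp
  next
    case 8
    then have "(\<Prod>r<p. std_moment (?c r)) = 0" using assms by (intro prod_zero bexI[of _ l]) auto
    with * 8 show ?thesis by simp
  qed
qed

lemma (in prob_space) expectation_sum:
  "(\<And>i. i \<in> I \<Longrightarrow> all_moments M (f i)) \<Longrightarrow>
    expectation (\<lambda>x. \<Sum>i\<in>I. f i x) = (\<Sum>i\<in>I. expectation (f i))"
  by (rule Bochner_Integration.integral_sum) (rule all_moments_integrable)

lemma sum_if_eq_less:
  fixes f :: "nat \<Rightarrow> real"
  shows "r < p \<Longrightarrow> (\<Sum>s<p. f s * (if r = s then 1 else 0)) = f r"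
    "r < p \<Longrightarrow> (\<Sum>s<p. f s * (if s = r then 1 else 0)) = f r"
proof -
  assume "r < p"
  moreover have "(\<Sum>s<p. f s * (if r = s then 1 else 0)) = (\<Sum>s<p. if r = s then f s else 0)"
    by (intro sum.cong) auto
  moreover have "(\<Sum>s<p. f s * (if s = r then 1 else 0)) = (\<Sum>s<p. if s = r then f s else 0)"
    by (intro sum.cong) auto
  ultimately show "(\<Sum>s<p. f s * (if r = s then 1 else 0)) = f r"
    "(\<Sum>s<p. f s * (if s = r then 1 else 0)) = f r"
    by simp_all
qed

lemma gauss_bil_mean: "(LINT g|gauss p. bil p m g g) = tr p m"
proof -
  have eq: "bil p m g g = (\<Sum>r<p. \<Sum>s<p. m r s * (g r * g s))" for g
    by (simp add: bil_def mult_ac)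
  have "(LINT g|gauss p. bil p m g g) = (\<Sum>r<p. \<Sum>s<p. (LINT g|gauss p. m r s * (g r * g s)))"
    unfolding eq
    by (rule trans[OF gauss.expectation_sum], (intro gauss.all_moments_intros all_moments_gauss; simp),
        rule sum.cong[OF refl])+ (rule refl)
  also have "\<dots> = (\<Sum>r<p. \<Sum>s<p. m r s * (if r = s then 1 else 0))"
    by (intro sum.cong refl) (simp only: gauss_moment2 lessThan_iff integral_mult_right_zero)
  also have "\<dots> = tr p m"
    unfolding tr_def by (intro sum.cong refl) (simp only: sum_if_eq_less lessThan_iff)
  finally show ?thesis .
qed
text \<open>The three pairings of the indices in m_rs m_tu: rs|tu gives (tr m)^2, rt|su gives tr (m
  m'), ru|st gives tr (m m). As \<open>m\<close> is arbitrary, the last two are kept apart.\<close>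

lemma gauss_bil_square: "(LINT g|gauss p. (bil p m g g)\<^sup>2) = (tr p m)\<^sup>2 + tr p (mm p m m) + tr p (mm p m (tp m))"
proof -
  have eq: "(bil p m g g)\<^sup>2 = (\<Sum>r<p. \<Sum>s<p. \<Sum>t<p. \<Sum>u<p. (m r s * m t u) * (g r * g s * g t * g u))" for g
    unfolding bil_def power2_eq_square sum_distrib_right sum_distrib_left
    by (intro sum.cong refl) (simp add: mult_ac)
  have "(LINT g|gauss p. (bil p m g g)\<^sup>2)
      = (\<Sum>r<p. \<Sum>s<p. \<Sum>t<p. \<Sum>u<p. (LINT g|gauss p. (m r s * m t u) * (g r * g s * g t * g u)))"
    unfolding eq
    by (rule trans[OF gauss.expectation_sum], (intro gauss.all_moments_intros all_moments_gauss; simp),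
        rule sum.cong[OF refl])+ (rule refl)
  also have "\<dots> = (\<Sum>r<p. \<Sum>s<p. \<Sum>t<p. \<Sum>u<p. (m r s * m t u) * ((if r = s then 1 else 0) * (if t = u then 1 else 0)
      + (if r = t then 1 else 0) * (if s = u then 1 else 0) + (if r = u then 1 else 0) * (if s = t then 1 else 0)))"
    by (intro sum.cong refl) (simp add: gauss_moment4 del: mult_cancel_left)
  also have "\<dots> = (\<Sum>r<p. \<Sum>s<p. \<Sum>t<p. \<Sum>u<p. m r s * m t u * (if r = s then 1 else 0) * (if t = u then 1 else 0))
     + (\<Sum>r<p. \<Sum>s<p. \<Sum>t<p. \<Sum>u<p. m r s * m t u * (if r = t then 1 else 0) * (if s = u then 1 else 0))
     + (\<Sum>r<p. \<Sum>s<p. \<Sum>t<p. \<Sum>u<p. m r s * m t u * (if s = t then 1 else 0) * (if r = u then 1 else 0))"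
    unfolding sum.distrib[symmetric] by (intro sum.cong refl) simp
  also have "(\<Sum>r<p. \<Sum>s<p. \<Sum>t<p. \<Sum>u<p. m r s * m t u * (if r = s then 1 else 0) * (if t = u then 1 else 0)) = (tr p m)\<^sup>2"
  proof -
    have "(\<Sum>r<p. \<Sum>s<p. \<Sum>t<p. \<Sum>u<p. m r s * m t u * (if r = s then 1 else 0) * (if t = u then 1 else 0))
        = (\<Sum>r<p. \<Sum>s<p. \<Sum>t<p. m r s * m t t * (if r = s then 1 else 0))"
      by (intro sum.cong refl) (simp add: sum_if_eq_less)
    also have "\<dots> = (\<Sum>r<p. \<Sum>s<p. (\<Sum>t<p. m r s * m t t) * (if r = s then 1 else 0))"
      by (simp only: sum_distrib_right)
    also have "\<dots> = (\<Sum>r<p. \<Sum>t<p. m r r * m t t)"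
      by (rule sum.cong[OF refl]) (simp only: sum_if_eq_less lessThan_iff)
    finally show ?thesis by (simp add: tr_def power2_eq_square sum_product)
  qed
  also have "(\<Sum>r<p. \<Sum>s<p. \<Sum>t<p. \<Sum>u<p. m r s * m t u * (if r = t then 1 else 0) * (if s = u then 1 else 0))
      = tr p (mm p m (tp m))"
  proof -
    have "(\<Sum>r<p. \<Sum>s<p. \<Sum>t<p. \<Sum>u<p. m r s * m t u * (if r = t then 1 else 0) * (if s = u then 1 else 0))
        = (\<Sum>r<p. \<Sum>s<p. \<Sum>t<p. m r s * m t s * (if r = t then 1 else 0))"
      by (intro sum.cong refl) (simp only: sum_if_eq_less lessThan_iff)
    also have "\<dots> = (\<Sum>r<p. \<Sum>s<p. m r s * m r s)"
      by (intro sum.cong refl) (simp only: sum_if_eq_less lessThan_iff)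
    finally show ?thesis by (simp add: tr_mm_tp)
  qed
  also have "(\<Sum>r<p. \<Sum>s<p. \<Sum>t<p. \<Sum>u<p. m r s * m t u * (if s = t then 1 else 0) * (if r = u then 1 else 0))
      = tr p (mm p m m)"
  proof -
    have "(\<Sum>r<p. \<Sum>s<p. \<Sum>t<p. \<Sum>u<p. m r s * m t u * (if s = t then 1 else 0) * (if r = u then 1 else 0))
        = (\<Sum>r<p. \<Sum>s<p. \<Sum>t<p. m r s * m t r * (if s = t then 1 else 0))"
      by (intro sum.cong refl) (simp only: sum_if_eq_less lessThan_iff)
    also have "\<dots> = (\<Sum>r<p. \<Sum>s<p. m r s * m s r)"
      by (intro sum.cong refl) (simp only: sum_if_eq_less lessThan_iff)
    finally show ?thesis by (simp add: tr_mm)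
  qed
  finally show ?thesis by simp
qed

lemma gauss_lin_square: "(LINT g|gauss p. (\<Sum>r<p. g r * u r)\<^sup>2) = (\<Sum>r<p. (u r)\<^sup>2)"
proof -
  have "(\<Sum>r<p. g r * u r)\<^sup>2 = bil p (\<lambda>r s. u r * u s) g g" for g
    unfolding bil_def power2_eq_square sum_product by (intro sum.cong refl) (simp add: mult_ac)
  then have "(LINT g|gauss p. (\<Sum>r<p. g r * u r)\<^sup>2) = tr p (\<lambda>r s. u r * u s)"
    by (simp only: gauss_bil_mean)
  then show ?thesis by (simp add: tr_def power2_eq_square)
qed

text \<open>The square of a linear form is the quadratic form of the rank-one matrix u u', for which
  all three terms of \<open>gauss_bil_square\<close> equal |u|^4.\<close>

lemma gauss_lin_fourth: "(LINT g|gauss p. (\<Sum>r<p. g r * u r) ^ 4) = 3 * (\<Sum>r<p. (u r)\<^sup>2)\<^sup>2"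
proof -
  have sq: "(\<Sum>r<p. g r * u r)\<^sup>2 = bil p (\<lambda>r s. u r * u s) g g" for g
    unfolding bil_def power2_eq_square sum_product by (intro sum.cong refl) (simp add: mult_ac)
  have "x ^ 4 = (x\<^sup>2)\<^sup>2" for x :: real
    by simp
  then have *: "(LINT g|gauss p. (\<Sum>r<p. g r * u r) ^ 4)
      = (tr p (\<lambda>r s. u r * u s))\<^sup>2 + tr p (mm p (\<lambda>r s. u r * u s) (\<lambda>r s. u r * u s))
        + tr p (mm p (\<lambda>r s. u r * u s) (tp (\<lambda>r s. u r * u s)))"
    by (simp only: sq gauss_bil_square)
  have "tr p (mm p (\<lambda>r s. u r * u s) (\<lambda>r s. u r * u s)) = (\<Sum>r<p. (u r)\<^sup>2)\<^sup>2"
    unfolding tr_mm power2_eq_square sum_product by (intro sum.cong refl) (simp add: mult_ac)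
  moreover have "tr p (mm p (\<lambda>r s. u r * u s) (tp (\<lambda>r s. u r * u s))) = (\<Sum>r<p. (u r)\<^sup>2)\<^sup>2"
    unfolding tr_mm_tp power2_eq_square sum_product by (intro sum.cong refl) (simp add: mult_ac)
  moreover have "tr p (\<lambda>r s. u r * u s) = (\<Sum>r<p. (u r)\<^sup>2)"
    by (simp add: tr_def power2_eq_square)
  ultimately show ?thesis unfolding * by simp
qed

lemma bil_eq_lin: "bil p m x y = (\<Sum>r<p. x r * (\<Sum>s<p. m r s * y s))"
  by (simp add: bil_def sum_distrib_left mult_ac)

lemma sum_square_eq_bil: "(\<Sum>r<p. (\<Sum>s<p. m r s * y s)\<^sup>2) = bil p (mm p (tp m) m) y y"
proof -
  have "(\<Sum>r<p. (\<Sum>s<p. m r s * y s)\<^sup>2) = (\<Sum>r<p. \<Sum>s<p. \<Sum>t<p. y s * (m r s * m r t) * y t)"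
    unfolding power2_eq_square sum_product by (intro sum.cong refl) (simp add: mult_ac)
  also have "\<dots> = (\<Sum>s<p. \<Sum>t<p. \<Sum>r<p. y s * (m r s * m r t) * y t)"
    by (subst sum.swap) (intro sum.cong refl sum.swap)
  finally show ?thesis
    by (simp add: bil_def mm_def tp_def sum_distrib_left sum_distrib_right)
qed

text \<open>For a Gram matrix, tr (m m) and tr (m m') are both at most (tr m)^2, which makes three
  equal terms.\<close>

lemma gauss_bil_square_le:
  assumes "m = mm p z (tp z)"
  shows "(LINT g|gauss p. (bil p m g g)\<^sup>2) \<le> 3 * (tr p m)\<^sup>2"
  using tr_gram_square_le[OF assms] tr_square_le[of p m] by (simp add: gauss_bil_square)

lemma gauss2_bil_square:
  "(LINT y|gauss p. LINT x|gauss p. (bil p m x y)\<^sup>2) = tr p (mm p m (tp m))"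
  unfolding bil_eq_lin[of p m] gauss_lin_square sum_square_eq_bil gauss_bil_mean by (rule tr_comm)

text \<open>For fixed y, x' m y is a linear form in x with coefficients m y, so the inner integral
  is 3 |m y|^4. In turn |m y|^2 is a quadratic form with Gram matrix m' m, which contributes the
  second factor 3.\<close>

lemma gauss2_bil_fourth_le:
  "(LINT y|gauss p. LINT x|gauss p. (bil p m x y) ^ 4) \<le> 9 * (tr p (mm p m (tp m)))\<^sup>2"
proof -
  have "(LINT y|gauss p. (bil p (mm p (tp m) m) y y)\<^sup>2) \<le> 3 * (tr p (mm p (tp m) m))\<^sup>2"
    by (rule gauss_bil_square_le[of _ _ "tp m"]) simp
  then show ?thesis
    unfolding bil_eq_lin[of p m] gauss_lin_fourth sum_square_eq_bil by (simp add: tr_comm)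
qed

section \<open>Invariance of the Gaussian law under (u + v) / sqrt 2\<close>

lemma distr_std_normal_half_sum:
  "distr (std_normal_distribution \<Otimes>\<^sub>M std_normal_distribution) borel (\<lambda>z. (fst z + snd z) / sqrt 2)
    = std_normal_distribution" (is "distr ?P borel ?f = _")
proof (rule Levy_uniqueness)
  have f [measurable]: "?f \<in> borel_measurable ?P" by measurable
  show "real_distribution (distr ?P borel ?f)"
    by (rule std_normal_pair.real_distribution_distr) (rule f)
  show "char (distr ?P borel ?f) = char std_normal_distribution"
  proof
    fix t
    have int: "integrable ?P (\<lambda>(x, y). iexp (t * ((x + y) / sqrt 2)))"
      by (rule std_normal_pair.integrable_const_bound[where B = 1]) (auto simp: case_prod_beta')
    have "char (distr ?P borel ?f) t = (CLINT z|?P. iexp (t * ?f z))"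
      by (simp add: char_def integral_distr)
    also have "\<dots> = (CLINT x|std_normal_distribution. CLINT y|std_normal_distribution. iexp (t * ((x + y) / sqrt 2)))"
      using std_normal_pair.integral_fst'[OF int] by (simp add: case_prod_beta')
    also have "\<dots> = (CLINT x|std_normal_distribution. CLINT y|std_normal_distribution.
        iexp (t / sqrt 2 * x) * iexp (t / sqrt 2 * y))"
      by (simp add: exp_add[symmetric] field_simps)
    also have "\<dots> = char std_normal_distribution (t / sqrt 2) * char std_normal_distribution (t / sqrt 2)"
      by (simp add: char_def)
    also have "\<dots> = char std_normal_distribution t"
      by (simp add: char_std_normal_distribution exp_add[symmetric] of_real_mult[symmetric] power_divide del: of_real_mult)
    finally show "char (distr ?P borel ?f) t = char std_normal_distribution t" .
  qed
qed (rule real_dist_normal_dist)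

definition half_sum :: "nat \<Rightarrow> (nat \<Rightarrow> real) \<Rightarrow> (nat \<Rightarrow> real) \<Rightarrow> nat \<Rightarrow> real" where
  "half_sum p u v = (\<lambda>r\<in>{..<p}. (u r + v r) / sqrt 2)"

lemma measurable_half_sum [measurable]:
  "(\<lambda>z. half_sum p (fst z) (snd z)) \<in> measurable (gauss p \<Otimes>\<^sub>M gauss p) (gauss p)"
  unfolding half_sum_def
  by (subst measurable_cong_sets[OF refl sets_gauss], rule measurable_restrict) measurable

text \<open>It suffices to compare the measures on boxes. The indicator of a box is a product over
  coordinates, so the integrals factor and the one-dimensional statement applies to each
  coordinate.\<close>

lemma distr_gauss_half_sum:
  "distr (gauss p \<Otimes>\<^sub>M gauss p) (gauss p) (\<lambda>z. half_sum p (fst z) (snd z)) = gauss p"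
    (is "distr ?P _ ?h = _")
proof -
  have "distr ?P (gauss p) ?h = Pi\<^sub>M {..<p} (\<lambda>_. std_normal_distribution)"
  proof (rule std_normals.PiM_eqI)
  show "finite {..<p}" by simp
  show "sets (distr ?P (gauss p) ?h) = sets (Pi\<^sub>M {..<p} (\<lambda>_. std_normal_distribution))"
    by (simp add: gauss_def)
  fix A :: "nat \<Rightarrow> real set"
  assume A: "\<And>i. i \<in> {..<p} \<Longrightarrow> A i \<in> sets std_normal_distribution"
  then have [measurable]: "i < p \<Longrightarrow> A i \<in> sets borel" for i by simp
  have AE: "Pi\<^sub>E {..<p} A \<in> sets (gauss p)"
    unfolding gauss_def by (intro sets_PiM_I_finite A) auto
  let ?N = "std_normal_distribution"
  let ?F = "\<lambda>r x y. indicator (A r) ((x + y) / sqrt 2) :: ennreal"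
  have "emeasure (distr ?P (gauss p) ?h) (Pi\<^sub>E {..<p} A) = (\<integral>\<^sup>+z. indicator (Pi\<^sub>E {..<p} A) (?h z) \<partial>?P)"
    by (subst nn_integral_indicator[symmetric], simp add: AE, subst nn_integral_distr)
      (auto intro: AE measurable_half_sum borel_measurable_indicator)
  also have "\<dots> = (\<integral>\<^sup>+z. (\<Prod>r<p. ?F r (fst z r) (snd z r)) \<partial>?P)"
  proof (rule nn_integral_cong)
    fix z
    show "indicator (Pi\<^sub>E {..<p} A) (?h z) = (\<Prod>r<p. ?F r (fst z r) (snd z r))"
    proof (cases "\<forall>r<p. (fst z r + snd z r) / sqrt 2 \<in> A r")
      case True
      then have "?h z \<in> Pi\<^sub>E {..<p} A" by (auto simp: half_sum_def)
      with True show ?thesis by simp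
    next
      case False
      then obtain r where r: "r < p" "(fst z r + snd z r) / sqrt 2 \<notin> A r" by blast
      then have "?h z \<notin> Pi\<^sub>E {..<p} A" by (auto simp: half_sum_def PiE_iff)
      moreover have "(\<Prod>r<p. ?F r (fst z r) (snd z r)) = 0" using r by (intro prod_zero bexI[of _ r]) auto
      ultimately show ?thesis by simp
    qed
  qed
  also have "\<dots> = (\<integral>\<^sup>+u. \<integral>\<^sup>+v. (\<Prod>r<p. ?F r (u r) (v r)) \<partial>gauss p \<partial>gauss p)"
    by (subst gauss.nn_integral_fst[symmetric]) (auto intro!: borel_measurable_prod measurable_compose[OF _ borel_measurable_indicator] simp: )
  also have "\<dots> = (\<integral>\<^sup>+u. (\<Prod>r<p. \<integral>\<^sup>+y. ?F r (u r) y \<partial>?N) \<partial>gauss p)"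
    unfolding gauss_def by (intro nn_integral_cong std_normals.product_nn_integral_prod) auto
  also have "\<dots> = (\<Prod>r<p. \<integral>\<^sup>+x. \<integral>\<^sup>+y. ?F r x y \<partial>?N \<partial>?N)"
    unfolding gauss_def by (rule std_normals.product_nn_integral_prod) auto
  also have "\<dots> = (\<Prod>r<p. emeasure ?N (A r))"
  proof (rule prod.cong[OF refl])
    fix r assume "r \<in> {..<p}"
    then have [measurable]: "A r \<in> sets borel" by simp
    have "emeasure ?N (A r) = emeasure (distr (?N \<Otimes>\<^sub>M ?N) borel (\<lambda>z. (fst z + snd z) / sqrt 2)) (A r)"
      by (simp only: distr_std_normal_half_sum)
    also have "\<dots> = (\<integral>\<^sup>+z. ?F r (fst z) (snd z) \<partial>(?N \<Otimes>\<^sub>M ?N))"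
      by (subst nn_integral_indicator[symmetric], simp, subst nn_integral_distr) auto
    also have "\<dots> = (\<integral>\<^sup>+x. \<integral>\<^sup>+y. ?F r x y \<partial>?N \<partial>?N)"
      by (subst std_normal.nn_integral_fst[symmetric]) auto
    finally show "(\<integral>\<^sup>+x. \<integral>\<^sup>+y. ?F r x y \<partial>?N \<partial>?N) = emeasure ?N (A r)" ..
  qed
  finally show "emeasure (distr ?P (gauss p) ?h) (Pi\<^sub>E {..<p} A) = (\<Prod>r<p. emeasure ?N (A r))" .
  qed
  then show ?thesis by (simp only: gauss_def)
qed

section \<open>Iterated integrals over product measures\<close>

lemma distr_pair_snd':
  assumes "prob_space M1" "prob_space M2"
  shows "distr (M1 \<Otimes>\<^sub>M M2) M2 snd = M2"
proof (rule measure_eqI)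
  interpret M1: prob_space M1 by fact
  interpret M2: prob_space M2 by fact
  fix A assume A: "A \<in> sets (distr (M1 \<Otimes>\<^sub>M M2) M2 snd)"
  then have "snd -` A \<inter> space (M1 \<Otimes>\<^sub>M M2) = space M1 \<times> A"
    using sets.sets_into_space[of A M2] by (auto simp: space_pair_measure)
  with A show "emeasure (distr (M1 \<Otimes>\<^sub>M M2) M2 snd) A = emeasure M2 A"
    by (simp add: emeasure_distr M2.emeasure_pair_measure_Times M1.emeasure_space_1)
qed simp

lemma all_moments_fst:
  assumes "prob_space M1" "prob_space M2" "all_moments M1 f"
  shows "all_moments (M1 \<Otimes>\<^sub>M M2) (\<lambda>z. f (fst z))"
  by (rule all_moments_distr[OF measurable_fst _ assms(3)]) (rule prob_space.distr_pair_fst[OF assms(2)])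

lemma all_moments_snd:
  assumes "prob_space M1" "prob_space M2" "all_moments M2 f"
  shows "all_moments (M1 \<Otimes>\<^sub>M M2) (\<lambda>z. f (snd z))"
  by (rule all_moments_distr[OF measurable_snd distr_pair_snd' assms(3)]) (rule assms)+

text \<open>The first factor is integrated innermost: in the products used later, the first
  component carries the matrix being averaged and the second the matrices conditioned upon.\<close>

lemma integral_pair_swap_snd:
  fixes f :: "'a \<times> 'b \<Rightarrow> real"
  assumes "prob_space M1" "prob_space M2" "integrable (M1 \<Otimes>\<^sub>M M2) f"
  shows "(LINT z|(M1 \<Otimes>\<^sub>M M2). f z) = (LINT y|M2. LINT x|M1. f (x, y))"
proof -
  interpret M1: prob_space M1 by fact
  interpret M2: prob_space M2 by fact
  interpret pair_prob_space M1 M2 ..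
  show ?thesis using integral_snd[of "\<lambda>x y. f (x, y)"] assms(3) by simp
qed

lemma integral_pair_mult:
  fixes f :: "'a \<Rightarrow> real" and g :: "'b \<Rightarrow> real"
  assumes M: "prob_space M1" "prob_space M2" and "all_moments M1 f" "all_moments M2 g"
  shows "(LINT z|(M1 \<Otimes>\<^sub>M M2). f (fst z) * g (snd z)) = (LINT x|M1. f x) * (LINT y|M2. g y)"
proof -
  have "integrable (M1 \<Otimes>\<^sub>M M2) (\<lambda>z. f (fst z) * g (snd z))"
    by (intro all_moments_integrable all_moments_mult all_moments_fst all_moments_snd assms)
  then show ?thesis
    by (simp add: integral_pair_swap_snd[OF M])
qed

lemma gauss_centered_square:
  "(LINT g|gauss p. (bil p m g g - tr p m)\<^sup>2) = tr p (mm p m m) + tr p (mm p m (tp m))"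
proof -
  have "(bil p m g g - tr p m)\<^sup>2 = (bil p m g g)\<^sup>2 + (- 2 * tr p m * bil p m g g + (tr p m)\<^sup>2)" for g
    by (simp add: power2_eq_square algebra_simps)
  moreover have "integrable (gauss p) (\<lambda>g. (bil p m g g)\<^sup>2)" "integrable (gauss p) (\<lambda>g. - 2 * tr p m * bil p m g g)"
    by (intro all_moments_integrable gauss.all_moments_intros all_moments_gauss; simp)+
  ultimately have "(LINT g|gauss p. (bil p m g g - tr p m)\<^sup>2)
      = (LINT g|gauss p. (bil p m g g)\<^sup>2) + (- 2 * tr p m * (LINT g|gauss p. bil p m g g) + (tr p m)\<^sup>2)"
    using gauss.prob_space[of p] by simp
  then show ?thesis
    unfolding gauss_bil_mean gauss_bil_square by (simp add: power2_eq_square)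
qed

lemma bil_half_sum:
  assumes "tp m = m"
  shows "bil p m (half_sum p u v) (half_sum p u v) = (bil p m u u + bil p m v v) / 2 + bil p m u v"
proof -
  have "bil p m (half_sum p u v) (half_sum p u v)
      = (\<Sum>r<p. \<Sum>s<p. (u r * m r s * u s + v r * m r s * v s + u r * m r s * v s + v r * m r s * u s) / 2)"
    unfolding bil_def by (intro sum.cong refl) (simp add: half_sum_def field_simps)
  also have "\<dots> = (bil p m u u + bil p m v v + bil p m u v + bil p m v u) / 2"
    by (simp add: bil_def sum.distrib sum_divide_distrib[symmetric])
  also have "bil p m v u = bil p m u v"
    using bil_commute[of p m v u] assms by simp
  finally show ?thesis by (simp add: field_simps)
qed

text \<open>This is (x + y)^2 \<le> (1 + e) x^2 + (1 + 1/e) y^2 with e = 1/2, applied twice. The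
  weights are uneven on purpose: below, the first term returns only 2 * 27/128 < 1 times the fourth
  moment under estimation, whereas the symmetric bound 8 (a^4 + b^4) would return all of it and
  could not be absorbed.\<close>

lemma fourth_power_sum_le:
  fixes a b :: real
  shows "(a + b) ^ 4 \<le> 27 / 8 * a ^ 4 + 27 * b ^ 4"
proof -
  have *: "(x + y)\<^sup>2 \<le> 3 / 2 * x\<^sup>2 + 3 * y\<^sup>2" for x y :: real
    using zero_le_power2[of "x - 2 * y"] by (simp add: power2_eq_square algebra_simps)
  have "(a + b) ^ 4 = ((a + b)\<^sup>2)\<^sup>2" by simp
  also have "\<dots> \<le> (3 / 2 * a\<^sup>2 + 3 * b\<^sup>2)\<^sup>2" by (intro power_mono *) simp
  also have "\<dots> \<le> 3 / 2 * (3 / 2 * a\<^sup>2)\<^sup>2 + 3 * (3 * b\<^sup>2)\<^sup>2" by (rule *)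
  finally show ?thesis by (simp add: power_mult_distrib power2_eq_square power4_eq_xxxx field_simps)
qed

text \<open>With \<open>u, v\<close> independent standard Gaussian vectors, \<open>(u + v) / \<surd>2\<close> is again one, and
  \<open>Y((u + v) / \<surd>2) = (Y u + Y v) / 2 + u' m v\<close> for the centered quadratic form \<open>Y\<close>. The first summand
  contributes less than one half of the fourth moment of \<open>Y\<close>, so the second one controls it.\<close>

lemma gauss_centered_fourth_le:
  assumes m: "tp m = m"
  shows "(LINT g|gauss p. (bil p m g g - tr p m) ^ 4) \<le> 430 * (tr p (mm p m m))\<^sup>2"
proof -
  let ?D = "gauss p \<Otimes>\<^sub>M gauss p"
  define Y where "Y g = bil p m g g - tr p m" for g
  define M where "M = (LINT g|gauss p. Y g ^ 4)"
  interpret D: pair_prob_space "gauss p" "gauss p" ..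
  have G: "prob_space (gauss p)" by (rule prob_space_gauss)
  have aY: "all_moments (gauss p) Y"
    unfolding Y_def by (intro gauss.all_moments_intros all_moments_gauss; simp)
  have aY1: "all_moments ?D (\<lambda>z. Y (fst z))" and aY2: "all_moments ?D (\<lambda>z. Y (snd z))"
    using aY by (auto intro: all_moments_fst all_moments_snd G)
  have aZ: "all_moments ?D (\<lambda>z. bil p m (fst z) (snd z))"
    by (intro D.all_moments_bil all_moments_fst[OF G G, of "\<lambda>g. g _"] all_moments_snd[OF G G, of "\<lambda>g. g _"] all_moments_gauss; simp)
  have Y0: "(LINT g|gauss p. Y g) = 0"
    unfolding Y_def using gauss.prob_space[of p]
    by (subst Bochner_Integration.integral_diff)
      (auto intro!: all_moments_integrable gauss.all_moments_bil all_moments_gauss simp: gauss_bil_mean)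
  have Y2: "(LINT g|gauss p. Y g ^ 2) = 2 * tr p (mm p m m)"
    unfolding Y_def gauss_centered_square m by simp
  have "M = (LINT g|distr ?D (gauss p) (\<lambda>z. half_sum p (fst z) (snd z)). Y g ^ 4)"
    by (simp only: M_def distr_gauss_half_sum)
  also have "\<dots> = (LINT z|?D. Y (half_sum p (fst z) (snd z)) ^ 4)"
    using all_moments_measurable[OF aY] by (intro integral_distr measurable_half_sum) simp
  also have "\<dots> \<le> (LINT z|?D. 27 / 128 * (Y (fst z) ^ 4 + 4 * (Y (fst z) ^ 3 * Y (snd z))
      + 6 * (Y (fst z) ^ 2 * Y (snd z) ^ 2) + 4 * (Y (fst z) * Y (snd z) ^ 3) + Y (snd z) ^ 4)
      + 27 * bil p m (fst z) (snd z) ^ 4)"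
  proof (rule integral_mono)
    have "all_moments ?D (\<lambda>z. Y (half_sum p (fst z) (snd z)))"
      by (rule all_moments_distr[OF measurable_half_sum distr_gauss_half_sum aY])
    then show "integrable ?D (\<lambda>z. Y (half_sum p (fst z) (snd z)) ^ 4)"
      by (intro all_moments_integrable D.all_moments_power)
    show "integrable ?D (\<lambda>z. 27 / 128 * (Y (fst z) ^ 4 + 4 * (Y (fst z) ^ 3 * Y (snd z))
      + 6 * (Y (fst z) ^ 2 * Y (snd z) ^ 2) + 4 * (Y (fst z) * Y (snd z) ^ 3) + Y (snd z) ^ 4)
      + 27 * bil p m (fst z) (snd z) ^ 4)"
      by (intro all_moments_integrable all_moments_add all_moments_mult D.all_moments_const
          D.all_moments_power aY1 aY2 aZ)
    fix z
    have "Y (half_sum p (fst z) (snd z)) = (Y (fst z) + Y (snd z)) / 2 + bil p m (fst z) (snd z)"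
      by (simp add: Y_def bil_half_sum[OF m] field_simps)
    also have "\<dots> ^ 4 \<le> 27 / 8 * ((Y (fst z) + Y (snd z)) / 2) ^ 4 + 27 * bil p m (fst z) (snd z) ^ 4"
      by (rule fourth_power_sum_le)
    also have "27 / 8 * ((Y (fst z) + Y (snd z)) / 2) ^ 4 = 27 / 128 * (Y (fst z) ^ 4 + 4 * (Y (fst z) ^ 3 * Y (snd z))
      + 6 * (Y (fst z) ^ 2 * Y (snd z) ^ 2) + 4 * (Y (fst z) * Y (snd z) ^ 3) + Y (snd z) ^ 4)"
      by (simp add: field_simps power2_eq_square power3_eq_cube power4_eq_xxxx)
    finally show "Y (half_sum p (fst z) (snd z)) ^ 4 \<le> 27 / 128 * (Y (fst z) ^ 4 + 4 * (Y (fst z) ^ 3 * Y (snd z))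
      + 6 * (Y (fst z) ^ 2 * Y (snd z) ^ 2) + 4 * (Y (fst z) * Y (snd z) ^ 3) + Y (snd z) ^ 4)
      + 27 * bil p m (fst z) (snd z) ^ 4" by simp
  qed
  also have "\<dots> = 27 / 128 * ((LINT z|?D. Y (fst z) ^ 4) + 4 * (LINT z|?D. Y (fst z) ^ 3 * Y (snd z))
      + 6 * (LINT z|?D. Y (fst z) ^ 2 * Y (snd z) ^ 2) + 4 * (LINT z|?D. Y (fst z) * Y (snd z) ^ 3)
      + (LINT z|?D. Y (snd z) ^ 4)) + 27 * (LINT z|?D. bil p m (fst z) (snd z) ^ 4)"
  proof -
    have "integrable ?D (\<lambda>z. Y (fst z) ^ 4)" "integrable ?D (\<lambda>z. Y (fst z) ^ 3 * Y (snd z))"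
      "integrable ?D (\<lambda>z. Y (fst z) ^ 2 * Y (snd z) ^ 2)" "integrable ?D (\<lambda>z. Y (fst z) * Y (snd z) ^ 3)"
      "integrable ?D (\<lambda>z. Y (snd z) ^ 4)" "integrable ?D (\<lambda>z. bil p m (fst z) (snd z) ^ 4)"
      by (intro all_moments_integrable all_moments_mult D.all_moments_power aY1 aY2 aZ)+
    then show ?thesis by simp
  qed
  also have "(LINT z|?D. Y (fst z) ^ 4) = M"
    using integral_pair_mult[OF G G gauss.all_moments_power[OF aY, of 4] gauss.all_moments_const[of _ 1]]
    using gauss.prob_space[of p] by (simp add: M_def)
  also have "(LINT z|?D. Y (snd z) ^ 4) = M"
    using integral_pair_mult[OF G G gauss.all_moments_const[of _ 1] gauss.all_moments_power[OF aY, of 4]]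
    using gauss.prob_space[of p] by (simp add: M_def)
  also have "(LINT z|?D. Y (fst z) ^ 3 * Y (snd z)) = 0"
    using integral_pair_mult[OF G G gauss.all_moments_power[OF aY, of 3] aY] by (simp add: Y0)
  also have "(LINT z|?D. Y (fst z) * Y (snd z) ^ 3) = 0"
    using integral_pair_mult[OF G G aY gauss.all_moments_power[OF aY, of 3]] by (simp add: Y0)
  also have "(LINT z|?D. Y (fst z) ^ 2 * Y (snd z) ^ 2) = (2 * tr p (mm p m m))\<^sup>2"
    using integral_pair_mult[OF G G gauss.all_moments_power[OF aY, of 2] gauss.all_moments_power[OF aY, of 2]]
    by (simp only: Y2) (simp add: power2_eq_square)
  finally have 1: "M \<le> 27 / 128 * (M + 4 * 0 + 6 * (2 * tr p (mm p m m))\<^sup>2 + 4 * 0 + M)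
      + 27 * (LINT z|?D. bil p m (fst z) (snd z) ^ 4)" .
  have "(LINT z|?D. bil p m (fst z) (snd z) ^ 4) = (LINT y|gauss p. LINT x|gauss p. bil p m x y ^ 4)"
    by (subst integral_pair_swap_snd[OF G G all_moments_integrable[OF D.all_moments_power[OF aZ]]]) simp
  also have "\<dots> \<le> 9 * (tr p (mm p m m))\<^sup>2"
    using gauss2_bil_fourth_le[of p m] by (simp add: m)
  finally have 2: "(LINT z|?D. bil p m (fst z) (snd z) ^ 4) \<le> 9 * (tr p (mm p m m))\<^sup>2" .
  have "M \<le> 430 * (tr p (mm p m m))\<^sup>2"
  proof -
    have *: "M \<le> 430 * q" if "M \<le> 27 / 128 * (M + 4 * 0 + 6 * (4 * q) + 4 * 0 + M) + 27 * e" "e \<le> 9 * q" "0 \<le> q"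
      for q e :: real
    proof -
      \<comment> \<open>With e \<le> 9 q this becomes 74 M \<le> 31752 q, and 31752 / 74 <
        430.\<close>
      have "128 * M \<le> 54 * M + 648 * q + 3456 * e" using that(1) by (simp add: field_simps)
      then show ?thesis using that(2,3) by linarith
    qed
    have sq: "(2 * tr p (mm p m m))\<^sup>2 = 4 * (tr p (mm p m m))\<^sup>2" by (simp add: power_mult_distrib)
    show ?thesis by (rule *[OF 1[unfolded sq] 2 zero_le_power2])
  qed
  then show ?thesis by (simp add: M_def Y_def)
qed

section \<open>Arrays of independent Gaussian vectors\<close>

lemma square_le_if_quadratic_nonneg:
  fixes a b c :: real
  assumes a: "0 \<le> a" and q: "\<And>t. 0 \<le> a * t\<^sup>2 + 2 * c * t + b"
  shows "c\<^sup>2 \<le> a * b"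
proof (cases "a = 0")
  case True
  have "c = 0"
  proof (rule ccontr)
    assume "c \<noteq> 0"
    \<comment> \<open>For \<open>a = 0\<close> the expression is affine in t, and this argument
      gives it the value -1.\<close>
    then show False using q[of "- (b + 1) / (2 * c)"] True by simp
  qed
  with True show ?thesis by simp
next
  case False
  with a have "0 < a" by simp
  then show ?thesis using q[of "- c / a"] by (simp add: field_simps power2_eq_square)
qed

lemma (in prob_space) expectation_Cauchy_Schwarz:
  assumes f: "all_moments M f" and g: "all_moments M g"
  shows "\<bar>expectation (\<lambda>x. f x * g x)\<bar> \<le> sqrt (expectation (\<lambda>x. (f x)\<^sup>2)) * sqrt (expectation (\<lambda>x. (g x)\<^sup>2))"
proof -
  let ?a = "expectation (\<lambda>x. (f x)\<^sup>2)" and ?b = "expectation (\<lambda>x. (g x)\<^sup>2)"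
    and ?c = "expectation (\<lambda>x. f x * g x)"
  have int: "integrable M (\<lambda>x. (f x)\<^sup>2)" "integrable M (\<lambda>x. (g x)\<^sup>2)" "integrable M (\<lambda>x. f x * g x)"
    by (intro all_moments_integrable all_moments_power all_moments_mult f g)+
  have "0 \<le> ?a * t\<^sup>2 + 2 * ?c * t + ?b" for t
  proof -
    have "0 \<le> expectation (\<lambda>x. (t * f x + g x)\<^sup>2)" by simp
    also have "(\<lambda>x. (t * f x + g x)\<^sup>2) = (\<lambda>x. t\<^sup>2 * (f x)\<^sup>2 + 2 * t * (f x * g x) + (g x)\<^sup>2)"
      by (simp add: power2_eq_square algebra_simps)
    also have "expectation \<dots> = t\<^sup>2 * ?a + 2 * t * ?c + ?b"
      using int by simp
    finally show ?thesis by (simp add: mult_ac)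
  qed
  then have "?c\<^sup>2 \<le> ?a * ?b" by (intro square_le_if_quadratic_nonneg) simp_all
  then have "sqrt (?c\<^sup>2) \<le> sqrt (?a * ?b)" by (rule real_sqrt_le_mono)
  then show ?thesis by (simp add: real_sqrt_mult)
qed

lemma all_moments_abs: "all_moments M f \<Longrightarrow> all_moments M (\<lambda>x. \<bar>f x\<bar>)"
  by (auto simp: all_moments_def)

lemma (in prob_space) expectation_abs_le_sqrt:
  assumes f: "all_moments M f"
  shows "expectation (\<lambda>x. \<bar>f x\<bar>) \<le> sqrt (expectation (\<lambda>x. (f x)\<^sup>2))"
  using expectation_Cauchy_Schwarz[OF all_moments_abs[OF f] all_moments_const[of 1]]
  by (simp add: prob_space)

text \<open>After expanding the square, pairs outside \<open>R\<close> vanish, and a pair in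
  \<open>R\<close> costs at most \<open>K\<close> by 2 a b \<le> a^2 + b^2. So only the number of
  dependent pairs counts: \<open>R\<close> will be the diagonal for sums of forms of single vectors,
  and the set of index pairs with a common index for off-diagonal sums.\<close>

lemma (in prob_space) expectation_sum_square_le:
  fixes f :: "'i \<Rightarrow> 'a \<Rightarrow> real"
  assumes I: "finite I" and f: "\<And>i. i \<in> I \<Longrightarrow> all_moments M (f i)" and R: "finite R"
    and 0: "\<And>i j. i \<in> I \<Longrightarrow> j \<in> I \<Longrightarrow> (i, j) \<notin> R \<Longrightarrow> expectation (\<lambda>x. f i x * f j x) = 0"
    and K: "\<And>i. i \<in> I \<Longrightarrow> expectation (\<lambda>x. (f i x)\<^sup>2) \<le> K" "0 \<le> K"
  shows "expectation (\<lambda>x. (\<Sum>i\<in>I. f i x)\<^sup>2) \<le> real (card R) * K"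
proof -
  have le: "expectation (\<lambda>x. f i x * f j x) \<le> K" if "i \<in> I" "j \<in> I" for i j
  proof -
    have am: "all_moments M (\<lambda>x. 1 / 2 * ((f i x)\<^sup>2 + (f j x)\<^sup>2))" "all_moments M (\<lambda>x. f i x * f j x)"
      by (intro all_moments_mult all_moments_add all_moments_power all_moments_const f that)+
    have "expectation (\<lambda>x. f i x * f j x) \<le> expectation (\<lambda>x. 1 / 2 * ((f i x)\<^sup>2 + (f j x)\<^sup>2))"
    proof (rule integral_mono)
      show "f i x * f j x \<le> 1 / 2 * ((f i x)\<^sup>2 + (f j x)\<^sup>2)" for x
        using sum_squares_bound[of "f i x" "f j x"] by simp
    qed (use am in \<open>blast intro: all_moments_integrable\<close>)+
    also have "\<dots> = (expectation (\<lambda>x. (f i x)\<^sup>2) + expectation (\<lambda>x. (f j x)\<^sup>2)) / 2"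
      using that f by (simp add: all_moments_integrable all_moments_power)
    also have "\<dots> \<le> K" using K(1)[of i] K(1)[of j] that by simp
    finally show ?thesis .
  qed
  have "expectation (\<lambda>x. (\<Sum>i\<in>I. f i x)\<^sup>2) = (\<Sum>i\<in>I. \<Sum>j\<in>I. expectation (\<lambda>x. f i x * f j x))"
    unfolding power2_eq_square sum_product
    by (rule trans[OF expectation_sum], (intro all_moments_sum all_moments_mult f; simp), rule sum.cong[OF refl])+
      (rule refl)
  also have "\<dots> = (\<Sum>x\<in>I\<times>I. expectation (\<lambda>w. f (fst x) w * f (snd x) w))"
    by (simp add: sum.cartesian_product case_prod_beta')
  also have "\<dots> \<le> (\<Sum>x\<in>I\<times>I. if x \<in> R then K else 0)"
    using le 0 by (intro sum_mono) (auto split: prod.splits)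
  also have "\<dots> = real (card (I\<times>I \<inter> R)) * K"
    using I by (simp add: sum.If_cases)
  also have "\<dots> \<le> real (card R) * K"
    using K(2) R by (intro mult_right_mono of_nat_mono card_mono) auto
  finally show ?thesis .
qed

text \<open>For fixed y the product is a quadratic form in x with the rank-one matrix (A y) (y' B),
  whose trace is y' B A y.\<close>

lemma gauss2_bil_mult_mean:
  "(LINT y|gauss p. LINT x|gauss p. bil p A x y * bil p B y x) = tr p (mm p A B)"
proof -
  have 1: "bil p A x y * bil p B y x
      = bil p (\<lambda>r u. (\<Sum>s<p. A r s * y s) * (\<Sum>t<p. y t * B t u)) x x" for x y
  proof -
    have "bil p B y x = (\<Sum>u<p. (\<Sum>t<p. y t * B t u) * x u)"
      unfolding bil_def by (subst sum.swap) (simp add: sum_distrib_right)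
    then have "bil p A x y * bil p B y x
        = (\<Sum>r<p. \<Sum>u<p. (x r * (\<Sum>s<p. A r s * y s)) * ((\<Sum>t<p. y t * B t u) * x u))"
      by (simp add: bil_eq_lin[of p A] sum_product)
    then show ?thesis by (simp add: bil_def mult.assoc)
  qed
  have 2: "tr p (\<lambda>r u. (\<Sum>s<p. A r s * y s) * (\<Sum>t<p. y t * B t u)) = bil p (mm p B A) y y" for y
  proof -
    have "tr p (\<lambda>r u. (\<Sum>s<p. A r s * y s) * (\<Sum>t<p. y t * B t u))
        = (\<Sum>r<p. \<Sum>s<p. \<Sum>t<p. y t * (B t r * A r s) * y s)"
      unfolding tr_def sum_product by (intro sum.cong refl) (simp add: mult_ac)
    also have "\<dots> = (\<Sum>r<p. \<Sum>t<p. \<Sum>s<p. y t * (B t r * A r s) * y s)"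
      by (intro sum.cong refl sum.swap)
    also have "\<dots> = (\<Sum>t<p. \<Sum>s<p. \<Sum>r<p. y t * (B t r * A r s) * y s)"
      by (subst sum.swap) (intro sum.cong refl sum.swap)
    finally show ?thesis by (simp add: bil_def mm_def sum_distrib_left sum_distrib_right)
  qed
  show ?thesis unfolding 1 gauss_bil_mean 2 by (rule tr_comm)
qed

section \<open>Arrays of independent Gaussian vectors\<close>

definition garr :: "nat \<Rightarrow> nat \<Rightarrow> (nat \<Rightarrow> nat \<Rightarrow> real) measure" where
  "garr n p = (\<Pi>\<^sub>M i\<in>{..<n}. gauss p)"

interpretation gauss_pair: pair_prob_space "gauss p" "gauss p" for p
  ..

interpretation gausses: product_prob_space "\<lambda>_. gauss p" "I :: nat set" for p I
  by unfold_locales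

lemma prob_space_garr: "prob_space (garr n p)"
  unfolding garr_def by (rule prob_space_PiM) (rule prob_space_gauss)

interpretation garr: prob_space "garr n p" for n p
  by (rule prob_space_garr)

lemma measurable_garr [measurable]: "i < n \<Longrightarrow> (\<lambda>v. v i) \<in> measurable (garr n p) (gauss p)"
  unfolding garr_def by (rule measurable_component_singleton) simp

lemma distr_garr: "i < n \<Longrightarrow> distr (garr n p) (gauss p) (\<lambda>v. v i) = gauss p"
  unfolding garr_def by (rule gausses.PiM_component) simp

lemma garr_indep_vars:
  assumes "0 < n"
  shows "garr.indep_vars n p (\<lambda>_. gauss p) (\<lambda>i v. v i) {..<n}"
proof (subst garr.indep_vars_iff_distr_eq_PiM')
  show "{..<n} \<noteq> {}" using assms by auto
  have "distr (garr n p) (Pi\<^sub>M {..<n} (\<lambda>_. gauss p)) (\<lambda>x. \<lambda>i\<in>{..<n}. x i)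
      = distr (garr n p) (garr n p) (\<lambda>x. x)"
    by (rule distr_cong) (auto simp: garr_def space_PiM)
  also have "\<dots> = garr n p" by (rule distr_id2) simp
  also have "\<dots> = Pi\<^sub>M {..<n} (\<lambda>i. distr (garr n p) (gauss p) (\<lambda>v. v i))"
    unfolding garr_def[of n p] by (intro PiM_cong) (simp_all add: distr_garr[unfolded garr_def])
  finally show "distr (garr n p) (Pi\<^sub>M {..<n} (\<lambda>_. gauss p)) (\<lambda>x. \<lambda>i\<in>{..<n}. x i)
      = Pi\<^sub>M {..<n} (\<lambda>i. distr (garr n p) (gauss p) (\<lambda>v. v i))" .
qed (auto intro: measurable_garr)

lemma all_moments_garr1: "i < n \<Longrightarrow> all_moments (gauss p) f \<Longrightarrow> all_moments (garr n p) (\<lambda>v. f (v i))"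
  by (rule all_moments_distr[OF measurable_garr distr_garr])

lemma all_moments_garr: "i < n \<Longrightarrow> r < p \<Longrightarrow> all_moments (garr n p) (\<lambda>v. v i r)"
  by (rule all_moments_garr1[of i n p "\<lambda>g. g r"]) (auto intro: all_moments_gauss)

lemma garr_integral1:
  fixes f :: "(nat \<Rightarrow> real) \<Rightarrow> real"
  assumes "i < n" "f \<in> borel_measurable (gauss p)"
  shows "(LINT v|garr n p. f (v i)) = (LINT g|gauss p. f g)"
  using integral_distr[OF measurable_garr[OF assms(1)] assms(2)] distr_garr[OF assms(1), of p] by simp

lemma garr_indep_var:
  assumes "A \<subseteq> {..<n}" "B \<subseteq> {..<n}" "A \<noteq> {}" "A \<inter> B = {}"
    and "F \<in> measurable (Pi\<^sub>M A (\<lambda>_. gauss p)) M" "G \<in> measurable (Pi\<^sub>M B (\<lambda>_. gauss p)) N"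
  shows "garr.indep_var n p M (\<lambda>v. F (restrict v A)) N (\<lambda>v. G (restrict v B))"
proof -
  have n: "0 < n" using assms(1,3) by auto
  have "garr.indep_var n p (Pi\<^sub>M A (\<lambda>_. gauss p)) (\<lambda>v. restrict (\<lambda>i. v i) A)
    (Pi\<^sub>M B (\<lambda>_. gauss p)) (\<lambda>v. restrict (\<lambda>i. v i) B)"
    by (rule garr.indep_var_restrict[OF garr_indep_vars[OF n]]) (use assms in auto)
  from garr.indep_var_compose[OF this assms(5,6)] show ?thesis by (simp add: comp_def)
qed

lemma distr_garr_pair:
  assumes "i < n" "j < n" "i \<noteq> j"
  shows "distr (garr n p) (gauss p \<Otimes>\<^sub>M gauss p) (\<lambda>v. (v i, v j)) = gauss p \<Otimes>\<^sub>M gauss p"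
proof -
  have "garr.indep_var n p (gauss p) (\<lambda>v. v i) (gauss p) (\<lambda>v. v j)"
    using garr_indep_var[of "{i}" n "{j}" "\<lambda>w. w i" p "gauss p" "\<lambda>w. w j" "gauss p"] assms
    by (simp add: measurable_component_singleton)
  then show ?thesis
    unfolding garr.indep_var_distribution_eq using assms by (simp add: distr_garr)
qed

lemma garr_integral2:
  fixes f :: "_ \<Rightarrow> real"
  assumes "i < n" "j < n" "i \<noteq> j" "f \<in> borel_measurable (gauss p \<Otimes>\<^sub>M gauss p)"
  shows "(LINT v|garr n p. f (v i, v j)) = (LINT z|(gauss p \<Otimes>\<^sub>M gauss p). f z)"
proof -
  have "(\<lambda>v. (v i, v j)) \<in> measurable (garr n p) (gauss p \<Otimes>\<^sub>M gauss p)"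
    using assms by measurable
  then show ?thesis
    using integral_distr[of "\<lambda>v. (v i, v j)" "garr n p" "gauss p \<Otimes>\<^sub>M gauss p" f] assms distr_garr_pair by simp
qed

lemma garr_indep_mult:
  fixes f g :: "_ \<Rightarrow> real"
  assumes ij: "i < n" "j < n" and kl: "k < n" "l < n" and disj: "{i, j} \<inter> {k, l} = {}"
    and f: "f \<in> borel_measurable (gauss p \<Otimes>\<^sub>M gauss p)" "g \<in> borel_measurable (gauss p \<Otimes>\<^sub>M gauss p)"
    and int: "integrable (garr n p) (\<lambda>v. f (v i, v j))" "integrable (garr n p) (\<lambda>v. g (v k, v l))"
  shows "(LINT v|garr n p. f (v i, v j) * g (v k, v l))
    = (LINT v|garr n p. f (v i, v j)) * (LINT v|garr n p. g (v k, v l))"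
proof -
  have "(\<lambda>w. f (w i, w j)) \<in> borel_measurable (Pi\<^sub>M {i, j} (\<lambda>_. gauss p))"
    by (intro measurable_compose[OF _ f(1)] measurable_Pair measurable_component_singleton) auto
  moreover have "(\<lambda>w. g (w k, w l)) \<in> borel_measurable (Pi\<^sub>M {k, l} (\<lambda>_. gauss p))"
    by (intro measurable_compose[OF _ f(2)] measurable_Pair measurable_component_singleton) auto
  ultimately have "garr.indep_var n p borel (\<lambda>v. f (v i, v j)) borel (\<lambda>v. g (v k, v l))"
    using garr_indep_var[of "{i, j}" n "{k, l}" "\<lambda>w. f (w i, w j)" p borel "\<lambda>w. g (w k, w l)" borel] ij kl disj
    by simp
  then show ?thesis using int by (intro garr.indep_var_lebesgue_integral)
qed

text \<open>With W the sum of the v_i v_i', this is tr (W X), and \<open>quad2\<close> is tr (W X W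
  Y). General covariances are reduced to this case by congruence.\<close>

definition quad1 :: "nat \<Rightarrow> nat \<Rightarrow> (nat \<Rightarrow> nat \<Rightarrow> real) \<Rightarrow> (nat \<Rightarrow> nat \<Rightarrow> real) \<Rightarrow> real" where
  "quad1 n p X v = (\<Sum>i<n. bil p X (v i) (v i))"

definition quad2 :: "nat \<Rightarrow> nat \<Rightarrow> (nat \<Rightarrow> nat \<Rightarrow> real) \<Rightarrow> (nat \<Rightarrow> nat \<Rightarrow> real) \<Rightarrow> (nat \<Rightarrow> nat \<Rightarrow> real) \<Rightarrow> real" where
  "quad2 n p X Y v = (\<Sum>i<n. \<Sum>j<n. bil p X (v i) (v j) * bil p Y (v j) (v i))"

lemma all_moments_garr_bil:
  "i < n \<Longrightarrow> j < n \<Longrightarrow> all_moments (garr n p) (\<lambda>v. bil p X (v i) (v j))"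
  by (intro garr.all_moments_bil all_moments_garr)

lemma all_moments_quad1: "all_moments (garr n p) (quad1 n p X)"
  unfolding quad1_def by (intro garr.all_moments_sum all_moments_garr_bil) auto

lemma all_moments_quad2: "all_moments (garr n p) (quad2 n p X Y)"
  unfolding quad2_def by (intro garr.all_moments_sum all_moments_mult all_moments_garr_bil) auto

lemma all_moments_gauss_bil: "all_moments (gauss p) (\<lambda>g. bil p X g g)"
  by (intro gauss.all_moments_bil all_moments_gauss)

lemma all_moments_gauss_pair_bil:
  "all_moments (gauss p \<Otimes>\<^sub>M gauss p) (\<lambda>z. bil p X (fst z) (snd z))"
  "all_moments (gauss p \<Otimes>\<^sub>M gauss p) (\<lambda>z. bil p X (snd z) (fst z))"
  by (intro gauss_pair.all_moments_bil
      all_moments_fst[OF prob_space_gauss prob_space_gauss, where f = "\<lambda>g. g _"]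
      all_moments_snd[OF prob_space_gauss prob_space_gauss, where f = "\<lambda>g. g _"] all_moments_gauss; simp)+

text \<open>\<open>F\<close> is left abstract so that products, squares and absolute deviations of
  the forms are all instances.\<close>

lemma garr_bil_diag:
  fixes F :: "real \<Rightarrow> real \<Rightarrow> real"
  assumes "i < n" "all_moments (gauss p) (\<lambda>g. F (bil p X g g) (bil p Y g g))"
  shows "(LINT v|garr n p. F (bil p X (v i) (v i)) (bil p Y (v i) (v i)))
    = (LINT g|gauss p. F (bil p X g g) (bil p Y g g))"
  by (rule garr_integral1[OF assms(1) all_moments_measurable[OF assms(2)]])

lemma garr_bil_offdiag:
  fixes F :: "real \<Rightarrow> real \<Rightarrow> real"
  assumes ij: "i < n" "j < n" "i \<noteq> j"
    and F: "all_moments (gauss p \<Otimes>\<^sub>M gauss p) (\<lambda>z. F (bil p X (fst z) (snd z)) (bil p Y (snd z) (fst z)))"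
  shows "(LINT v|garr n p. F (bil p X (v i) (v j)) (bil p Y (v j) (v i)))
    = (LINT y|gauss p. LINT x|gauss p. F (bil p X x y) (bil p Y y x))"
  using garr_integral2[OF ij all_moments_measurable[OF F]]
    integral_pair_swap_snd[OF prob_space_gauss prob_space_gauss all_moments_integrable[OF F]]
  by simp

section \<open>Mean and fluctuation of \<open>quad1\<close>\<close>

lemma gauss_bil_centered_square_le:
  "(LINT g|gauss p. (bil p X g g - tr p X)\<^sup>2) \<le> 2 * tr p (mm p X (tp X))"
  unfolding gauss_centered_square using tr_square_le[of p X] by linarith

lemma gauss_bil_centered_mean: "(LINT g|gauss p. bil p X g g - tr p X) = 0"
  using gauss.prob_space[of p]
  by (subst Bochner_Integration.integral_diff)
    (auto intro!: all_moments_integrable all_moments_gauss_bil simp: gauss_bil_mean)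

lemma quad1_mean: "(LINT v|garr n p. quad1 n p X v) = n * tr p X"
proof -
  have "(LINT v|garr n p. quad1 n p X v) = (\<Sum>i<n. LINT v|garr n p. bil p X (v i) (v i))"
    unfolding quad1_def by (intro garr.expectation_sum all_moments_garr_bil) auto
  also have "\<dots> = (\<Sum>i<n. tr p X)"
    using garr_bil_diag[of _ n p "\<lambda>x _. x" X X] by (intro sum.cong refl) (simp add: all_moments_gauss_bil gauss_bil_mean)
  finally show ?thesis by simp
qed

text \<open>The centered summands are orthogonal, so only the n diagonal pairs survive.\<close>

lemma quad1_variance_le:
  "(LINT v|garr n p. (quad1 n p X v - n * tr p X)\<^sup>2) \<le> 2 * real n * tr p (mm p X (tp X))"
proof -
  let ?f = "\<lambda>i v. bil p X (v i) (v i) - tr p X"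
  have am: "all_moments (gauss p) (\<lambda>g. bil p X g g - tr p X)"
    by (intro gauss.all_moments_diff all_moments_gauss_bil gauss.all_moments_const)
  have "(LINT v|garr n p. (\<Sum>i<n. ?f i v)\<^sup>2) \<le> real (card (Id_on {..<n})) * (2 * tr p (mm p X (tp X)))"
  proof (rule garr.expectation_sum_square_le)
    show "all_moments (garr n p) (?f i)" if "i \<in> {..<n}" for i
      using that by (intro garr.all_moments_diff all_moments_garr_bil garr.all_moments_const) auto
    show "finite (Id_on {..<n})" by (simp add: Id_on_def)
    show "(LINT v|garr n p. ?f i v * ?f j v) = 0" if "i \<in> {..<n}" "j \<in> {..<n}" "(i, j) \<notin> Id_on {..<n}" for i j
    proof -
      have ij: "i < n" "j < n" "i \<noteq> j" using that by auto
      have "(\<lambda>z. (bil p X (fst z) (fst z) - tr p X) * (bil p X (snd z) (snd z) - tr p X))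
          \<in> borel_measurable (gauss p \<Otimes>\<^sub>M gauss p)"
        by (intro all_moments_measurable all_moments_mult all_moments_fst[OF prob_space_gauss prob_space_gauss am]
            all_moments_snd[OF prob_space_gauss prob_space_gauss am])
      from garr_integral2[OF ij this] show ?thesis
        using integral_pair_mult[OF prob_space_gauss prob_space_gauss am am]
        by (simp add: gauss_bil_centered_mean)
    qed
    show "(LINT v|garr n p. (?f i v)\<^sup>2) \<le> 2 * tr p (mm p X (tp X))" if "i \<in> {..<n}" for i
      using garr_bil_diag[of i n p "\<lambda>x _. (x - tr p X)\<^sup>2" X X] that gauss.all_moments_power[OF am, of 2]
        gauss_bil_centered_square_le[of p X] by simp
    show "0 \<le> 2 * tr p (mm p X (tp X))" by (simp add: tr_mm_tp_nonneg)
  qed simp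
  moreover have "card (Id_on {..<n}) = n"
  proof -
    have "Id_on {..<n} = (\<lambda>i. (i, i)) ` {..<n}" by auto
    then show ?thesis by (simp add: card_image inj_on_def)
  qed
  moreover have "(\<Sum>i<n. ?f i v) = quad1 n p X v - n * tr p X" for v
    by (simp add: quad1_def sum_subtractf)
  ultimately show ?thesis by (simp add: mult_ac)
qed

lemma quad1_deviation_le:
  "(LINT v|garr n p. \<bar>quad1 n p X v - n * tr p X\<bar>) \<le> sqrt (2 * real n * tr p (mm p X (tp X)))"
proof -
  have "all_moments (garr n p) (\<lambda>v. quad1 n p X v - n * tr p X)"
    by (intro garr.all_moments_diff all_moments_quad1 garr.all_moments_const)
  from garr.expectation_abs_le_sqrt[OF this] show ?thesis
    using real_sqrt_le_mono[OF quad1_variance_le] by (rule order_trans)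
qed

section \<open>Fluctuation of \<open>quad2\<close>: diagonal and off-diagonal pairs\<close>

definition offdiag :: "nat \<Rightarrow> (nat \<times> nat) set" where
  "offdiag n = {(i, j). i < n \<and> j < n \<and> i \<noteq> j}"

lemma offdiag_subset: "offdiag n \<subseteq> {..<n} \<times> {..<n}"
  by (auto simp: offdiag_def)

lemma finite_offdiag [simp]: "finite (offdiag n)"
  by (rule finite_subset[OF offdiag_subset]) simp

lemma card_offdiag_le: "real (card (offdiag n)) \<le> (real n)\<^sup>2"
proof -
  have "card (offdiag n) \<le> card ({..<n} \<times> {..<n})" by (intro card_mono offdiag_subset) simp
  then have "card (offdiag n) \<le> n\<^sup>2" by (simp add: power2_eq_square)
  then show ?thesis by (metis of_nat_le_iff of_nat_power)
qed

lemma sum_split_offdiag: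
  fixes f :: "nat \<Rightarrow> nat \<Rightarrow> real"
  shows "(\<Sum>i<n. \<Sum>j<n. f i j) = (\<Sum>i<n. f i i) + (\<Sum>x\<in>offdiag n. f (fst x) (snd x))"
proof -
  have "{..<n} \<times> {..<n} = (\<lambda>i. (i, i)) ` {..<n} \<union> offdiag n" by (auto simp: offdiag_def)
  moreover have "(\<lambda>i. (i, i)) ` {..<n} \<inter> offdiag n = {}" by (auto simp: offdiag_def)
  ultimately have "(\<Sum>x\<in>{..<n} \<times> {..<n}. f (fst x) (snd x))
      = (\<Sum>x\<in>(\<lambda>i. (i, i)) ` {..<n}. f (fst x) (snd x)) + (\<Sum>x\<in>offdiag n. f (fst x) (snd x))"
    by (simp add: sum.union_disjoint)
  then show ?thesis
    by (simp add: sum.cartesian_product case_prod_beta' sum.reindex inj_on_def)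
qed

definition overlap :: "nat \<Rightarrow> ((nat \<times> nat) \<times> (nat \<times> nat)) set" where
  "overlap n = {(x, y). x \<in> {..<n} \<times> {..<n} \<and> y \<in> {..<n} \<times> {..<n} \<and> {fst x, snd x} \<inter> {fst y, snd y} \<noteq> {}}"

text \<open>A common index is one of four coincidences, and each of them leaves three free
  indices.\<close>

lemma card_overlap_le: "finite (overlap n) \<and> real (card (overlap n)) \<le> 4 * real n ^ 3"
proof -
  let ?C = "{..<n} \<times> {..<n} \<times> {..<n}"
  let ?f1 = "\<lambda>(i, j, l). ((i, j), (i, l))" and ?f2 = "\<lambda>(i, j, l). ((i, j), (l, i))"
    and ?f3 = "\<lambda>(i, j, l). ((i, j), (j, l))" and ?f4 = "\<lambda>(i, j, l). ((i, j), (l, j))"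
  have sub: "overlap n \<subseteq> ?f1 ` ?C \<union> ?f2 ` ?C \<union> (?f3 ` ?C \<union> ?f4 ` ?C)"
  proof
    fix w assume "w \<in> overlap n"
    then obtain i j k l where w: "w = ((i, j), (k, l))" "i < n" "j < n" "k < n" "l < n" "{i, j} \<inter> {k, l} \<noteq> {}"
      by (auto simp: overlap_def)
    then consider "k = i" | "l = i" | "k = j" | "l = j" by auto
    then show "w \<in> ?f1 ` ?C \<union> ?f2 ` ?C \<union> (?f3 ` ?C \<union> ?f4 ` ?C)"
    proof cases
      case 1 then have "w = ?f1 (i, j, l)" using w by simp
      with w show ?thesis by blast
    next
      case 2 then have "w = ?f2 (i, j, k)" using w by simp
      with w show ?thesis by blast
    next
      case 3 then have "w = ?f3 (i, j, l)" using w by simp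
      with w show ?thesis by blast
    next
      case 4 then have "w = ?f4 (i, j, k)" using w by simp
      with w show ?thesis by blast
    qed
  qed
  have c: "card (f ` ?C) \<le> n ^ 3" for f :: "_ \<Rightarrow> (nat \<times> nat) \<times> (nat \<times> nat)"
    using card_image_le[of ?C f] by (simp add: power3_eq_cube mult.assoc)
  have "card (overlap n) \<le> card (?f1 ` ?C \<union> ?f2 ` ?C \<union> (?f3 ` ?C \<union> ?f4 ` ?C))"
    by (intro card_mono sub) simp
  also have "\<dots> \<le> (card (?f1 ` ?C) + card (?f2 ` ?C)) + (card (?f3 ` ?C) + card (?f4 ` ?C))"
    by (intro order_trans[OF card_Un_le] add_mono card_Un_le)
  also have "\<dots> \<le> (n ^ 3 + n ^ 3) + (n ^ 3 + n ^ 3)" by (intro add_mono c)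
  finally have "card (overlap n) \<le> 4 * n ^ 3" by simp
  then have "real (card (overlap n)) \<le> real (4 * n ^ 3)" by (simp only: of_nat_le_iff)
  moreover have "finite (overlap n)" by (rule finite_subset[OF sub]) simp
  ultimately show ?thesis by simp
qed

text \<open>Cauchy-Schwarz separates the fourth moments of x' X y and y' Y x, each at most 9 times
  the fourth power of a Frobenius norm.\<close>

lemma gauss_pair_bil_mult_square_le:
  "(LINT y|gauss p. LINT x|gauss p. (bil p X x y * bil p Y y x)\<^sup>2)
    \<le> 9 * (tr p (mm p X (tp X)) * tr p (mm p Y (tp Y)))"
proof -
  let ?D = "gauss p \<Otimes>\<^sub>M gauss p" and ?x2 = "tr p (mm p X (tp X))" and ?y2 = "tr p (mm p Y (tp Y))"
  note G = prob_space_gauss[of p]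
  note swap = integral_pair_swap_snd[OF G G all_moments_integrable]
  have am: "all_moments ?D (\<lambda>z. (bil p X (fst z) (snd z))\<^sup>2)" "all_moments ?D (\<lambda>z. (bil p Y (snd z) (fst z))\<^sup>2)"
    by (intro gauss_pair.all_moments_power all_moments_gauss_pair_bil)+
  have "(LINT z|?D. ((bil p X (fst z) (snd z))\<^sup>2)\<^sup>2) = (LINT y|gauss p. LINT x|gauss p. (bil p X x y) ^ 4)"
    using swap[OF gauss_pair.all_moments_power[OF am(1), of 2]] by simp
  then have 1: "(LINT z|?D. ((bil p X (fst z) (snd z))\<^sup>2)\<^sup>2) \<le> 9 * ?x2\<^sup>2"
    using gauss2_bil_fourth_le[of p X] by simp
  have "(LINT z|?D. ((bil p Y (snd z) (fst z))\<^sup>2)\<^sup>2) = (LINT y|gauss p. LINT x|gauss p. (bil p (tp Y) x y) ^ 4)"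
    using swap[OF gauss_pair.all_moments_power[OF am(2), of 2]] by (simp add: bil_commute[of p Y])
  then have 2: "(LINT z|?D. ((bil p Y (snd z) (fst z))\<^sup>2)\<^sup>2) \<le> 9 * ?y2\<^sup>2"
    using gauss2_bil_fourth_le[of p "tp Y"] by (simp add: tr_comm[of p "tp Y"])
  have "(LINT y|gauss p. LINT x|gauss p. (bil p X x y * bil p Y y x)\<^sup>2)
      = (LINT z|?D. (bil p X (fst z) (snd z))\<^sup>2 * (bil p Y (snd z) (fst z))\<^sup>2)"
    using swap[OF all_moments_mult[OF am]] by (simp add: power_mult_distrib)
  also have "\<dots> \<le> sqrt (LINT z|?D. ((bil p X (fst z) (snd z))\<^sup>2)\<^sup>2) * sqrt (LINT z|?D. ((bil p Y (snd z) (fst z))\<^sup>2)\<^sup>2)"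
    using gauss_pair.expectation_Cauchy_Schwarz[OF am] by linarith
  also have "\<dots> \<le> sqrt (9 * ?x2\<^sup>2) * sqrt (9 * ?y2\<^sup>2)"
    using 1 2 by (intro mult_mono real_sqrt_le_mono) auto
  also have "\<dots> = 9 * (?x2 * ?y2)"
  proof -
    have "sqrt (9 * a\<^sup>2) = 3 * a" if "0 \<le> a" for a :: real
      using that by (simp add: real_sqrt_mult)
    then show ?thesis by (simp add: tr_mm_tp_nonneg)
  qed
  finally show ?thesis .
qed

text \<open>Centered products over disjoint index pairs are independent, so at most 4 n^3 pairs of
  pairs contribute, each at most 9 tr (X X') tr (Y Y'). The root gives 6 n^(3/2), where the triangle
  inequality would only give order n^2.\<close>

lemma offdiag_deviation_le:
  "(LINT v|garr n p. \<bar>\<Sum>x\<in>offdiag n. bil p X (v (fst x)) (v (snd x)) * bil p Y (v (snd x)) (v (fst x)) - tr p (mm p X Y)\<bar>)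
    \<le> 6 * (n * sqrt n) * sqrt (tr p (mm p X (tp X)) * tr p (mm p Y (tp Y)))"
proof -
  define c where "c = tr p (mm p X Y)"
  let ?x2 = "tr p (mm p X (tp X))" and ?y2 = "tr p (mm p Y (tp Y))"
  let ?D = "gauss p \<Otimes>\<^sub>M gauss p"
  let ?s = "\<lambda>z. bil p X (fst z) (snd z) * bil p Y (snd z) (fst z) - c"
  let ?f = "\<lambda>x v. bil p X (v (fst x)) (v (snd x)) * bil p Y (v (snd x)) (v (fst x)) - c"
  note G = prob_space_gauss[of p]
  have am0: "all_moments ?D (\<lambda>z. bil p X (fst z) (snd z) * bil p Y (snd z) (fst z))"
    by (intro all_moments_mult all_moments_gauss_pair_bil)
  have am: "all_moments ?D ?s"
    by (intro gauss_pair.all_moments_diff gauss_pair.all_moments_const am0)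
  have amf: "all_moments (garr n p) (?f x)" if "x \<in> offdiag n" for x
    using that by (intro garr.all_moments_diff garr.all_moments_const all_moments_mult all_moments_garr_bil)
      (auto simp: offdiag_def)
  have prod_mean: "(LINT z|?D. bil p X (fst z) (snd z) * bil p Y (snd z) (fst z)) = c"
    using integral_pair_swap_snd[OF G G all_moments_integrable[OF am0]] by (simp add: gauss2_bil_mult_mean c_def)
  have s_mean: "(LINT z|?D. ?s z) = 0"
    using all_moments_integrable[OF am0] gauss_pair.prob_space[of p] prod_mean by simp
  have f_mean: "(LINT v|garr n p. ?f x v) = 0" if "x \<in> offdiag n" for x
    using garr_integral2[of "fst x" n "snd x" ?s p] that all_moments_measurable[OF am] s_mean
    by (auto simp: offdiag_def)
  have s_square: "(LINT z|?D. (?s z)\<^sup>2) \<le> 9 * (?x2 * ?y2)"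
  proof -
    have "(LINT z|?D. (?s z)\<^sup>2) = (LINT z|?D. (bil p X (fst z) (snd z) * bil p Y (snd z) (fst z))\<^sup>2) - c\<^sup>2"
      using gauss_pair.variance_eq[OF all_moments_integrable[OF am0]
          all_moments_integrable[OF gauss_pair.all_moments_power[OF am0]]]
      by (simp only: prod_mean)
    also have "\<dots> \<le> (LINT z|?D. (bil p X (fst z) (snd z) * bil p Y (snd z) (fst z))\<^sup>2)" by simp
    also have "\<dots> \<le> 9 * (?x2 * ?y2)"
      using integral_pair_swap_snd[OF G G all_moments_integrable[OF gauss_pair.all_moments_power[OF am0, of 2]]]
        gauss_pair_bil_mult_square_le[of p X Y] by simp
    finally show ?thesis .
  qed
  have "(LINT v|garr n p. (\<Sum>x\<in>offdiag n. ?f x v)\<^sup>2) \<le> real (card (overlap n)) * (9 * (?x2 * ?y2))"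
  proof (rule garr.expectation_sum_square_le)
    show "finite (overlap n)" using card_overlap_le by blast
    show "0 \<le> 9 * (?x2 * ?y2)" by (simp add: tr_mm_tp_nonneg)
    show "(LINT v|garr n p. (?f x v)\<^sup>2) \<le> 9 * (?x2 * ?y2)" if "x \<in> offdiag n" for x
      using garr_integral2[of "fst x" n "snd x" "\<lambda>z. (?s z)\<^sup>2" p] that s_square
        all_moments_measurable[OF gauss_pair.all_moments_power[OF am, of 2]]
      by (auto simp: offdiag_def)
    show "(LINT v|garr n p. ?f x v * ?f y v) = 0" if x: "x \<in> offdiag n" and y: "y \<in> offdiag n" and "(x, y) \<notin> overlap n" for x y
    proof -
      have "{fst x, snd x} \<inter> {fst y, snd y} = {}"
        using that offdiag_subset by (auto simp: overlap_def offdiag_def)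
      then have "(LINT v|garr n p. ?f x v * ?f y v) = (LINT v|garr n p. ?f x v) * (LINT v|garr n p. ?f y v)"
        using garr_indep_mult[of "fst x" n "snd x" "fst y" "snd y" ?s p ?s] x y
          all_moments_measurable[OF am] all_moments_integrable[OF amf[OF x]] all_moments_integrable[OF amf[OF y]]
        by (auto simp: offdiag_def)
      then show ?thesis using f_mean[OF x] by simp
    qed
  qed (use amf in simp_all)
  also have "\<dots> \<le> (4 * real n ^ 3) * (9 * (?x2 * ?y2))"
    using card_overlap_le by (intro mult_right_mono) (auto simp: tr_mm_tp_nonneg)
  also have "\<dots> = (6 * (n * sqrt n))\<^sup>2 * (?x2 * ?y2)"
    by (simp add: power_mult_distrib) (simp add: power2_eq_square power3_eq_cube)
  finally have "sqrt (LINT v|garr n p. (\<Sum>x\<in>offdiag n. ?f x v)\<^sup>2) \<le> sqrt ((6 * (n * sqrt n))\<^sup>2 * (?x2 * ?y2))"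
    by (rule real_sqrt_le_mono)
  also have "\<dots> = 6 * (n * sqrt n) * sqrt (?x2 * ?y2)" by (simp add: real_sqrt_mult)
  finally have "sqrt (LINT v|garr n p. (\<Sum>x\<in>offdiag n. ?f x v)\<^sup>2) \<le> 6 * (n * sqrt n) * sqrt (?x2 * ?y2)" .
  moreover have "(LINT v|garr n p. \<bar>\<Sum>x\<in>offdiag n. ?f x v\<bar>) \<le> sqrt (LINT v|garr n p. (\<Sum>x\<in>offdiag n. ?f x v)\<^sup>2)"
    by (rule garr.expectation_abs_le_sqrt) (intro garr.all_moments_sum amf)
  ultimately show ?thesis unfolding c_def by linarith
qed

text \<open>Cauchy-Schwarz with the second moment 3 (tr G)^2 of the first factor and 2 tr (H H') of
  the centered second one; sqrt 6 is rounded up to 3.\<close>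

lemma diag_deviation_le:
  assumes G: "G = mm p Z (tp Z)" and i: "i < n"
  shows "(LINT v|garr n p. \<bar>bil p G (v i) (v i) * (bil p H (v i) (v i) - tr p H)\<bar>)
    \<le> 3 * tr p G * sqrt (tr p (mm p H (tp H)))"
proof -
  let ?g = "tr p G" and ?h2 = "tr p (mm p H (tp H))"
  have am: "all_moments (gauss p) (\<lambda>g. \<bar>bil p G g g\<bar>)" "all_moments (gauss p) (\<lambda>g. \<bar>bil p H g g - tr p H\<bar>)"
    by (intro all_moments_abs gauss.all_moments_diff gauss.all_moments_const all_moments_gauss_bil)+
  have g0: "0 \<le> ?g" unfolding G by (rule tr_mm_tp_nonneg)
  have "(LINT v|garr n p. \<bar>bil p G (v i) (v i) * (bil p H (v i) (v i) - tr p H)\<bar>)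
      = (LINT g|gauss p. \<bar>bil p G g g\<bar> * \<bar>bil p H g g - tr p H\<bar>)"
    using garr_bil_diag[OF i, where F = "\<lambda>x y. \<bar>x\<bar> * \<bar>y - tr p H\<bar>", OF all_moments_mult[OF am]]
    by (simp add: abs_mult)
  also have "\<dots> \<le> sqrt (LINT g|gauss p. \<bar>bil p G g g\<bar>\<^sup>2) * sqrt (LINT g|gauss p. \<bar>bil p H g g - tr p H\<bar>\<^sup>2)"
    using gauss.expectation_Cauchy_Schwarz[OF am] by linarith
  also have "\<dots> \<le> sqrt (3 * ?g\<^sup>2) * sqrt (2 * ?h2)"
    using gauss_bil_square_le[OF G] gauss_bil_centered_square_le[of p H]
    by (intro mult_mono real_sqrt_le_mono) auto
  also have "\<dots> = sqrt 6 * (?g * sqrt ?h2)"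
    using g0 by (simp add: real_sqrt_mult[symmetric] mult_ac)
      (simp add: real_sqrt_mult mult_ac)
  also have "\<dots> \<le> 3 * (?g * sqrt ?h2)"
    using g0 by (intro mult_right_mono real_le_lsqrt) (auto simp: tr_mm_tp_nonneg)
  finally show ?thesis by (simp add: mult_ac)
qed

text \<open>Takes \<open>G\<close> out of the square root, so that error bounds become linear in tr
  G.\<close>

lemma sqrt_gram_le:
  assumes G: "G = mm p Z (tp Z)" and b: "0 \<le> b"
  shows "sqrt (tr p (mm p G (tp G)) * b) \<le> tr p G * sqrt b"
proof -
  have g0: "0 \<le> tr p G" unfolding G by (rule tr_mm_tp_nonneg)
  have "sqrt (tr p (mm p G (tp G)) * b) \<le> sqrt ((tr p G)\<^sup>2 * b)"
    using b by (intro real_sqrt_le_mono mult_right_mono tr_gram_square_le[OF G])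
  then show ?thesis using g0 by (simp add: real_sqrt_mult)
qed

text \<open>The main term comes from i = j: there the H-form is replaced by tr H, and then the sum
  of the G-forms by n tr G. For i \<noteq> j the products fluctuate around tr (G H) by
  \<open>offdiag_deviation_le\<close>; their mean, at most n^2 copies of tr (G H), remains as the
  last error term.\<close>

lemma quad2_deviation_le:
  assumes G: "G = mm p Z (tp Z)"
  shows "(LINT v|garr n p. \<bar>quad2 n p G H v - n * tr p G * tr p H\<bar>)
    \<le> 9 * (n * sqrt n) * tr p G * sqrt (tr p (mm p H (tp H))) + 2 * sqrt n * tr p G * \<bar>tr p H\<bar>
      + (real n)\<^sup>2 * \<bar>tr p (mm p G H)\<bar>"
proof -
  let ?g = "tr p G" and ?h = "tr p H" and ?h2 = "tr p (mm p H (tp H))" and ?c = "tr p (mm p G H)"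
  have g0: "0 \<le> ?g" unfolding G by (rule tr_mm_tp_nonneg)
  let ?d = "\<lambda>i v. bil p G (v i) (v i) * (bil p H (v i) (v i) - ?h)"
  let ?u = "\<lambda>v. \<Sum>x\<in>offdiag n. bil p G (v (fst x)) (v (snd x)) * bil p H (v (snd x)) (v (fst x)) - ?c"
  have dec: "quad2 n p G H v - n * ?g * ?h
      = (\<Sum>i<n. ?d i v) + ?h * (quad1 n p G v - n * ?g) + ?u v + card (offdiag n) * ?c" for v
    unfolding quad2_def sum_split_offdiag quad1_def
    by (simp add: right_diff_distrib sum_subtractf sum_distrib_left[symmetric] sum_distrib_right[symmetric] mult_ac)
  have am: "all_moments (garr n p) (\<lambda>v. \<bar>?d i v\<bar>)" if "i \<in> {..<n}" for i
    using that by (intro all_moments_abs all_moments_mult garr.all_moments_diff garr.all_moments_const all_moments_garr_bil) auto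
  have amq: "all_moments (garr n p) (\<lambda>v. \<bar>quad1 n p G v - n * ?g\<bar>)"
    by (intro all_moments_abs garr.all_moments_diff garr.all_moments_const all_moments_quad1)
  have amu: "all_moments (garr n p) (\<lambda>v. \<bar>?u v\<bar>)"
    by (intro all_moments_abs garr.all_moments_sum garr.all_moments_diff garr.all_moments_const all_moments_mult all_moments_garr_bil)
      (auto simp: offdiag_def)
  have "(LINT v|garr n p. \<bar>quad2 n p G H v - n * ?g * ?h\<bar>)
      \<le> (LINT v|garr n p. (\<Sum>i<n. \<bar>?d i v\<bar>) + \<bar>?h\<bar> * \<bar>quad1 n p G v - n * ?g\<bar> + \<bar>?u v\<bar> + (real n)\<^sup>2 * \<bar>?c\<bar>)"
  proof (rule integral_mono)
    show "integrable (garr n p) (\<lambda>v. \<bar>quad2 n p G H v - n * ?g * ?h\<bar>)"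
      by (intro all_moments_integrable all_moments_abs garr.all_moments_diff garr.all_moments_const all_moments_quad2)
    show "integrable (garr n p) (\<lambda>v. (\<Sum>i<n. \<bar>?d i v\<bar>) + \<bar>?h\<bar> * \<bar>quad1 n p G v - n * ?g\<bar> + \<bar>?u v\<bar> + (real n)\<^sup>2 * \<bar>?c\<bar>)"
      by (intro all_moments_integrable all_moments_add garr.all_moments_sum am all_moments_mult amq amu garr.all_moments_const)
    fix v
    have "\<bar>\<Sum>i<n. ?d i v\<bar> \<le> (\<Sum>i<n. \<bar>?d i v\<bar>)" by (rule sum_abs)
    moreover have "\<bar>card (offdiag n) * ?c\<bar> \<le> (real n)\<^sup>2 * \<bar>?c\<bar>"
      unfolding abs_mult using card_offdiag_le[of n] by (intro mult_right_mono) auto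
    moreover have "\<bar>?h * (quad1 n p G v - n * ?g)\<bar> = \<bar>?h\<bar> * \<bar>quad1 n p G v - n * ?g\<bar>" by (rule abs_mult)
    ultimately show "\<bar>quad2 n p G H v - n * ?g * ?h\<bar> \<le> (\<Sum>i<n. \<bar>?d i v\<bar>) + \<bar>?h\<bar> * \<bar>quad1 n p G v - n * ?g\<bar> + \<bar>?u v\<bar> + (real n)\<^sup>2 * \<bar>?c\<bar>"
      unfolding dec by linarith
  qed
  also have "\<dots> = (\<Sum>i<n. LINT v|garr n p. \<bar>?d i v\<bar>) + \<bar>?h\<bar> * (LINT v|garr n p. \<bar>quad1 n p G v - n * ?g\<bar>)
      + (LINT v|garr n p. \<bar>?u v\<bar>) + (real n)\<^sup>2 * \<bar>?c\<bar>"
  proof -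
    have "integrable (garr n p) (\<lambda>v. \<Sum>i<n. \<bar>?d i v\<bar>)"
      "integrable (garr n p) (\<lambda>v. \<bar>?h\<bar> * \<bar>quad1 n p G v - n * ?g\<bar>)" "integrable (garr n p) (\<lambda>v. \<bar>?u v\<bar>)"
      by (intro all_moments_integrable garr.all_moments_sum am all_moments_mult amq amu garr.all_moments_const; assumption)+
    then show ?thesis
      using garr.prob_space[of n p] garr.expectation_sum[OF am, of "{..<n}" "\<lambda>i. i"] by simp
  qed
  also have "\<dots> \<le> (\<Sum>i<n. 3 * ?g * sqrt ?h2) + \<bar>?h\<bar> * (2 * sqrt n * ?g)
      + 6 * (n * sqrt n) * (?g * sqrt ?h2) + (real n)\<^sup>2 * \<bar>?c\<bar>"
  proof (intro add_mono order_refl sum_mono mult_left_mono)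
    show "(LINT v|garr n p. \<bar>?d i v\<bar>) \<le> 3 * ?g * sqrt ?h2" if "i \<in> {..<n}" for i
      using that by (intro diag_deviation_le[OF G]) simp
    have "(LINT v|garr n p. \<bar>quad1 n p G v - n * ?g\<bar>) \<le> sqrt (tr p (mm p G (tp G)) * (2 * real n))"
      using quad1_deviation_le[of n p G] by (simp add: mult_ac)
    also have "\<dots> \<le> ?g * sqrt (2 * real n)" by (rule sqrt_gram_le[OF G]) simp
    also have "\<dots> \<le> ?g * sqrt (2\<^sup>2 * n)" by (intro mult_left_mono g0 real_sqrt_le_mono) simp
    also have "\<dots> = 2 * sqrt n * ?g" by (simp add: real_sqrt_mult)
    finally show "(LINT v|garr n p. \<bar>quad1 n p G v - n * ?g\<bar>) \<le> 2 * sqrt n * ?g" .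
    have "(LINT v|garr n p. \<bar>?u v\<bar>) \<le> 6 * (n * sqrt n) * sqrt (tr p (mm p G (tp G)) * ?h2)"
      by (rule offdiag_deviation_le)
    also have "\<dots> \<le> 6 * (n * sqrt n) * (?g * sqrt ?h2)"
      by (intro mult_left_mono sqrt_gram_le[OF G] tr_mm_tp_nonneg) simp
    finally show "(LINT v|garr n p. \<bar>?u v\<bar>) \<le> 6 * (n * sqrt n) * (?g * sqrt ?h2)" .
  qed simp
  also have "(\<Sum>i<n. 3 * ?g * sqrt ?h2) \<le> 3 * (n * sqrt n) * (?g * sqrt ?h2)"
  proof -
    \<comment> \<open>This lets the diagonal error with factor 3 join the off-diagonal one with
      factor 6, giving 9.\<close>
    have "real n \<le> n * sqrt n" by (cases n) auto
    then have "real n * (3 * (?g * sqrt ?h2)) \<le> (n * sqrt n) * (3 * (?g * sqrt ?h2))"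
      using g0 by (intro mult_right_mono) (auto simp: tr_mm_tp_nonneg)
    then show ?thesis by (simp add: mult_ac)
  qed
  finally show ?thesis by (simp add: mult_ac)
qed

text \<open>tr (Z Z' Y Y') is the squared Frobenius norm of Y' Z.\<close>

lemma tr_gram_mult_nonneg:
  assumes "G = mm p Z (tp Z)" "H = mm p Y (tp Y)"
  shows "0 \<le> tr p (mm p G H)"
proof -
  have "tr p (mm p G H) = tr p (mm p (mm p (tp Y) Z) (tp (mm p (tp Y) Z)))"
    unfolding assms tp_mm tp_tp mm_assoc
    by (subst (2) tr_comm) (simp only: mm_assoc)
  then show ?thesis by (simp add: tr_mm_tp_nonneg)
qed

text \<open>Only the order of magnitude is wanted, so the diagonal is estimated by Cauchy-Schwarz;
  off the diagonal the mean is exactly tr (G H).\<close>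

lemma quad2_mean_le:
  assumes G: "G = mm p Z (tp Z)" and H: "H = mm p Y (tp Y)"
  shows "(LINT v|garr n p. quad2 n p G H v) \<le> 3 * real n * tr p G * tr p H + (real n)\<^sup>2 * tr p (mm p G H)"
proof -
  let ?g = "tr p G" and ?h = "tr p H" and ?c = "tr p (mm p G H)"
  have g0: "0 \<le> ?g" "0 \<le> ?h" unfolding G H by (rule tr_mm_tp_nonneg)+
  have am: "all_moments (garr n p) (\<lambda>v. bil p G (v i) (v j) * bil p H (v j) (v i))" if "i < n" "j < n" for i j
    using that by (intro all_moments_mult all_moments_garr_bil)
  have diag: "(LINT v|garr n p. bil p G (v i) (v i) * bil p H (v i) (v i)) \<le> 3 * ?g * ?h" if "i < n" for i
  proof -
    have "(LINT v|garr n p. bil p G (v i) (v i) * bil p H (v i) (v i)) = (LINT g|gauss p. bil p G g g * bil p H g g)"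
      by (rule garr_bil_diag[OF that]) (intro all_moments_mult all_moments_gauss_bil)
    also have "\<dots> \<le> sqrt (LINT g|gauss p. (bil p G g g)\<^sup>2) * sqrt (LINT g|gauss p. (bil p H g g)\<^sup>2)"
      using gauss.expectation_Cauchy_Schwarz[OF all_moments_gauss_bil[of p G] all_moments_gauss_bil[of p H]]
      by linarith
    also have "\<dots> \<le> sqrt (3 * ?g\<^sup>2) * sqrt (3 * ?h\<^sup>2)"
      using gauss_bil_square_le[OF G] gauss_bil_square_le[OF H] by (intro mult_mono real_sqrt_le_mono) auto
    also have "\<dots> = 3 * ?g * ?h" using g0 by (simp add: real_sqrt_mult)
    finally show ?thesis .
  qed
  have off: "(LINT v|garr n p. bil p G (v (fst x)) (v (snd x)) * bil p H (v (snd x)) (v (fst x))) = ?c"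
    if "x \<in> offdiag n" for x
    using garr_bil_offdiag[of "fst x" n "snd x" p "\<lambda>x y. x * y" G H] that
      all_moments_mult[OF all_moments_gauss_pair_bil]
    by (auto simp: offdiag_def gauss2_bil_mult_mean)
  have "(LINT v|garr n p. quad2 n p G H v)
      = (\<Sum>i<n. LINT v|garr n p. bil p G (v i) (v i) * bil p H (v i) (v i))
        + (\<Sum>x\<in>offdiag n. LINT v|garr n p. bil p G (v (fst x)) (v (snd x)) * bil p H (v (snd x)) (v (fst x)))"
    unfolding quad2_def sum_split_offdiag
    by (subst Bochner_Integration.integral_add, (intro all_moments_integrable garr.all_moments_sum am; auto simp: offdiag_def)+,
        intro arg_cong2[where f = "(+)"] garr.expectation_sum am) (auto simp: offdiag_def)
  also have "\<dots> \<le> (\<Sum>i<n. 3 * ?g * ?h) + (\<Sum>x\<in>offdiag n. ?c)"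
    using diag off by (intro add_mono sum_mono) auto
  also have "\<dots> \<le> 3 * real n * ?g * ?h + (real n)\<^sup>2 * ?c"
    using mult_right_mono[OF card_offdiag_le[of n] tr_gram_mult_nonneg[OF G H]] by (simp add: mult_ac)
  finally show ?thesis .
qed

text \<open>Meant for a non-symmetric \<open>X\<close>. No cancellation is used off the diagonal: |a
  b| \<le> (a^2 + b^2) / 2, and both squares have mean tr (X X'). On the diagonal the square has
  mean (tr X)^2 + tr (X X) + tr (X X').\<close>

lemma quad2_self_abs_mean_le:
  "(LINT v|garr n p. \<bar>quad2 n p X X v\<bar>)
    \<le> n * ((tr p X)\<^sup>2 + 2 * tr p (mm p X (tp X))) + (real n)\<^sup>2 * tr p (mm p X (tp X))"
proof -
  let ?x2 = "tr p (mm p X (tp X))"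
  let ?a = "\<lambda>x v. (1 / 2) * ((bil p X (v (fst x)) (v (snd x)))\<^sup>2 + (bil p X (v (snd x)) (v (fst x)))\<^sup>2)"
  have am: "all_moments (garr n p) (\<lambda>v. (bil p X (v i) (v j))\<^sup>2)" if "i < n" "j < n" for i j
    using that by (intro garr.all_moments_power all_moments_garr_bil)
  have ama: "all_moments (garr n p) (?a x)" if "x \<in> offdiag n" for x
    using that by (intro all_moments_add all_moments_mult garr.all_moments_const am) (auto simp: offdiag_def)
  have "(LINT v|garr n p. \<bar>quad2 n p X X v\<bar>) \<le> (LINT v|garr n p. (\<Sum>i<n. (bil p X (v i) (v i))\<^sup>2) + (\<Sum>x\<in>offdiag n. ?a x v))"
  proof (rule integral_mono)
    show "integrable (garr n p) (\<lambda>v. \<bar>quad2 n p X X v\<bar>)"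
      by (intro all_moments_integrable all_moments_abs all_moments_quad2)
    show "integrable (garr n p) (\<lambda>v. (\<Sum>i<n. (bil p X (v i) (v i))\<^sup>2) + (\<Sum>x\<in>offdiag n. ?a x v))"
      by (intro all_moments_integrable all_moments_add garr.all_moments_sum am ama) auto
    fix v
    have "\<bar>\<Sum>x\<in>offdiag n. bil p X (v (fst x)) (v (snd x)) * bil p X (v (snd x)) (v (fst x))\<bar> \<le> (\<Sum>x\<in>offdiag n. ?a x v)"
    proof (rule order_trans[OF sum_abs sum_mono])
      have "\<bar>a * b\<bar> \<le> (1 / 2) * (a\<^sup>2 + b\<^sup>2)" for a b :: real
        using sum_squares_bound[of "\<bar>a\<bar>" "\<bar>b\<bar>"] by (simp add: abs_mult)
      then show "\<bar>bil p X (v (fst x)) (v (snd x)) * bil p X (v (snd x)) (v (fst x))\<bar> \<le> ?a x v" for x .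
    qed
    moreover have "0 \<le> (\<Sum>i<n. (bil p X (v i) (v i))\<^sup>2)" by (simp add: sum_nonneg)
    ultimately show "\<bar>quad2 n p X X v\<bar> \<le> (\<Sum>i<n. (bil p X (v i) (v i))\<^sup>2) + (\<Sum>x\<in>offdiag n. ?a x v)"
      unfolding quad2_def sum_split_offdiag power2_eq_square[symmetric] by linarith
  qed
  also have "\<dots> = (\<Sum>i<n. LINT v|garr n p. (bil p X (v i) (v i))\<^sup>2) + (\<Sum>x\<in>offdiag n. LINT v|garr n p. ?a x v)"
    by (subst Bochner_Integration.integral_add, (intro all_moments_integrable garr.all_moments_sum am ama; simp)+,
        intro arg_cong2[where f = "(+)"] garr.expectation_sum am ama) auto
  also have "\<dots> \<le> (\<Sum>i<n. (tr p X)\<^sup>2 + 2 * ?x2) + (\<Sum>x\<in>offdiag n. ?x2)"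
  proof (intro add_mono sum_mono)
    show "(LINT v|garr n p. (bil p X (v i) (v i))\<^sup>2) \<le> (tr p X)\<^sup>2 + 2 * ?x2" if "i \<in> {..<n}" for i
      using garr_bil_diag[of i n p "\<lambda>x _. x\<^sup>2" X X] that gauss.all_moments_power[OF all_moments_gauss_bil, of p X 2]
        tr_square_le[of p X] by (simp add: gauss_bil_square)
    have sq: "(LINT v|garr n p. (bil p X (v i) (v j))\<^sup>2) = ?x2" if "i < n" "j < n" "i \<noteq> j" for i j
      using garr_bil_offdiag[OF that, of p "\<lambda>x _. x\<^sup>2" X X] gauss_pair.all_moments_power[OF all_moments_gauss_pair_bil(1), of p X 2]
      by (simp add: gauss2_bil_square)
    show "(LINT v|garr n p. ?a x v) \<le> ?x2" if "x \<in> offdiag n" for x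
      using that sq am by (auto simp: offdiag_def all_moments_integrable)
  qed
  also have "\<dots> \<le> n * ((tr p X)\<^sup>2 + 2 * ?x2) + (real n)\<^sup>2 * ?x2"
    using mult_right_mono[OF card_offdiag_le[of n] tr_mm_tp_nonneg[of p X]] by simp
  finally show ?thesis .
qed

section \<open>Characteristic functions of centered quadratic forms\<close>

lemma exp_minus_bound:
  fixes x :: real
  assumes "0 \<le> x"
  shows "\<bar>(1 - x) - exp (- x)\<bar> \<le> x\<^sup>2 / 2"
proof -
  have 1: "1 - x \<le> exp (- x)" using exp_ge_add_one_self[of "- x"] by simp
  have "1 + x + x\<^sup>2 / 2 \<le> exp x" by (rule exp_lower_Taylor_quadratic[OF assms])
  moreover have pos: "0 < 1 + x + x\<^sup>2 / 2"
    using assms by (simp add: add_pos_nonneg)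
  ultimately have "exp (- x) \<le> 1 / (1 + x + x\<^sup>2 / 2)"
    by (simp add: exp_minus inverse_eq_divide frac_le)
  also have "\<dots> \<le> 1 - x + x\<^sup>2 / 2"
  proof -
    \<comment> \<open>The product equals 1 + x^4 / 4.\<close>
    have "1 \<le> (1 - x + x\<^sup>2 / 2) * (1 + x + x\<^sup>2 / 2)"
      using assms by (simp add: power2_eq_square field_simps)
    then show ?thesis using pos by (simp add: divide_le_eq)
  qed
  finally show ?thesis using 1 by linarith
qed

text \<open>This is a + sqrt (2 b) for the coefficients a of V and b of V^2 which the expansion in
  \<open>quad1_char_le\<close> produces. The square root, of order n^(-1/4) for fixed t, is the
  price of linearity in V.\<close>

definition clt_rate :: "real \<Rightarrow> nat \<Rightarrow> real" where
  "clt_rate t n = \<bar>t\<bar> ^ 3 / (12 * sqrt n) + sqrt (2 * (9 * \<bar>t\<bar> ^ 3 / sqrt n + t ^ 4 / (8 * n)))"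

text \<open>Trades the quadratic term for a linear one, so that later only the mean of \<open>V\<close> has to be controlled.\<close>

lemma min_quadratic_le:
  fixes a b V x :: real
  assumes "x \<le> 2" "x \<le> a * V + b * V\<^sup>2" "0 \<le> a" "0 \<le> b" "0 \<le> V"
  shows "x \<le> (a + sqrt (2 * b)) * V"
proof -
  have "x - a * V \<le> sqrt (2 * b) * V"
  proof (cases "b * V\<^sup>2 \<le> 2")
    case True
    have "(b * V\<^sup>2)\<^sup>2 \<le> 2 * (b * V\<^sup>2)"
      unfolding power2_eq_square[of "b * V\<^sup>2"] using True assms by (intro mult_right_mono) auto
    then have "b * V\<^sup>2 \<le> sqrt (2 * b * V\<^sup>2)" by (intro real_le_rsqrt) (simp add: mult_ac)
    then show ?thesis using assms by (simp add: real_sqrt_mult)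
  next
    case False
    then have "sqrt (2\<^sup>2) \<le> sqrt (2 * b * V\<^sup>2)" by (intro real_sqrt_le_mono) simp
    then have "2 \<le> sqrt (2 * b) * V" using assms by (simp add: real_sqrt_mult)
    moreover have "0 \<le> a * V" using assms by simp
    ultimately show ?thesis using assms(1) by linarith
  qed
  then show ?thesis by (simp add: algebra_simps)
qed

text \<open>By independence the characteristic function is \<phi>^n; it is compared with \<psi>^n,
  where \<psi> = exp (- t^2 s), by |\<phi>^n - \<psi>^n| \<le> n |\<phi> - \<psi>|. Both bases are
  close to 1 - t^2 s: \<phi> by Taylor expansion with a third-moment remainder, \<psi> by
  \<open>exp_minus_bound\<close>. Since the fourth moment is at most 430 s^2, all errors depend on
  the matrix only through V = 2 n s.\<close>

lemma quad1_char_le: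
  fixes n p :: nat and t :: real
  assumes m: "tp m = m" and n: "0 < n"
  defines "V \<equiv> 2 * real n * tr p (mm p m m)"
  shows "cmod ((CLINT v|garr n p. iexp (t * (quad1 n p m v - n * tr p m))) - exp (- (t\<^sup>2 * V) / 2))
    \<le> clt_rate t n * V"
proof -
  define s where "s = tr p (mm p m m)"
  define Y where "Y g = bil p m g g - tr p m" for g
  define \<mu> where "\<mu> = distr (gauss p) borel Y"
  define \<phi> where "\<phi> = char \<mu> t"
  define \<psi> where "\<psi> = exp (- (t\<^sup>2 * s))"
  have s0: "0 \<le> s" using tr_mm_tp_nonneg[of p m] by (simp add: s_def m)
  have V: "V = 2 * real n * s" by (simp add: V_def s_def)
  have V0: "0 \<le> V" using s0 by (simp add: V)
  have aY: "all_moments (gauss p) Y"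
    unfolding Y_def by (intro gauss.all_moments_diff all_moments_gauss_bil gauss.all_moments_const)
  have mY [measurable]: "Y \<in> borel_measurable (gauss p)" by (rule all_moments_measurable[OF aY])
  interpret \<mu>: real_distribution \<mu>
    unfolding \<mu>_def by (rule gauss.real_distribution_distr[OF mY])
  have Y0: "(LINT g|gauss p. Y g) = 0"
    unfolding Y_def by (rule gauss_bil_centered_mean)
  have Y2: "(LINT g|gauss p. (Y g)\<^sup>2) = 2 * s"
    unfolding Y_def gauss_centered_square m by (simp add: s_def)
  have Y4: "(LINT g|gauss p. (Y g) ^ 4) \<le> 430 * s\<^sup>2"
    unfolding Y_def s_def by (rule gauss_centered_fourth_le[OF m])
  have eq_prod: "iexp (t * (quad1 n p m v - n * tr p m)) = (\<Prod>i<n. iexp (t * Y (v i)))" for v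
  proof -
    have "quad1 n p m v - n * tr p m = (\<Sum>i<n. Y (v i))"
      by (simp add: quad1_def Y_def sum_subtractf)
    then show ?thesis by (simp add: sum_distrib_left exp_sum[symmetric])
  qed
  have "(CLINT v|garr n p. iexp (t * (quad1 n p m v - n * tr p m))) = (\<Prod>i<n. CLINT g|gauss p. iexp (t * Y g))"
    unfolding eq_prod garr_def
    by (rule gausses.product_integral_prod) (auto intro!: gauss.integrable_const_bound[where B = 1])
  also have "\<dots> = \<phi> ^ n"
    by (simp add: \<phi>_def \<mu>_def char_def integral_distr)
  finally have lhs: "(CLINT v|garr n p. iexp (t * (quad1 n p m v - n * tr p m))) = \<phi> ^ n" .
  have rhs: "exp (- (t\<^sup>2 * V) / 2) = \<psi> ^ n"
    by (simp add: \<psi>_def V exp_of_nat_mult[symmetric])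
  have \<phi>1: "cmod \<phi> \<le> 1" unfolding \<phi>_def by (rule \<mu>.cmod_char_le_1)
  have \<psi>1: "\<bar>\<psi>\<bar> \<le> 1" using s0 by (simp add: \<psi>_def)
  \<comment> \<open>The third absolute moment is interpolated by |y|^3 \<le> (\<epsilon> y^2 + y^4 /
    \<epsilon>) / 2. As s = V / (2 n), this choice makes both n \<epsilon> s and n s^2 / \<epsilon>
    of order n^(-1/2).\<close>
  define \<epsilon> where "\<epsilon> = 1 / sqrt n"
  have \<epsilon>: "0 < \<epsilon>" using n by (simp add: \<epsilon>_def)
  have third: "(LINT g|gauss p. min (6 * (Y g)\<^sup>2) (\<bar>t\<bar> * \<bar>Y g\<bar> ^ 3)) \<le> \<bar>t\<bar> * (\<epsilon> * s + 215 * s\<^sup>2 / \<epsilon>)"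
  proof -
    have am: "all_moments (gauss p) (\<lambda>g. \<bar>t\<bar> * (1 / 2 * (\<epsilon> * (Y g)\<^sup>2 + 1 / \<epsilon> * (Y g) ^ 4)))"
      by (intro all_moments_mult all_moments_add gauss.all_moments_const gauss.all_moments_power aY)
    have "(LINT g|gauss p. min (6 * (Y g)\<^sup>2) (\<bar>t\<bar> * \<bar>Y g\<bar> ^ 3))
        \<le> (LINT g|gauss p. \<bar>t\<bar> * (1 / 2 * (\<epsilon> * (Y g)\<^sup>2 + 1 / \<epsilon> * (Y g) ^ 4)))"
    proof (rule integral_mono)
      show "integrable (gauss p) (\<lambda>g. min (6 * (Y g)\<^sup>2) (\<bar>t\<bar> * \<bar>Y g\<bar> ^ 3))"
        by (intro integrable_min all_moments_integrable all_moments_mult gauss.all_moments_const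
            gauss.all_moments_power all_moments_abs aY)
      show "integrable (gauss p) (\<lambda>g. \<bar>t\<bar> * (1 / 2 * (\<epsilon> * (Y g)\<^sup>2 + 1 / \<epsilon> * (Y g) ^ 4)))"
        by (rule all_moments_integrable[OF am])
      fix g
      have "\<bar>y\<bar> ^ 3 \<le> 1 / 2 * (\<epsilon> * y\<^sup>2 + 1 / \<epsilon> * y ^ 4)" for y :: real
      proof -
        have "0 \<le> y\<^sup>2 * (\<epsilon> - \<bar>y\<bar>)\<^sup>2 / (2 * \<epsilon>)" using \<epsilon> by simp
        also have "\<dots> = 1 / 2 * (\<epsilon> * y\<^sup>2 + 1 / \<epsilon> * (y\<^sup>2 * \<bar>y\<bar>\<^sup>2)) - \<bar>y\<bar>\<^sup>2 * \<bar>y\<bar>"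
          using \<epsilon> by (simp add: field_simps power2_eq_square)
        also have "y\<^sup>2 * \<bar>y\<bar>\<^sup>2 = y ^ 4" by (simp add: power2_eq_square power4_eq_xxxx)
        also have "\<bar>y\<bar>\<^sup>2 * \<bar>y\<bar> = \<bar>y\<bar> ^ 3" by (simp only: power2_eq_square power3_eq_cube)
        finally show ?thesis by simp
      qed
      then have "\<bar>t\<bar> * \<bar>Y g\<bar> ^ 3 \<le> \<bar>t\<bar> * (1 / 2 * (\<epsilon> * (Y g)\<^sup>2 + 1 / \<epsilon> * (Y g) ^ 4))"
        by (intro mult_left_mono) auto
      then show "min (6 * (Y g)\<^sup>2) (\<bar>t\<bar> * \<bar>Y g\<bar> ^ 3) \<le> \<bar>t\<bar> * (1 / 2 * (\<epsilon> * (Y g)\<^sup>2 + 1 / \<epsilon> * (Y g) ^ 4))"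
        by linarith
    qed
    also have "\<dots> = \<bar>t\<bar> * (1 / 2 * (\<epsilon> * (LINT g|gauss p. (Y g)\<^sup>2) + 1 / \<epsilon> * (LINT g|gauss p. (Y g) ^ 4)))"
      using all_moments_integrable[OF gauss.all_moments_power[OF aY]] by simp
    also have "\<dots> \<le> \<bar>t\<bar> * (1 / 2 * (\<epsilon> * (2 * s) + 1 / \<epsilon> * (430 * s\<^sup>2)))"
      using Y2 Y4 \<epsilon> by (intro mult_left_mono add_mono) auto
    also have "1 / 2 * (\<epsilon> * (2 * s) + 1 / \<epsilon> * (430 * s\<^sup>2)) = \<epsilon> * s + 215 * s\<^sup>2 / \<epsilon>"
      using \<epsilon> by (simp add: field_simps)
    finally show ?thesis .
  qed
  have "cmod (\<phi> - (1 - t\<^sup>2 * (2 * s) / 2)) \<le> t\<^sup>2 / 6 * (LINT g|gauss p. min (6 * (Y g)\<^sup>2) (\<bar>t\<bar> * \<bar>Y g\<bar> ^ 3))"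
    unfolding \<phi>_def
    by (rule gauss.char_approx3'[OF mY all_moments_integrable[OF aY] all_moments_integrable[OF gauss.all_moments_power[OF aY]] Y0 _ \<mu>_def])
      (simp add: Y0 Y2)
  also have "\<dots> \<le> t\<^sup>2 / 6 * (\<bar>t\<bar> * (\<epsilon> * s + 215 * s\<^sup>2 / \<epsilon>))"
    by (intro mult_left_mono third) simp
  finally have A: "cmod (\<phi> - of_real (1 - t\<^sup>2 * s)) \<le> t\<^sup>2 / 6 * (\<bar>t\<bar> * (\<epsilon> * s + 215 * s\<^sup>2 / \<epsilon>))"
    by simp
  have B: "cmod (of_real (1 - t\<^sup>2 * s) - of_real \<psi>) \<le> (t\<^sup>2 * s)\<^sup>2 / 2"
    unfolding of_real_diff[symmetric] norm_of_real \<psi>_def real_norm_def using s0 by (intro exp_minus_bound) simp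
  have "cmod (\<phi> - of_real \<psi>) \<le> cmod (\<phi> - of_real (1 - t\<^sup>2 * s)) + cmod (of_real (1 - t\<^sup>2 * s) - of_real \<psi>)"
    using norm_triangle_ineq[of "\<phi> - of_real (1 - t\<^sup>2 * s)" "of_real (1 - t\<^sup>2 * s) - of_real \<psi>"] by simp
  with A B have C: "cmod (\<phi> - of_real \<psi>) \<le> t\<^sup>2 / 6 * (\<bar>t\<bar> * (\<epsilon> * s + 215 * s\<^sup>2 / \<epsilon>)) + (t\<^sup>2 * s)\<^sup>2 / 2"
    by linarith
  have "cmod (\<phi> ^ n - (of_real \<psi>) ^ n) \<le> n * cmod (\<phi> - of_real \<psi>)"
    using \<phi>1 \<psi>1 by (intro norm_power_diff) auto
  also have "\<dots> \<le> n * (t\<^sup>2 / 6 * (\<bar>t\<bar> * (\<epsilon> * s + 215 * s\<^sup>2 / \<epsilon>)) + (t\<^sup>2 * s)\<^sup>2 / 2)"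
    by (intro mult_left_mono C) simp
  also have "\<dots> = \<bar>t\<bar> ^ 3 / (12 * sqrt n) * V + (\<bar>t\<bar> ^ 3 * 215 / (24 * sqrt n) + t ^ 4 / (8 * n)) * V\<^sup>2"
  proof -
    have "t\<^sup>2 = \<bar>t\<bar>\<^sup>2" by simp
    then have t3: "t\<^sup>2 * \<bar>t\<bar> = \<bar>t\<bar> ^ 3" by (simp only: power2_eq_square power3_eq_cube)
    have key: "T / 6 * (w * w * (1 / w) * s + 215 * (w * w * w) * s\<^sup>2)
        = T / (12 * w) * (2 * (w * w) * s) + T * 215 / (24 * w) * (2 * (w * w) * s)\<^sup>2" if "w \<noteq> 0" for T w :: real
      using that by (simp add: field_simps power2_eq_square)
    have "n * (t\<^sup>2 / 6 * (\<bar>t\<bar> * (\<epsilon> * s + 215 * s\<^sup>2 / \<epsilon>))) = (t\<^sup>2 * \<bar>t\<bar>) / 6 * (real n * \<epsilon> * s + 215 * (real n * sqrt n) * s\<^sup>2)"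
      by (simp add: \<epsilon>_def field_simps)
    also have "\<dots> = \<bar>t\<bar> ^ 3 / (12 * sqrt n) * V + \<bar>t\<bar> ^ 3 * 215 / (24 * sqrt n) * V\<^sup>2"
      unfolding t3 V \<epsilon>_def using key[of "sqrt n" "\<bar>t\<bar> ^ 3"] n by simp
    finally have e1: "n * (t\<^sup>2 / 6 * (\<bar>t\<bar> * (\<epsilon> * s + 215 * s\<^sup>2 / \<epsilon>)))
        = \<bar>t\<bar> ^ 3 / (12 * sqrt n) * V + \<bar>t\<bar> ^ 3 * 215 / (24 * sqrt n) * V\<^sup>2" .
    have e2: "n * ((t\<^sup>2 * s)\<^sup>2 / 2) = t ^ 4 / (8 * n) * V\<^sup>2"
      using n by (simp add: V field_simps power2_eq_square power4_eq_xxxx)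
    show ?thesis
      unfolding distrib_left[of "real n"] distrib_right[of _ _ "V\<^sup>2"] e1 e2 by (rule add.assoc)
  qed
  also have "\<dots> \<le> \<bar>t\<bar> ^ 3 / (12 * sqrt n) * V + (9 * \<bar>t\<bar> ^ 3 / sqrt n + t ^ 4 / (8 * n)) * V\<^sup>2"
  proof -
    \<comment> \<open>215 is half of the fourth-moment constant 430, and 215 / 24 < 9.\<close>
    have "\<bar>t\<bar> ^ 3 * 215 / (24 * sqrt n) \<le> 9 * \<bar>t\<bar> ^ 3 / sqrt n"
      using n by (simp add: field_simps mult_right_mono)
    then show ?thesis by (intro add_left_mono mult_right_mono add_right_mono) auto
  qed
  finally have D: "cmod (\<phi> ^ n - (of_real \<psi>) ^ n)
      \<le> \<bar>t\<bar> ^ 3 / (12 * sqrt n) * V + (9 * \<bar>t\<bar> ^ 3 / sqrt n + t ^ 4 / (8 * n)) * V\<^sup>2" .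
  \<comment> \<open>The trivial bound 2 is what makes the quadratic bound harmless for large
    V.\<close>
  have "cmod (\<phi> ^ n - (of_real \<psi>) ^ n) \<le> cmod (\<phi> ^ n) + cmod ((of_real \<psi>) ^ n)"
    by (rule norm_triangle_ineq4)
  also have "\<dots> \<le> 1 + 1"
    unfolding norm_power using \<phi>1 \<psi>1 by (intro add_mono power_le_one) auto
  finally have "cmod (\<phi> ^ n - (of_real \<psi>) ^ n) \<le> 2" by simp
  from min_quadratic_le[OF this D _ _ V0]
  have "cmod (\<phi> ^ n - (of_real \<psi>) ^ n) \<le> clt_rate t n * V"
    by (simp add: clt_rate_def)
  then show ?thesis unfolding lhs rhs by simp
qed

section \<open>Traces of Wishart matrices\<close>

text \<open>Since \<open>ennreal\<close> maps negative numbers to \<open>0\<close>, this bounds the mean of the positive part of \<open>f\<close>.\<close>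

definition mean_le :: "'a measure \<Rightarrow> ('a \<Rightarrow> real) \<Rightarrow> real \<Rightarrow> bool" where
  "mean_le M f c \<longleftrightarrow> f \<in> borel_measurable M \<and> 0 \<le> c \<and> (\<integral>\<^sup>+x. ennreal (f x) \<partial>M) \<le> ennreal c"

section \<open>Calculus of mean bounds\<close>

lemma mean_leI:
  assumes "all_moments M f" "\<And>x. 0 \<le> f x" "(LINT x|M. f x) \<le> c"
  shows "mean_le M f c"
proof -
  have "0 \<le> (LINT x|M. f x)" using assms(2) by (simp add: integral_nonneg_AE)
  then have "0 \<le> c" using assms(3) by linarith
  moreover have "(\<integral>\<^sup>+x. ennreal (f x) \<partial>M) = ennreal (LINT x|M. f x)"
    using assms(1,2) by (intro nn_integral_eq_integral all_moments_integrable) auto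
  ultimately show ?thesis
    using all_moments_measurable[OF assms(1)] assms(3) by (simp add: mean_le_def ennreal_leI)
qed

lemma mean_le_add:
  assumes "mean_le M f c" "mean_le M g d"
  shows "mean_le M (\<lambda>x. f x + g x) (c + d)"
proof -
  have [measurable]: "f \<in> borel_measurable M" "g \<in> borel_measurable M" using assms by (auto simp: mean_le_def)
  have "(\<integral>\<^sup>+x. ennreal (f x + g x) \<partial>M) \<le> (\<integral>\<^sup>+x. ennreal (f x) + ennreal (g x) \<partial>M)"
  proof (rule nn_integral_mono)
    fix x
    have "ennreal (f x + g x) \<le> ennreal (max 0 (f x) + max 0 (g x))" by (intro ennreal_leI) auto
    also have "\<dots> = ennreal (f x) + ennreal (g x)"
      by (subst ennreal_plus) (auto simp: max_def ennreal_neg)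
    finally show "ennreal (f x + g x) \<le> ennreal (f x) + ennreal (g x)" .
  qed
  also have "\<dots> = (\<integral>\<^sup>+x. ennreal (f x) \<partial>M) + (\<integral>\<^sup>+x. ennreal (g x) \<partial>M)" by (rule nn_integral_add) auto
  also have "\<dots> \<le> ennreal c + ennreal d" using assms by (intro add_mono) (auto simp: mean_le_def)
  also have "\<dots> = ennreal (c + d)" using assms by (simp add: mean_le_def)
  finally show ?thesis using assms by (simp add: mean_le_def)
qed

lemma mean_le_cmult:
  assumes "mean_le M f c" "0 \<le> k"
  shows "mean_le M (\<lambda>x. k * f x) (k * c)"
proof -
  have [measurable]: "f \<in> borel_measurable M" using assms by (auto simp: mean_le_def)
  have "(\<integral>\<^sup>+x. ennreal (k * f x) \<partial>M) = ennreal k * (\<integral>\<^sup>+x. ennreal (f x) \<partial>M)"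
    using assms(2) by (simp add: ennreal_mult' nn_integral_cmult)
  also have "\<dots> \<le> ennreal k * ennreal c" using assms by (intro mult_left_mono) (auto simp: mean_le_def)
  also have "\<dots> = ennreal (k * c)" using assms by (simp add: mean_le_def ennreal_mult')
  finally show ?thesis using assms by (simp add: mean_le_def)
qed

lemma mean_le_mono:
  assumes "mean_le M g c" "f \<in> borel_measurable M" "\<And>x. x \<in> space M \<Longrightarrow> f x \<le> g x" "c \<le> d"
  shows "mean_le M f d"
proof -
  have "(\<integral>\<^sup>+x. ennreal (f x) \<partial>M) \<le> (\<integral>\<^sup>+x. ennreal (g x) \<partial>M)"
    by (intro nn_integral_mono ennreal_leI assms(3))
  also have "\<dots> \<le> ennreal c" using assms by (simp add: mean_le_def)
  also have "\<dots> \<le> ennreal d" by (intro ennreal_leI assms)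
  finally show ?thesis using assms by (simp add: mean_le_def)
qed

lemma mean_le_weaken: "mean_le M f c \<Longrightarrow> c \<le> d \<Longrightarrow> mean_le M f d"
  by (rule mean_le_mono[OF _ _ order_refl]) (auto simp only: mean_le_def)

lemma mean_le_const: "prob_space M \<Longrightarrow> 0 \<le> c \<Longrightarrow> mean_le M (\<lambda>_. c) c"
  by (simp add: mean_le_def prob_space.emeasure_space_1)

text \<open>Tonelli for positive parts: the conditional mean is bounded by \<open>h\<close>, then
  the mean of \<open>h\<close> by \<open>c\<close>. Without an integrability condition,
  \<open>h\<close> may contain square roots and absolute values of traces.\<close>

lemma mean_le_pair:
  assumes M: "prob_space M1" "prob_space M2" and f: "f \<in> borel_measurable (M1 \<Otimes>\<^sub>M M2)"
    and 1: "\<And>y. y \<in> space M2 \<Longrightarrow> mean_le M1 (\<lambda>x. f (x, y)) (h y)" and 2: "mean_le M2 h c"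
  shows "mean_le (M1 \<Otimes>\<^sub>M M2) f c"
proof -
  interpret M1: prob_space M1 by fact
  interpret M2: prob_space M2 by fact
  interpret pair_prob_space M1 M2 ..
  have [measurable]: "f \<in> borel_measurable (M1 \<Otimes>\<^sub>M M2)" by fact
  have "(\<integral>\<^sup>+z. ennreal (f z) \<partial>(M1 \<Otimes>\<^sub>M M2)) = (\<integral>\<^sup>+y. \<integral>\<^sup>+x. ennreal (f (x, y)) \<partial>M1 \<partial>M2)"
    by (rule nn_integral_snd[symmetric]) simp
  also have "\<dots> \<le> (\<integral>\<^sup>+y. ennreal (h y) \<partial>M2)"
    using 1 by (intro nn_integral_mono) (auto simp: mean_le_def)
  also have "\<dots> \<le> ennreal c" using 2 by (simp add: mean_le_def)
  finally show ?thesis using 2 f by (simp add: mean_le_def)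
qed

lemma mean_le_pair_snd:
  assumes "prob_space M1" "prob_space M2" "mean_le M2 h c"
  shows "mean_le (M1 \<Otimes>\<^sub>M M2) (\<lambda>z. h (snd z)) c"
proof -
  interpret M1: prob_space M1 by fact
  interpret M2: prob_space M2 by fact
  interpret pair_prob_space M1 M2 ..
  have [measurable]: "h \<in> borel_measurable M2" using assms(3) by (simp add: mean_le_def)
  have "(\<integral>\<^sup>+z. ennreal (h (snd z)) \<partial>(M1 \<Otimes>\<^sub>M M2)) = (\<integral>\<^sup>+y. \<integral>\<^sup>+x. ennreal (h y) \<partial>M1 \<partial>M2)"
    by (subst nn_integral_snd[symmetric]) simp_all
  also have "\<dots> = (\<integral>\<^sup>+y. ennreal (h y) \<partial>M2)" by (simp add: M1.emeasure_space_1)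
  finally show ?thesis using assms(3) by (simp add: mean_le_def)
qed

text \<open>The substitution v = L g turns v' X v into g' (L' X L) g. The identities below express
  traces of such congruences through L L' alone.\<close>

definition cong_mat :: "nat \<Rightarrow> (nat \<Rightarrow> nat \<Rightarrow> real) \<Rightarrow> (nat \<Rightarrow> nat \<Rightarrow> real) \<Rightarrow> nat \<Rightarrow> nat \<Rightarrow> real" where
  "cong_mat p L X = mm p (tp L) (mm p X L)"

lemma tr_cong_mat: "tr p (cong_mat p L X) = tr p (mm p (mm p L (tp L)) X)"
  unfolding cong_mat_def by (subst tr_comm) (simp only: mm_assoc tr_comm[of p X])

lemma tr_cong_mat_mult:
  "tr p (mm p (cong_mat p L X) (cong_mat p L Y))
    = tr p (mm p (mm p L (tp L)) (mm p X (mm p (mm p L (tp L)) Y)))"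
  unfolding cong_mat_def mm_assoc by (subst (2) tr_comm) (simp only: mm_assoc)

lemma tp_cong_mat: "tp (cong_mat p L X) = cong_mat p L (tp X)"
  by (simp add: cong_mat_def tp_mm mm_assoc)

lemma cong_mat_gram: "cong_mat p L (mm p Z (tp Z)) = mm p (mm p (tp L) Z) (tp (mm p (tp L) Z))"
  by (simp add: cong_mat_def tp_mm mm_assoc)

text \<open>A Wishart matrix with parameter L L', as a function of the underlying standard Gaussian
  array.\<close>

definition wish :: "nat \<Rightarrow> nat \<Rightarrow> (nat \<Rightarrow> nat \<Rightarrow> real) \<Rightarrow> (nat \<Rightarrow> nat \<Rightarrow> real) \<Rightarrow> nat \<Rightarrow> nat \<Rightarrow> real" where
  "wish n p L v = (\<lambda>r s. \<Sum>i<n. lin p L (v i) r * lin p L (v i) s)"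

lemma tp_wish: "tp (wish n p L v) = wish n p L v"
  by (intro ext) (simp add: tp_def wish_def mult.commute)

lemma tr_wish: "tr p (mm p (wish n p L v) X) = quad1 n p (cong_mat p L X) v"
proof -
  have "tr p (mm p (wish n p L v) X) = (\<Sum>r<p. \<Sum>s<p. \<Sum>i<n. lin p L (v i) s * X s r * lin p L (v i) r)"
    by (simp add: tr_mm wish_def sum_distrib_right sum_distrib_left mult_ac)
  also have "\<dots> = (\<Sum>r<p. \<Sum>i<n. \<Sum>s<p. lin p L (v i) s * X s r * lin p L (v i) r)"
    by (intro sum.cong refl sum.swap)
  also have "\<dots> = (\<Sum>i<n. \<Sum>r<p. \<Sum>s<p. lin p L (v i) s * X s r * lin p L (v i) r)" by (rule sum.swap)
  also have "\<dots> = (\<Sum>i<n. bil p X (lin p L (v i)) (lin p L (v i)))"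
    unfolding bil_def by (intro sum.cong refl sum.swap)
  finally show ?thesis by (simp add: bil_lin quad1_def cong_mat_def)
qed

lemma tr_wish2:
  "tr p (mm p (wish n p L v) (mm p X (mm p (wish n p L v) Y))) = quad2 n p (cong_mat p L X) (cong_mat p L Y) v"
proof -
  define x where "x i = lin p L (v i)" for i
  \<comment> \<open>\<open>a X i\<close> is the row vector x_i' X, so the product of the Wishart
    matrix with X is the sum of the x_i (x_i' X).\<close>
  define a where "a X i s = (\<Sum>t<p. x i t * X t s)" for X :: "nat \<Rightarrow> nat \<Rightarrow> real" and i s
  have TX: "mm p (wish n p L v) X r s = (\<Sum>i<n. x i r * a X i s)" for X r s
  proof -
    have "mm p (wish n p L v) X r s = (\<Sum>t<p. \<Sum>i<n. x i r * (x i t * X t s))"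
      by (simp add: mm_def wish_def x_def sum_distrib_right mult.assoc)
    also have "\<dots> = (\<Sum>i<n. \<Sum>t<p. x i r * (x i t * X t s))" by (rule sum.swap)
    finally show ?thesis by (simp add: a_def sum_distrib_left)
  qed
  have bil_a: "(\<Sum>s<p. a X i s * x j s) = bil p X (x i) (x j)" for X i j
    unfolding a_def bil_def sum_distrib_right by (rule sum.swap)
  have "tr p (mm p (wish n p L v) (mm p X (mm p (wish n p L v) Y)))
      = tr p (mm p (mm p (wish n p L v) X) (mm p (wish n p L v) Y))" by (simp only: mm_assoc)
  also have "\<dots> = (\<Sum>r<p. \<Sum>s<p. \<Sum>i<n. \<Sum>j<n. (a X i s * x j s) * (a Y j r * x i r))"
    unfolding tr_mm TX sum_product by (intro sum.cong refl) (simp add: mult_ac)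
  also have "\<dots> = (\<Sum>r<p. \<Sum>i<n. \<Sum>s<p. \<Sum>j<n. (a X i s * x j s) * (a Y j r * x i r))"
    by (intro sum.cong refl sum.swap)
  also have "\<dots> = (\<Sum>i<n. \<Sum>r<p. \<Sum>j<n. \<Sum>s<p. (a X i s * x j s) * (a Y j r * x i r))"
    by (subst sum.swap) (intro sum.cong refl sum.swap)
  also have "\<dots> = (\<Sum>i<n. \<Sum>j<n. \<Sum>r<p. \<Sum>s<p. (a X i s * x j s) * (a Y j r * x i r))"
    by (intro sum.cong refl sum.swap)
  also have "\<dots> = (\<Sum>i<n. \<Sum>j<n. bil p X (x i) (x j) * bil p Y (x j) (x i))"
    unfolding bil_a[symmetric] sum_product by (intro sum.cong refl sum.swap)
  finally show ?thesis by (simp add: quad2_def x_def bil_lin cong_mat_def)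
qed

text \<open>For symmetric \<open>T\<close> the trace is the squared Frobenius norm of Y' T
  Z.\<close>

lemma tr_gram2_nonneg: "tp T = T \<Longrightarrow> 0 \<le> tr p (mm p T (mm p (mm p Z (tp Z)) (mm p T (mm p Y (tp Y)))))"
proof -
  assume T: "tp T = T"
  have "tr p (mm p T (mm p (mm p Z (tp Z)) (mm p T (mm p Y (tp Y)))))
      = tr p (mm p (mm p (tp Y) (mm p T Z)) (tp (mm p (tp Y) (mm p T Z))))"
    unfolding tp_mm tp_tp mm_assoc T by (subst (2) tr_comm) (simp only: mm_assoc)
  then show ?thesis by (simp add: tr_mm_tp_nonneg)
qed

section \<open>Bounds for a single Wishart matrix\<close>

lemma wish_deviation:
  assumes S: "S = mm p L (tp L)"
  shows "mean_le (garr n p) (\<lambda>v. \<bar>tr p (mm p (wish n p L v) X) - n * tr p (mm p S X)\<bar>)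
    (sqrt (2 * real n * tr p (mm p S (mm p X (mm p S (tp X))))))"
  using quad1_deviation_le[of n p "cong_mat p L X"]
  unfolding tp_cong_mat tr_cong_mat_mult tr_cong_mat S[symmetric] tr_wish
  by (intro mean_leI all_moments_abs garr.all_moments_diff garr.all_moments_const all_moments_quad1) auto

lemma wish_square:
  assumes S: "S = mm p L (tp L)"
  shows "mean_le (garr n p) (\<lambda>v. (tr p (mm p (wish n p L v) X))\<^sup>2)
    ((n * tr p (mm p S X))\<^sup>2 + 2 * real n * tr p (mm p S (mm p X (mm p S (tp X)))))"
proof -
  have "(LINT v|garr n p. (quad1 n p (cong_mat p L X) v)\<^sup>2)
      = (LINT v|garr n p. (quad1 n p (cong_mat p L X) v - n * tr p (cong_mat p L X))\<^sup>2) + (n * tr p (cong_mat p L X))\<^sup>2"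
    using garr.variance_eq[OF all_moments_integrable[OF all_moments_quad1]
        all_moments_integrable[OF garr.all_moments_power[OF all_moments_quad1]]]
    by (simp add: quad1_mean)
  also have "\<dots> \<le> 2 * real n * tr p (mm p (cong_mat p L X) (tp (cong_mat p L X))) + (n * tr p (cong_mat p L X))\<^sup>2"
    by (intro add_right_mono quad1_variance_le)
  finally show ?thesis
    unfolding tp_cong_mat tr_cong_mat_mult tr_cong_mat S[symmetric] tr_wish
    by (intro mean_leI garr.all_moments_power all_moments_quad1) (auto simp: add.commute)
qed

lemma wish2_deviation:
  assumes S: "S = mm p L (tp L)" and G: "G = mm p Z (tp Z)"
  shows "mean_le (garr n p) (\<lambda>v. \<bar>tr p (mm p (wish n p L v) (mm p G (mm p (wish n p L v) H)))
      - n * tr p (mm p S G) * tr p (mm p S H)\<bar>)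
    (9 * (n * sqrt n) * tr p (mm p S G) * sqrt (tr p (mm p S (mm p H (mm p S (tp H)))))
      + 2 * sqrt n * tr p (mm p S G) * \<bar>tr p (mm p S H)\<bar> + (real n)\<^sup>2 * \<bar>tr p (mm p S (mm p G (mm p S H)))\<bar>)"
  using quad2_deviation_le[of "cong_mat p L G" p "mm p (tp L) Z" n "cong_mat p L H", unfolded G, OF cong_mat_gram, folded G]
  unfolding tp_cong_mat tr_cong_mat_mult tr_cong_mat S[symmetric] tr_wish2
  by (intro mean_leI all_moments_abs garr.all_moments_diff garr.all_moments_const all_moments_quad2) auto

lemma wish2_mean:
  assumes S: "S = mm p L (tp L)" and G: "G = mm p Z (tp Z)" and H: "H = mm p Y (tp Y)"
  shows "mean_le (garr n p) (\<lambda>v. tr p (mm p (wish n p L v) (mm p G (mm p (wish n p L v) H))))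
    (3 * real n * tr p (mm p S G) * tr p (mm p S H) + (real n)\<^sup>2 * tr p (mm p S (mm p G (mm p S H))))"
proof (rule mean_leI)
  show "0 \<le> tr p (mm p (wish n p L v) (mm p G (mm p (wish n p L v) H)))" for v
    unfolding G H by (intro tr_gram2_nonneg tp_wish)
  show "all_moments (garr n p) (\<lambda>v. tr p (mm p (wish n p L v) (mm p G (mm p (wish n p L v) H))))"
    unfolding tr_wish2 by (rule all_moments_quad2)
  show "(LINT v|garr n p. tr p (mm p (wish n p L v) (mm p G (mm p (wish n p L v) H))))
    \<le> 3 * real n * tr p (mm p S G) * tr p (mm p S H) + (real n)\<^sup>2 * tr p (mm p S (mm p G (mm p S H)))"
    using quad2_mean_le[of "cong_mat p L G" p "mm p (tp L) Z" "cong_mat p L H" "mm p (tp L) Y" n,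
        unfolded G H, OF cong_mat_gram cong_mat_gram, folded G H]
    unfolding tr_cong_mat_mult tr_cong_mat S[symmetric] tr_wish2 by simp
qed

lemma wish2_self:
  assumes S: "S = mm p L (tp L)"
  shows "mean_le (garr n p) (\<lambda>v. \<bar>tr p (mm p (wish n p L v) (mm p X (mm p (wish n p L v) X)))\<bar>)
    (n * ((tr p (mm p S X))\<^sup>2 + 2 * tr p (mm p S (mm p X (mm p S (tp X)))))
      + (real n)\<^sup>2 * tr p (mm p S (mm p X (mm p S (tp X)))))"
  using quad2_self_abs_mean_le[of n p "cong_mat p L X"]
  unfolding tp_cong_mat tr_cong_mat_mult tr_cong_mat S[symmetric] tr_wish2
  by (intro mean_leI all_moments_abs all_moments_quad2) auto

lemma wish_integral:
  assumes S: "S = mm p L (tp L)"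
  shows "integrable (garr n p) (\<lambda>v. tr p (mm p (wish n p L v) X))"
    and "(LINT v|garr n p. tr p (mm p (wish n p L v) X)) = n * tr p (mm p S X)"
  unfolding tr_wish quad1_mean tr_cong_mat S
  by (auto intro: all_moments_integrable all_moments_quad1)

text \<open>C = L' X L need not be symmetric, but \<open>quad1_char_le\<close> asks for symmetry.
  The symmetrization \<open>m\<close> defines the same form up to the factor c, and 2 tr (m m) = c^2
  (tr (C C) + tr (C C')) is the origin of the two terms of V.\<close>

lemma wish_char:
  fixes n p :: nat and t c :: real and S X :: "nat \<Rightarrow> nat \<Rightarrow> real"
  assumes S: "S = mm p L (tp L)" and n: "0 < n"
  defines "V \<equiv> c\<^sup>2 * real n * (tr p (mm p S (mm p X (mm p S X))) + tr p (mm p S (mm p X (mm p S (tp X)))))"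
  shows "cmod ((CLINT v|garr n p. iexp (t * (c * (tr p (mm p (wish n p L v) X) - n * tr p (mm p S X)))))
      - exp (- (t\<^sup>2 * V) / 2)) \<le> clt_rate t n * V"
proof -
  define C where "C = cong_mat p L X"
  define m where "m r s = c * ((C r s + C s r) / 2)" for r s
  have tpm: "tp m = m" by (intro ext) (simp add: tp_def m_def add.commute)
  have bilm: "bil p m x x = c * bil p C x x" for x
  proof -
    have "bil p m x x = c * ((bil p C x x + bil p (tp C) x x) / 2)"
      by (simp add: bil_def m_def tp_def sum_distrib_left sum.distrib[symmetric] sum_divide_distrib algebra_simps)
    also have "bil p (tp C) x x = bil p C x x" by (rule bil_commute[symmetric])
    finally show ?thesis by simp
  qed
  have q: "quad1 n p m v = c * quad1 n p C v" for v
    by (simp add: quad1_def bilm sum_distrib_left)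
  have trm: "tr p m = c * tr p C" by (simp add: tr_def m_def sum_distrib_left)
  have "tr p (mm p m m) = (\<Sum>r<p. \<Sum>s<p. c\<^sup>2 / 4 * (C r s * C r s + C s r * C s r + 2 * (C r s * C s r)))"
    unfolding tr_mm m_def by (intro sum.cong refl) (simp add: power2_eq_square field_simps)
  also have "\<dots> = c\<^sup>2 / 4 * (tr p (mm p C (tp C)) + tr p (mm p (tp C) C) + 2 * tr p (mm p C C))"
    by (simp add: tr_mm tp_def sum.distrib sum_distrib_left distrib_left)
  also have "tr p (mm p (tp C) C) = tr p (mm p C (tp C))" by (rule tr_comm)
  finally have "tr p (mm p m m) = c\<^sup>2 / 2 * (tr p (mm p C C) + tr p (mm p C (tp C)))" by (simp add: field_simps)
  then have V: "V = 2 * real n * tr p (mm p m m)"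
    unfolding V_def C_def tp_cong_mat tr_cong_mat_mult S[symmetric] by (simp add: field_simps)
  have "c * (tr p (mm p (wish n p L v) X) - n * tr p (mm p S X)) = quad1 n p m v - n * tr p m" for v
    unfolding q trm C_def tr_cong_mat S[symmetric] tr_wish by (simp add: algebra_simps)
  then show ?thesis
    using quad1_char_le[OF tpm n, of p t] unfolding V[symmetric] by simp
qed

text \<open>Jensen's inequality for the square root, from sqrt f \<le> (sqrt c + f / sqrt c) / 2.
  The \<open>max 0\<close> covers points with f < 0, where the real \<open>sqrt\<close> is
  negative.\<close>

lemma mean_le_sqrt:
  assumes M: "prob_space M" and f: "mean_le M f c" "0 < c"
  shows "mean_le M (\<lambda>x. sqrt (f x)) (sqrt c)"
proof (rule mean_le_mono)
  show "mean_le M (\<lambda>x. 1 / 2 * (sqrt c + 1 / sqrt c * max 0 (f x))) (1 / 2 * (sqrt c + 1 / sqrt c * c))"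
  proof (intro mean_le_cmult mean_le_add mean_le_const[OF M])
    have "f \<in> borel_measurable M" using f by (simp add: mean_le_def)
    moreover have "ennreal (max 0 y) = ennreal y" for y by (simp add: max_def ennreal_neg)
    ultimately show "mean_le M (\<lambda>x. max 0 (f x)) c" using f by (simp add: mean_le_def)
  qed (use f in auto)
  have "(sqrt :: real \<Rightarrow> real) \<in> borel_measurable borel"
    by (intro borel_measurable_continuous_onI continuous_on_real_sqrt continuous_on_id)
  then show "(\<lambda>x. sqrt (f x)) \<in> borel_measurable M"
    using f by (auto simp: mean_le_def intro: measurable_compose)
  show "1 / 2 * (sqrt c + 1 / sqrt c * c) \<le> sqrt c" using f(2) by (simp add: real_div_sqrt)
  show "sqrt (f x) \<le> 1 / 2 * (sqrt c + 1 / sqrt c * max 0 (f x))" for x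
  proof (cases "0 \<le> f x")
    case True
    have "sqrt c * (2 * sqrt (f x)) \<le> sqrt c * sqrt c + sqrt (f x) * sqrt (f x)"
      using sum_squares_bound[of "sqrt c" "sqrt (f x)"] by (simp add: power2_eq_square mult_ac)
    then show ?thesis using f(2) True by (simp add: field_simps)
  next
    case False
    then have "sqrt (f x) \<le> 0" by simp
    then show ?thesis using f(2) by (intro order_trans[OF \<open>sqrt (f x) \<le> 0\<close>]) auto
  qed
qed

lemma (in prob_space) all_moments_mm:
  assumes "\<And>r s. all_moments M (\<lambda>x. A x r s)" "\<And>r s. all_moments M (\<lambda>x. B x r s)"
  shows "all_moments M (\<lambda>x. mm p (A x) (B x) r s)"
  unfolding mm_def by (intro all_moments_sum all_moments_mult assms)

lemma (in prob_space) all_moments_tr: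
  assumes "\<And>r s. all_moments M (\<lambda>x. A x r s)"
  shows "all_moments M (\<lambda>x. tr p (A x))"
  unfolding tr_def by (intro all_moments_sum assms)

lemma all_moments_wish: "all_moments (garr n p) (\<lambda>v. wish n p L v r s)"
proof -
  have "all_moments (garr n p) (\<lambda>v. lin p L (v i) r)" if "i < n" for i r
  proof (cases "r < p")
    case True
    then show ?thesis using that
      by (simp add: lin_def) (intro garr.all_moments_sum all_moments_mult garr.all_moments_const all_moments_garr; simp)
  qed (simp add: lin_def garr.all_moments_const)
  then show ?thesis unfolding wish_def by (intro garr.all_moments_sum all_moments_mult) auto
qed

section \<open>Four independent Wishart matrices at a fixed dimension\<close>

locale four_wishart =
  fixes p :: nat and n :: "label \<Rightarrow> nat" and L :: "label \<Rightarrow> nat \<Rightarrow> nat \<Rightarrow> real"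
begin

abbreviation mul (infixr "\<odot>" 70) where "A \<odot> B \<equiv> mm p A B"

definition S :: "label \<Rightarrow> nat \<Rightarrow> nat \<Rightarrow> real" where "S i = L i \<odot> tp (L i)"

text \<open>The clause for singletons avoids a final factor \<open>word []\<close>: multiplication
  by it changes the values outside the p \<times> p range, so \<open>S i \<odot> word []\<close> and
  \<open>S i\<close> in general differ as functions.\<close>

fun word :: "label list \<Rightarrow> nat \<Rightarrow> nat \<Rightarrow> real" where
  "word [] = (\<lambda>r s. if r = s then 1 else 0)"
| "word [i] = S i"
| "word (i # j # w) = S i \<odot> word (j # w)"

abbreviation T :: "label \<Rightarrow> (nat \<Rightarrow> nat \<Rightarrow> real) \<Rightarrow> nat \<Rightarrow> nat \<Rightarrow> real" where
  "T i \<equiv> wish (n i) p (L i)"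

abbreviation \<mu> :: "label \<Rightarrow> (nat \<Rightarrow> nat \<Rightarrow> real) measure" where
  "\<mu> i \<equiv> garr (n i) p"

abbreviation \<mu>2 where "\<mu>2 \<equiv> \<mu> Lc \<Otimes>\<^sub>M \<mu> Ld"
abbreviation \<mu>3 where "\<mu>3 \<equiv> \<mu> Lb \<Otimes>\<^sub>M \<mu>2"

lemma tp_S: "tp (S i) = S i"
  by (simp add: S_def tp_mm)

lemma tp_T: "tp (T i v) = T i v"
  by (rule tp_wish)

lemma prob_\<mu>: "prob_space (\<mu> i)" by (rule prob_space_garr)

lemma prob_\<mu>2: "prob_space \<mu>2" by (intro prob_space_pair prob_\<mu>)

lemma prob_\<mu>3: "prob_space \<mu>3" by (intro prob_space_pair prob_\<mu> prob_\<mu>2)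

sublocale p2: prob_space \<mu>2 by (rule prob_\<mu>2)
sublocale p3: prob_space \<mu>3 by (rule prob_\<mu>3)

lemma am_T2: "all_moments \<mu>2 (\<lambda>z. T Lc (fst z) r s)" "all_moments \<mu>2 (\<lambda>z. T Ld (snd z) r s)"
  by (rule all_moments_fst[OF prob_\<mu> prob_\<mu> all_moments_wish], rule all_moments_snd[OF prob_\<mu> prob_\<mu> all_moments_wish])

lemma am_T3: "all_moments \<mu>3 (\<lambda>z. T Lb (fst z) r s)" "all_moments \<mu>3 (\<lambda>z. T Lc (fst (snd z)) r s)"
  "all_moments \<mu>3 (\<lambda>z. T Ld (snd (snd z)) r s)"
  by (rule all_moments_fst[OF prob_\<mu> prob_\<mu>2 all_moments_wish], rule all_moments_snd[OF prob_\<mu> prob_\<mu>2 am_T2(1)],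
      rule all_moments_snd[OF prob_\<mu> prob_\<mu>2 am_T2(2)])

lemmas am1 = garr.all_moments_tr garr.all_moments_mm all_moments_wish garr.all_moments_const
lemmas am2 = p2.all_moments_tr p2.all_moments_mm am_T2 p2.all_moments_const
lemmas am3 = p3.all_moments_tr p3.all_moments_mm am_T3 p3.all_moments_const

end

text \<open>The situation at a single large p: one \<open>K\<close> for all words, and
  \<open>n_le\<close>, which holds eventually because n = o(p).\<close>

locale four_wishart_bounds = four_wishart +
  fixes K :: real
  assumes p: "0 < p" and n: "\<And>i. 0 < n i" and n_le: "\<And>i. n i \<le> p" and K: "1 \<le> K"
    and word_le: "\<And>w. 2 \<le> length w \<Longrightarrow> length w \<le> 16 \<Longrightarrow> \<bar>tr p (word w)\<bar> \<le> K * p"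
begin

lemma tr_le: "2 \<le> length w \<Longrightarrow> length w \<le> 16 \<Longrightarrow> tr p (word w) \<le> K * p"
  using word_le[of w] by linarith

text \<open>The factor 4 is 3 from the diagonal plus 1 from the off-diagonal part n^2 K p, which n
  \<le> p \<le> K p absorbs into n (K p)^2.\<close>

lemma gram2_mean:
  assumes G: "G = Z \<odot> tp Z" and H: "H = Y \<odot> tp Y"
    and le: "tr p (S i \<odot> G) \<le> K * p" "tr p (S i \<odot> H) \<le> K * p" "tr p (S i \<odot> G \<odot> S i \<odot> H) \<le> K * p"
  shows "mean_le (\<mu> i) (\<lambda>v. tr p (T i v \<odot> G \<odot> T i v \<odot> H)) (4 * K\<^sup>2 * real (n i) * (real p)\<^sup>2)"
proof (rule mean_le_mono[OF wish2_mean[OF S_def G H]])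
  have nonneg: "0 \<le> tr p (S i \<odot> G)" "0 \<le> tr p (S i \<odot> H)"
    unfolding S_def G H by (rule tr_gram_mult_nonneg[OF refl refl])+
  have KP: "0 \<le> K * p" using K by simp
  have "3 * real (n i) * tr p (S i \<odot> G) * tr p (S i \<odot> H) \<le> 3 * real (n i) * (K * p) * (K * p)"
    using nonneg le KP by (intro mult_mono) auto
  moreover have "(real (n i))\<^sup>2 * tr p (S i \<odot> G \<odot> S i \<odot> H) \<le> real (n i) * (K * p) * (K * p)"
  proof -
    have "(real (n i))\<^sup>2 * tr p (S i \<odot> G \<odot> S i \<odot> H) \<le> (real (n i))\<^sup>2 * (K * p)"
      using le by (intro mult_left_mono) auto
    also have "\<dots> = real (n i) * (1 * real (n i)) * (K * p)" by (simp add: power2_eq_square)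
    also have "\<dots> \<le> real (n i) * (K * p) * (K * p)"
      using K n_le[of i] KP by (intro mult_right_mono mult_left_mono mult_mono) auto
    finally show ?thesis .
  qed
  moreover have "4 * K\<^sup>2 * real (n i) * (real p)\<^sup>2 = 3 * real (n i) * (K * p) * (K * p) + real (n i) * (K * p) * (K * p)"
    by (simp add: power2_eq_square)
  ultimately show "3 * real (n i) * tr p (S i \<odot> G) * tr p (S i \<odot> H) + (real (n i))\<^sup>2 * tr p (S i \<odot> G \<odot> S i \<odot> H)
    \<le> 4 * K\<^sup>2 * real (n i) * (real p)\<^sup>2" by linarith
  show "(\<lambda>v. tr p (T i v \<odot> G \<odot> T i v \<odot> H)) \<in> borel_measurable (\<mu> i)"
    by (intro all_moments_measurable am1)
qed simp

text \<open>T_c is averaged first, the matrix T_d u T_d being Gram. What is left are two traces in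
  T_d of the shape of \<open>gram2_mean\<close>, with S_c and with S_c k S_c in the last place; 16 =
  3 * 4 + 4.\<close>

lemma gram3_mean:
  assumes u: "u = Z \<odot> tp Z" and k: "k = Y \<odot> tp Y"
    and le: "tr p (S Lc \<odot> k) \<le> K * p" "tr p (S Ld \<odot> u) \<le> K * p" "tr p (S Ld \<odot> S Lc) \<le> K * p"
      "tr p (S Ld \<odot> S Lc \<odot> k \<odot> S Lc) \<le> K * p"
      "tr p (S Ld \<odot> u \<odot> S Ld \<odot> S Lc) \<le> K * p" "tr p (S Ld \<odot> u \<odot> S Ld \<odot> S Lc \<odot> k \<odot> S Lc) \<le> K * p"
  shows "mean_le \<mu>2 (\<lambda>z. tr p (T Lc (fst z) \<odot> (T Ld (snd z) \<odot> u \<odot> T Ld (snd z)) \<odot> T Lc (fst z) \<odot> k))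
    (16 * K ^ 3 * real (n Lc) * real (n Ld) * real p ^ 3)"
proof (rule mean_le_pair[OF prob_\<mu> prob_\<mu>])
  let ?F = "\<lambda>d. T Ld d \<odot> u \<odot> T Ld d"
  have F: "?F d = (T Ld d \<odot> Z) \<odot> tp (T Ld d \<odot> Z)" for d
    by (simp add: u tp_mm tp_T mm_assoc)
  have KP: "0 \<le> K * p" using K by simp
  show "(\<lambda>z. tr p (T Lc (fst z) \<odot> ?F (snd z) \<odot> T Lc (fst z) \<odot> k)) \<in> borel_measurable \<mu>2"
    by (intro all_moments_measurable am2)
  let ?h = "\<lambda>d. 3 * real (n Lc) * tr p (S Lc \<odot> k) * tr p (T Ld d \<odot> u \<odot> T Ld d \<odot> S Lc)
    + (real (n Lc))\<^sup>2 * tr p (T Ld d \<odot> u \<odot> T Ld d \<odot> (S Lc \<odot> k \<odot> S Lc))"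
  have k0: "0 \<le> tr p (S Lc \<odot> k)" unfolding S_def k by (rule tr_gram_mult_nonneg[OF refl refl])
  show "mean_le (\<mu> Lc) (\<lambda>c. tr p (T Lc (fst (c, d)) \<odot> ?F (snd (c, d)) \<odot> T Lc (fst (c, d)) \<odot> k)) (?h d)" for d
  proof -
    have "tr p (S Lc \<odot> ?F d) = tr p (T Ld d \<odot> u \<odot> T Ld d \<odot> S Lc)"
      by (subst tr_comm) (simp only: mm_assoc)
    moreover have "tr p (S Lc \<odot> ?F d \<odot> S Lc \<odot> k) = tr p (T Ld d \<odot> u \<odot> T Ld d \<odot> (S Lc \<odot> k \<odot> S Lc))"
      by (subst tr_comm) (simp only: mm_assoc)
    ultimately show ?thesis
      using wish2_mean[OF S_def[of Lc] F[of d] k, of "n Lc"] by (simp add: mult_ac)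
  qed
  have mean: "mean_le (\<mu> Ld) ?h (3 * real (n Lc) * tr p (S Lc \<odot> k) * (4 * K\<^sup>2 * real (n Ld) * (real p)\<^sup>2)
      + (real (n Lc))\<^sup>2 * (4 * K\<^sup>2 * real (n Ld) * (real p)\<^sup>2))"
  proof (intro mean_le_add mean_le_cmult)
    show "mean_le (\<mu> Ld) (\<lambda>d. tr p (T Ld d \<odot> u \<odot> T Ld d \<odot> S Lc)) (4 * K\<^sup>2 * real (n Ld) * (real p)\<^sup>2)"
      by (rule gram2_mean[OF u S_def]) (use le in auto)
    have "S Lc \<odot> k \<odot> S Lc = (S Lc \<odot> Y) \<odot> tp (S Lc \<odot> Y)"
      by (simp add: k tp_mm tp_S mm_assoc)
    then show "mean_le (\<mu> Ld) (\<lambda>d. tr p (T Ld d \<odot> u \<odot> T Ld d \<odot> (S Lc \<odot> k \<odot> S Lc))) (4 * K\<^sup>2 * real (n Ld) * (real p)\<^sup>2)"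
      by (rule gram2_mean[OF u]) (use le in auto)
  qed (use k0 in auto)
  have le': "3 * real (n Lc) * tr p (S Lc \<odot> k) * (4 * K\<^sup>2 * real (n Ld) * (real p)\<^sup>2)
      + (real (n Lc))\<^sup>2 * (4 * K\<^sup>2 * real (n Ld) * (real p)\<^sup>2) \<le> 16 * K ^ 3 * real (n Lc) * real (n Ld) * real p ^ 3"
  proof -
    let ?E = "4 * K\<^sup>2 * real (n Ld) * (real p)\<^sup>2"
    have E0: "0 \<le> ?E" using K by simp
    have "3 * real (n Lc) * tr p (S Lc \<odot> k) * ?E \<le> 3 * real (n Lc) * (K * p) * ?E"
      using le(1) E0 by (intro mult_right_mono mult_left_mono) auto
    moreover have "(real (n Lc))\<^sup>2 * ?E \<le> real (n Lc) * (K * p) * ?E"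
    proof -
      have "real (n Lc) * (1 * real (n Lc)) \<le> real (n Lc) * (K * p)"
        using K n_le[of Lc] by (intro mult_left_mono mult_mono) auto
      then show ?thesis using E0 by (intro mult_right_mono) (auto simp: power2_eq_square)
    qed
    moreover have "16 * K ^ 3 * real (n Lc) * real (n Ld) * real p ^ 3 = 3 * real (n Lc) * (K * p) * ?E + real (n Lc) * (K * p) * ?E"
      by (simp add: power2_eq_square power3_eq_cube)
    ultimately show ?thesis by linarith
  qed
  from mean_le_weaken[OF mean le'] show "mean_le (\<mu> Ld) ?h (16 * K ^ 3 * real (n Lc) * real (n Ld) * real p ^ 3)" .
qed

text \<open>The error of replacing tr (T G T H) by n tr (S G) tr (S H), per unit of a common bound
  for the means of tr (S G) and |tr (S G S H)|, when tr (S H) and tr (S H S H) are at most K p.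
  Relative to n p its three terms are of order sqrt (n / p), 1 / sqrt n and n / p.\<close>

definition dev :: "label \<Rightarrow> real" where
  "dev i = 9 * (real (n i) * sqrt (n i)) * sqrt (K * p) + 2 * sqrt (n i) * (K * p) + (real (n i))\<^sup>2"

lemma dev_nonneg: "0 \<le> dev i"
  using K by (auto simp: dev_def intro!: add_nonneg_nonneg mult_nonneg_nonneg)

lemma wish2_replace:
  assumes G: "G = Z \<odot> tp Z" and H: "tp H = H"
    and le: "\<bar>tr p (S i \<odot> H)\<bar> \<le> K * p" "tr p (S i \<odot> H \<odot> S i \<odot> H) \<le> K * p"
  shows "mean_le (\<mu> i) (\<lambda>v. \<bar>tr p (T i v \<odot> G \<odot> T i v \<odot> H) - real (n i) * tr p (S i \<odot> G) * tr p (S i \<odot> H)\<bar>)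
    ((9 * (real (n i) * sqrt (n i)) * sqrt (K * p) + 2 * sqrt (n i) * (K * p)) * tr p (S i \<odot> G)
      + (real (n i))\<^sup>2 * \<bar>tr p (S i \<odot> G \<odot> S i \<odot> H)\<bar>)"
proof (rule mean_le_mono[OF wish2_deviation[OF S_def G]])
  have g0: "0 \<le> tr p (S i \<odot> G)"
    unfolding S_def G by (rule tr_gram_mult_nonneg[OF refl refl])
  have "9 * (real (n i) * sqrt (n i)) * tr p (S i \<odot> G) * sqrt (tr p (S i \<odot> H \<odot> S i \<odot> tp H))
      \<le> 9 * (real (n i) * sqrt (n i)) * tr p (S i \<odot> G) * sqrt (K * p)"
    using g0 le(2) by (intro mult_left_mono real_sqrt_le_mono) (auto simp: H)
  moreover have "2 * sqrt (n i) * tr p (S i \<odot> G) * \<bar>tr p (S i \<odot> H)\<bar> \<le> 2 * sqrt (n i) * tr p (S i \<odot> G) * (K * p)"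
    using g0 le(1) by (intro mult_left_mono) auto
  ultimately show "9 * (real (n i) * sqrt (n i)) * tr p (S i \<odot> G) * sqrt (tr p (S i \<odot> H \<odot> S i \<odot> tp H))
    + 2 * sqrt (n i) * tr p (S i \<odot> G) * \<bar>tr p (S i \<odot> H)\<bar>
    + (real (n i))\<^sup>2 * \<bar>tr p (S i \<odot> G \<odot> S i \<odot> H)\<bar>
    \<le> (9 * (real (n i) * sqrt (n i)) * sqrt (K * p) + 2 * sqrt (n i) * (K * p)) * tr p (S i \<odot> G)
      + (real (n i))\<^sup>2 * \<bar>tr p (S i \<odot> G \<odot> S i \<odot> H)\<bar>"
    unfolding distrib_right by (simp add: mult_ac)
  show "(\<lambda>v. \<bar>tr p (T i v \<odot> G \<odot> T i v \<odot> H) - real (n i) * tr p (S i \<odot> G) * tr p (S i \<odot> H)\<bar>) \<in> borel_measurable (\<mu> i)"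
    by (intro all_moments_measurable all_moments_abs garr.all_moments_diff am1)
qed simp

text \<open>\<open>G\<close> depends on the remaining matrices y. The bound \<open>?h\<close> is
  linear in two traces of \<open>G y\<close>, so one bound \<open>c\<close> for both of their means
  suffices.\<close>

lemma wish2_replace_mean:
  assumes M: "prob_space M" and G: "\<And>y. G y = Z y \<odot> tp (Z y)" and H: "tp H = H"
    and am: "all_moments (\<mu> i \<Otimes>\<^sub>M M) (\<lambda>z. tr p (T i (fst z) \<odot> G (snd z) \<odot> T i (fst z) \<odot> H)
        - real (n i) * tr p (S i \<odot> G (snd z)) * tr p (S i \<odot> H))"
    and le: "\<bar>tr p (S i \<odot> H)\<bar> \<le> K * p" "tr p (S i \<odot> H \<odot> S i \<odot> H) \<le> K * p"
    and m1: "mean_le M (\<lambda>y. tr p (S i \<odot> G y)) c"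
    and m2: "mean_le M (\<lambda>y. \<bar>tr p (S i \<odot> G y \<odot> S i \<odot> H)\<bar>) c"
  shows "mean_le (\<mu> i \<Otimes>\<^sub>M M) (\<lambda>z. \<bar>tr p (T i (fst z) \<odot> G (snd z) \<odot> T i (fst z) \<odot> H)
        - real (n i) * tr p (S i \<odot> G (snd z)) * tr p (S i \<odot> H)\<bar>) (dev i * c)"
proof (rule mean_le_pair[OF prob_\<mu> M])
  let ?a = "9 * (real (n i) * sqrt (n i)) * sqrt (K * p) + 2 * sqrt (n i) * (K * p)"
  let ?h = "\<lambda>y. ?a * tr p (S i \<odot> G y) + (real (n i))\<^sup>2 * \<bar>tr p (S i \<odot> G y \<odot> S i \<odot> H)\<bar>"
  show "(\<lambda>z. \<bar>tr p (T i (fst z) \<odot> G (snd z) \<odot> T i (fst z) \<odot> H)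
        - real (n i) * tr p (S i \<odot> G (snd z)) * tr p (S i \<odot> H)\<bar>) \<in> borel_measurable (\<mu> i \<Otimes>\<^sub>M M)"
    by (intro all_moments_measurable all_moments_abs am)
  have a0: "0 \<le> ?a" using K by (intro add_nonneg_nonneg mult_nonneg_nonneg) auto
  show "mean_le (\<mu> i) (\<lambda>x. \<bar>tr p (T i (fst (x, y)) \<odot> G (snd (x, y)) \<odot> T i (fst (x, y)) \<odot> H)
        - real (n i) * tr p (S i \<odot> G (snd (x, y))) * tr p (S i \<odot> H)\<bar>) (?h y)" for y
    unfolding fst_conv snd_conv by (rule wish2_replace[OF G H le])
  have "mean_le M ?h (?a * c + (real (n i))\<^sup>2 * c)"
    by (intro mean_le_add mean_le_cmult m1 m2 a0) simp
  then show "mean_le M ?h (dev i * c)" by (simp add: dev_def distrib_right)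
qed

end

section \<open>Concentration of the conditional mean and variance\<close>

lemma abs_weighted_sum_le:
  fixes x y w k l :: real
  assumes "0 \<le> k" "0 \<le> l"
  shows "\<bar>x + (k * y + l * w)\<bar> \<le> \<bar>x\<bar> + (k * \<bar>y\<bar> + l * \<bar>w\<bar>)"
  using abs_triangle_ineq[of x "k * y + l * w"] abs_triangle_ineq[of "k * y" "l * w"] assms
  by (simp add: abs_mult)

section \<open>Concentration of the main variance term tr (S Q S Q')\<close>

context four_wishart
begin

text \<open>The nesting lets each peeling meet the same shape: \<open>G\<close> sits between two
  copies of T_b, \<open>F\<close> between two of T_c, and \<open>S La\<close> between two of
  T_d.\<close>

definition F where "F d = T Ld d \<odot> S La \<odot> T Ld d"
definition G where "G y = T Lc (fst y) \<odot> F (snd y) \<odot> T Lc (fst y)"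
definition Q where "Q z = T Lb (fst z) \<odot> T Lc (fst (snd z)) \<odot> T Ld (snd (snd z))"

lemma tp_Q: "tp (Q z) = T Ld (snd (snd z)) \<odot> T Lc (fst (snd z)) \<odot> T Lb (fst z)"
  by (simp add: Q_def tp_mm tp_T mm_assoc)

lemma F_gram: "F d = (T Ld d \<odot> L La) \<odot> tp (T Ld d \<odot> L La)"
  by (simp add: F_def S_def tp_mm tp_T mm_assoc)

lemma G_gram: "G y = (T Lc (fst y) \<odot> T Ld (snd y) \<odot> L La) \<odot> tp (T Lc (fst y) \<odot> T Ld (snd y) \<odot> L La)"
  by (simp add: G_def F_def S_def tp_mm tp_T mm_assoc)

lemma conj_gram: "S i \<odot> (Z \<odot> tp Z) \<odot> S i = (S i \<odot> Z) \<odot> tp (S i \<odot> Z)"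
  by (simp add: tp_mm tp_S mm_assoc)

lemma tr_W: "tr p (S La \<odot> Q z \<odot> S La \<odot> tp (Q z)) = tr p (T Lb (fst z) \<odot> G (snd z) \<odot> T Lb (fst z) \<odot> S La)"
  unfolding tp_Q unfolding Q_def G_def F_def by (subst tr_comm) (simp only: mm_assoc)

lemma tr_SG: "tr p (S Lb \<odot> G y) = tr p (T Lc (fst y) \<odot> F (snd y) \<odot> T Lc (fst y) \<odot> S Lb)"
  unfolding G_def by (subst tr_comm) (simp only: mm_assoc)

lemma tr_SF: "tr p (S Lc \<odot> F d) = tr p (T Ld d \<odot> S La \<odot> T Ld d \<odot> S Lc)"
  unfolding F_def by (subst tr_comm) (simp only: mm_assoc)

lemma tr_SGSH: "tr p (S Lb \<odot> G y \<odot> S Lb \<odot> H)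
    = tr p (T Lc (fst y) \<odot> F (snd y) \<odot> T Lc (fst y) \<odot> (S Lb \<odot> H \<odot> S Lb))"
  unfolding G_def by (subst tr_comm) (simp only: mm_assoc)

lemma tr_SFSH: "tr p (S Lc \<odot> F d \<odot> S Lc \<odot> H) = tr p (T Ld d \<odot> S La \<odot> T Ld d \<odot> (S Lc \<odot> H \<odot> S Lc))"
  unfolding F_def by (subst tr_comm) (simp only: mm_assoc)

definition \<tau> :: "label \<Rightarrow> label \<Rightarrow> real" where "\<tau> i j = tr p (S i \<odot> S j)"

lemma \<tau>_nonneg: "0 \<le> \<tau> i j"
  unfolding \<tau>_def S_def by (rule tr_gram_mult_nonneg[OF refl refl])

lemma tr_gram_sym_nonneg:
  assumes "A = Z \<odot> tp Z" "B = Y \<odot> tp Y" "tp X = X"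
  shows "0 \<le> tr p (X \<odot> A \<odot> X \<odot> B)"
  unfolding assms(1,2) by (rule tr_gram2_nonneg[OF assms(3)])

end

context four_wishart_bounds
begin

lemma \<tau>_le: "\<tau> i j \<le> K * p"
  using tr_le[of "[i, j]"] by (simp add: \<tau>_def)

lemma SG_mean: "mean_le \<mu>2 (\<lambda>y. tr p (S Lb \<odot> G y)) (16 * K ^ 3 * real (n Lc) * real (n Ld) * real p ^ 3)"
  unfolding tr_SG F_def
  by (rule gram3_mean[OF S_def S_def])
    (use tr_le[of "[Lc, Lb]"] tr_le[of "[Ld, La]"] tr_le[of "[Ld, Lc]"] tr_le[of "[Ld, Lc, Lb, Lc]"]
      tr_le[of "[Ld, La, Ld, Lc]"] tr_le[of "[Ld, La, Ld, Lc, Lb, Lc]"] in \<open>simp_all add: mm_assoc\<close>)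

text \<open>The trace is nonnegative, so the absolute value disappears. After cycling, S_b S_a S_b
  takes the place of \<open>k\<close> in \<open>gram3_mean\<close>; the listed words are the traces
  that lemma asks for.\<close>

lemma SGSS_mean: "mean_le \<mu>2 (\<lambda>y. \<bar>tr p (S Lb \<odot> G y \<odot> S Lb \<odot> S La)\<bar>) (16 * K ^ 3 * real (n Lc) * real (n Ld) * real p ^ 3)"
proof -
  have "\<bar>tr p (S Lb \<odot> G y \<odot> S Lb \<odot> S La)\<bar>
      = tr p (T Lc (fst y) \<odot> (T Ld (snd y) \<odot> S La \<odot> T Ld (snd y)) \<odot> T Lc (fst y) \<odot> (S Lb \<odot> S La \<odot> S Lb))" for y
    using tr_gram_sym_nonneg[OF G_gram[of y] S_def[of La] tp_S[of Lb]] unfolding tr_SGSH F_def by simp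
  then show ?thesis
    by (simp only:) (rule gram3_mean[OF S_def conj_gram[of Lb "L La", folded S_def]],
      use tr_le[of "[Lc, Lb, La, Lb]"] tr_le[of "[Ld, La]"] tr_le[of "[Ld, Lc]"] tr_le[of "[Ld, Lc, Lb, La, Lb, Lc]"]
      tr_le[of "[Ld, La, Ld, Lc]"] tr_le[of "[Ld, La, Ld, Lc, Lb, La, Lb, Lc]"] in \<open>simp_all add: mm_assoc\<close>)
qed

lemma SF_mean: "mean_le (\<mu> Ld) (\<lambda>d. tr p (S Lc \<odot> F d)) (4 * K\<^sup>2 * real (n Ld) * (real p)\<^sup>2)"
  unfolding tr_SF
  by (rule gram2_mean[OF S_def S_def])
    (use tr_le[of "[Ld, La]"] tr_le[of "[Ld, Lc]"] tr_le[of "[Ld, La, Ld, Lc]"] in simp_all)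

lemma SFSS_mean: "mean_le (\<mu> Ld) (\<lambda>d. \<bar>tr p (S Lc \<odot> F d \<odot> S Lc \<odot> S Lb)\<bar>) (4 * K\<^sup>2 * real (n Ld) * (real p)\<^sup>2)"
proof -
  have "\<bar>tr p (S Lc \<odot> F d \<odot> S Lc \<odot> S Lb)\<bar> = tr p (T Ld d \<odot> S La \<odot> T Ld d \<odot> (S Lc \<odot> S Lb \<odot> S Lc))" for d
    using tr_gram_sym_nonneg[OF F_gram[of d] S_def[of Lb] tp_S[of Lc]] unfolding tr_SFSH by simp
  then show ?thesis
    by (simp only:) (rule gram2_mean[OF S_def conj_gram[of Lc "L Lb", folded S_def]],
      use tr_le[of "[Ld, La]"] tr_le[of "[Ld, Lc, Lb, Lc]"] tr_le[of "[Ld, La, Ld, Lc, Lb, Lc]"] in \<open>simp_all add: mm_assoc\<close>)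
qed

text \<open>A telescoping replacement of T_b, T_c and T_d. Each step costs \<open>dev\<close> of its
  own matrix times a first-moment bound for the matrices not yet replaced, weighted by the
  deterministic factors \<open>?k2\<close>, \<open>?k3\<close> already split off. The three costs
  are brought under the common constant 16 K^3 p^3.\<close>

lemma W_mean:
  "mean_le \<mu>3 (\<lambda>z. \<bar>tr p (S La \<odot> Q z \<odot> S La \<odot> tp (Q z))
      - real (n Lb) * real (n Lc) * real (n Ld) * (\<tau> Lb La * \<tau> Lc Lb * \<tau> Ld Lc * \<tau> Ld La)\<bar>)
    (16 * K ^ 3 * real p ^ 3 * (dev Lb * (real (n Lc) * real (n Ld)) + dev Lc * (real (n Lb) * real (n Ld)) + dev Ld * (real (n Lb) * real (n Lc))))"
proof -
  let ?e1 = "\<lambda>z. \<bar>tr p (T Lb (fst z) \<odot> G (snd z) \<odot> T Lb (fst z) \<odot> S La) - real (n Lb) * tr p (S Lb \<odot> G (snd z)) * \<tau> Lb La\<bar>"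
  let ?e2 = "\<lambda>y. \<bar>tr p (T Lc (fst y) \<odot> F (snd y) \<odot> T Lc (fst y) \<odot> S Lb) - real (n Lc) * tr p (S Lc \<odot> F (snd y)) * \<tau> Lc Lb\<bar>"
  let ?e3 = "\<lambda>d. \<bar>tr p (T Ld d \<odot> S La \<odot> T Ld d \<odot> S Lc) - real (n Ld) * \<tau> Ld La * \<tau> Ld Lc\<bar>"
  have KP: "0 \<le> K * p" using K by simp
  have abs_\<tau>: "\<bar>tr p (S i \<odot> S j)\<bar> \<le> K * p" for i j using word_le[of "[i, j]"] by simp
  have le4: "tr p (S i \<odot> S j \<odot> S i \<odot> S j) \<le> K * p" for i j using tr_le[of "[i, j, i, j]"] by simp
  have 1: "mean_le \<mu>3 ?e1 (dev Lb * (16 * K ^ 3 * real (n Lc) * real (n Ld) * real p ^ 3))"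
    unfolding \<tau>_def
    by (rule wish2_replace_mean[OF prob_\<mu>2 G_gram tp_S _ abs_\<tau> le4 SG_mean SGSS_mean])
      (unfold G_def F_def, intro p3.all_moments_diff all_moments_mult am3)
  have 2: "mean_le \<mu>2 ?e2 (dev Lc * (4 * K\<^sup>2 * real (n Ld) * (real p)\<^sup>2))"
    unfolding \<tau>_def
    by (rule wish2_replace_mean[OF prob_\<mu> F_gram tp_S _ abs_\<tau> le4 SF_mean SFSS_mean])
      (unfold F_def, intro p2.all_moments_diff all_moments_mult am2)
  have 3: "mean_le (\<mu> Ld) ?e3 (dev Ld * (K * p))"
    unfolding \<tau>_def
  proof (rule mean_le_mono[OF wish2_replace[OF S_def tp_S abs_\<tau> le4]])
    have "\<bar>tr p (S Ld \<odot> S La \<odot> S Ld \<odot> S Lc)\<bar> \<le> K * p" using word_le[of "[Ld, La, Ld, Lc]"] by simp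
    moreover have "tr p (S Ld \<odot> S La) \<le> K * p" using \<tau>_le by (simp add: \<tau>_def)
    ultimately show "(9 * (real (n Ld) * sqrt (n Ld)) * sqrt (K * p) + 2 * sqrt (n Ld) * (K * p)) * tr p (S Ld \<odot> S La)
      + (real (n Ld))\<^sup>2 * \<bar>tr p (S Ld \<odot> S La \<odot> S Ld \<odot> S Lc)\<bar> \<le> dev Ld * (K * p)"
      unfolding dev_def distrib_right[of _ "(real (n Ld))\<^sup>2"] using KP
      by (intro add_mono mult_left_mono) auto
    show "(\<lambda>d. \<bar>tr p (T Ld d \<odot> S La \<odot> T Ld d \<odot> S Lc) - real (n Ld) * tr p (S Ld \<odot> S La) * tr p (S Ld \<odot> S Lc)\<bar>) \<in> borel_measurable (\<mu> Ld)"
      by (intro all_moments_measurable all_moments_abs garr.all_moments_diff am1)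
  qed simp
  let ?k2 = "real (n Lb) * \<tau> Lb La" and ?k3 = "real (n Lb) * \<tau> Lb La * (real (n Lc) * \<tau> Lc Lb)"
  have k0: "0 \<le> ?k2" "0 \<le> ?k3" by (simp_all add: \<tau>_nonneg)
  have k2: "?k2 \<le> real (n Lb) * (K * p)" by (intro mult_left_mono \<tau>_le) simp
  have k3: "?k3 \<le> real (n Lb) * (K * p) * (real (n Lc) * (K * p))"
    using KP \<tau>_nonneg by (intro mult_mono mult_left_mono \<tau>_le) auto
  have "mean_le \<mu>3 (\<lambda>z. ?e1 z + (?k2 * ?e2 (snd z) + ?k3 * ?e3 (snd (snd z))))
    (dev Lb * (16 * K ^ 3 * real (n Lc) * real (n Ld) * real p ^ 3)
      + (?k2 * (dev Lc * (4 * K\<^sup>2 * real (n Ld) * (real p)\<^sup>2)) + ?k3 * (dev Ld * (K * p))))"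
    by (intro mean_le_add mean_le_cmult 1 k0 mean_le_pair_snd[OF prob_\<mu> prob_\<mu>2 2]
        mean_le_pair_snd[OF prob_\<mu> prob_\<mu>2 mean_le_pair_snd[OF prob_\<mu> prob_\<mu> 3]])
  then show ?thesis
  proof (rule mean_le_mono)
    show "(\<lambda>z. \<bar>tr p (S La \<odot> Q z \<odot> S La \<odot> tp (Q z))
      - real (n Lb) * real (n Lc) * real (n Ld) * (\<tau> Lb La * \<tau> Lc Lb * \<tau> Ld Lc * \<tau> Ld La)\<bar>) \<in> borel_measurable \<mu>3"
      unfolding tr_W G_def F_def by (intro all_moments_measurable all_moments_abs p3.all_moments_diff am3)
    fix z
    let ?w1 = "tr p (T Lb (fst z) \<odot> G (snd z) \<odot> T Lb (fst z) \<odot> S La)" and ?w2 = "tr p (S Lb \<odot> G (snd z))"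
      and ?w3 = "tr p (S Lc \<odot> F (snd (snd z)))"
    have dec: "?w1 - real (n Lb) * real (n Lc) * real (n Ld) * (\<tau> Lb La * \<tau> Lc Lb * \<tau> Ld Lc * \<tau> Ld La)
      = (?w1 - real (n Lb) * ?w2 * \<tau> Lb La) + (?k2 * (?w2 - real (n Lc) * ?w3 * \<tau> Lc Lb) + ?k3 * (?w3 - real (n Ld) * \<tau> Ld La * \<tau> Ld Lc))"
      by (simp add: algebra_simps)
    show "\<bar>tr p (S La \<odot> Q z \<odot> S La \<odot> tp (Q z))
        - real (n Lb) * real (n Lc) * real (n Ld) * (\<tau> Lb La * \<tau> Lc Lb * \<tau> Ld Lc * \<tau> Ld La)\<bar>
      \<le> ?e1 z + (?k2 * ?e2 (snd z) + ?k3 * ?e3 (snd (snd z)))"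
      unfolding tr_W dec tr_SG[symmetric] tr_SF[symmetric] by (rule abs_weighted_sum_le[OF k0])
  next
    let ?A = "K ^ 3 * real p ^ 3"
    have K0: "0 \<le> K" using K by simp
    have "?k2 * (dev Lc * (4 * K\<^sup>2 * real (n Ld) * (real p)\<^sup>2)) \<le> real (n Lb) * (K * p) * (dev Lc * (4 * K\<^sup>2 * real (n Ld) * (real p)\<^sup>2))"
      using k2 K dev_nonneg[of Lc] by (intro mult_right_mono) auto
    also have "\<dots> = 4 * (?A * (dev Lc * (real (n Lb) * real (n Ld))))" by (simp add: power2_eq_square power3_eq_cube)
    also have "\<dots> \<le> 16 * (?A * (dev Lc * (real (n Lb) * real (n Ld))))"
      using K0 dev_nonneg[of Lc] by (intro mult_right_mono) auto
    finally have b2: "?k2 * (dev Lc * (4 * K\<^sup>2 * real (n Ld) * (real p)\<^sup>2)) \<le> 16 * (?A * (dev Lc * (real (n Lb) * real (n Ld))))" .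
    have "?k3 * (dev Ld * (K * p)) \<le> real (n Lb) * (K * p) * (real (n Lc) * (K * p)) * (dev Ld * (K * p))"
      using k3 KP dev_nonneg[of Ld] by (intro mult_right_mono) auto
    also have "\<dots> = 1 * (?A * (dev Ld * (real (n Lb) * real (n Lc))))" by (simp add: power2_eq_square power3_eq_cube)
    also have "\<dots> \<le> 16 * (?A * (dev Ld * (real (n Lb) * real (n Lc))))"
      using K0 dev_nonneg[of Ld] by (intro mult_right_mono) auto
    finally have b3: "?k3 * (dev Ld * (K * p)) \<le> 16 * (?A * (dev Ld * (real (n Lb) * real (n Lc))))" .
    have b1: "dev Lb * (16 * K ^ 3 * real (n Lc) * real (n Ld) * real p ^ 3) = 16 * (?A * (dev Lb * (real (n Lc) * real (n Ld))))"
      by simp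
    have "16 * K ^ 3 * real p ^ 3 * (dev Lb * (real (n Lc) * real (n Ld)) + dev Lc * (real (n Lb) * real (n Ld)) + dev Ld * (real (n Lb) * real (n Lc)))
      = 16 * (?A * (dev Lb * (real (n Lc) * real (n Ld)))) + (16 * (?A * (dev Lc * (real (n Lb) * real (n Ld)))) + 16 * (?A * (dev Ld * (real (n Lb) * real (n Lc)))))"
      by (simp add: distrib_left)
    then show "dev Lb * (16 * K ^ 3 * real (n Lc) * real (n Ld) * real p ^ 3)
      + (?k2 * (dev Lc * (4 * K\<^sup>2 * real (n Ld) * (real p)\<^sup>2)) + ?k3 * (dev Ld * (K * p)))
      \<le> 16 * K ^ 3 * real p ^ 3 * (dev Lb * (real (n Lc) * real (n Ld)) + dev Lc * (real (n Lb) * real (n Ld)) + dev Ld * (real (n Lb) * real (n Lc)))"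
      unfolding b1 using b2 b3 by linarith
  qed
qed

end

section \<open>The negligible variance term and the conditional mean\<close>

context four_wishart
begin

text \<open>What follows T_b, respectively T_c, once that matrix has been cycled to the front. These
  products are not symmetric, so they are controlled through tr (S X S X') instead of as Gram
  matrices.\<close>

definition X where "X y = T Lc (fst y) \<odot> T Ld (snd y) \<odot> S La"
definition Y where "Y d = T Ld d \<odot> S La \<odot> S Lb"

lemma tr_SQSQ: "tr p (S La \<odot> Q z \<odot> S La \<odot> Q z) = tr p (T Lb (fst z) \<odot> X (snd z) \<odot> T Lb (fst z) \<odot> X (snd z))"
  unfolding Q_def X_def by (subst tr_comm) (simp only: mm_assoc)

lemma tr_SQ: "tr p (S La \<odot> Q z) = tr p (T Lb (fst z) \<odot> X (snd z))"
  unfolding Q_def X_def by (subst tr_comm) (simp only: mm_assoc)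

lemma tr_SX: "tr p (S Lb \<odot> X y) = tr p (T Lc (fst y) \<odot> Y (snd y))"
  unfolding X_def Y_def by (subst tr_comm) (simp only: mm_assoc)

lemma tr_SY: "tr p (S Lc \<odot> Y d) = tr p (T Ld d \<odot> (S La \<odot> S Lb \<odot> S Lc))"
  unfolding Y_def by (subst tr_comm) (simp only: mm_assoc)

lemma tr_SXSX: "tr p (S Lb \<odot> X y \<odot> S Lb \<odot> tp (X y))
    = tr p (T Lc (fst y) \<odot> (T Ld (snd y) \<odot> (S La \<odot> S Lb \<odot> S La) \<odot> T Ld (snd y)) \<odot> T Lc (fst y) \<odot> S Lb)"
  unfolding X_def tp_mm tp_T tp_S by (subst tr_comm) (simp only: mm_assoc)

lemma tr_SYSY: "tr p (S Lc \<odot> Y d \<odot> S Lc \<odot> tp (Y d))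
    = tr p (T Ld d \<odot> (S La \<odot> (S Lb \<odot> S Lc \<odot> S Lb) \<odot> S La) \<odot> T Ld d \<odot> S Lc)"
  unfolding Y_def tp_mm tp_T tp_S by (subst tr_comm) (simp only: mm_assoc)

definition \<tau>4 :: real where "\<tau>4 = tr p (S Ld \<odot> S La \<odot> S Lb \<odot> S Lc)"

text \<open>With C = L' Q L for the factor L of S_a, the sum is tr (C C) + tr (C C'), and tr (C C)
  \<ge> - tr (C C').\<close>

lemma SQSQ_nonneg: "0 \<le> tr p (S La \<odot> Q z \<odot> S La \<odot> Q z) + tr p (S La \<odot> Q z \<odot> S La \<odot> tp (Q z))"
  using tr_square_le[of p "cong_mat p (L La) (Q z)"]
  unfolding tp_cong_mat tr_cong_mat_mult S_def[symmetric] by linarith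

end

context four_wishart_bounds
begin

lemma SXSX_mean: "mean_le \<mu>2 (\<lambda>y. tr p (S Lb \<odot> X y \<odot> S Lb \<odot> tp (X y))) (16 * K ^ 3 * real (n Lc) * real (n Ld) * real p ^ 3)"
  unfolding tr_SXSX
  by (rule gram3_mean[OF conj_gram[of La "L Lb", folded S_def] S_def])
    (use tr_le[of "[Lc, Lb]"] tr_le[of "[Ld, La, Lb, La]"] tr_le[of "[Ld, Lc]"] tr_le[of "[Ld, Lc, Lb, Lc]"]
      tr_le[of "[Ld, La, Lb, La, Ld, Lc]"] tr_le[of "[Ld, La, Lb, La, Ld, Lc, Lb, Lc]"] in \<open>simp_all add: mm_assoc\<close>)

lemma SYSY_mean: "mean_le (\<mu> Ld) (\<lambda>d. tr p (S Lc \<odot> Y d \<odot> S Lc \<odot> tp (Y d))) (4 * K\<^sup>2 * real (n Ld) * (real p)\<^sup>2)"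
proof -
  have u: "S La \<odot> (S Lb \<odot> S Lc \<odot> S Lb) \<odot> S La = (S La \<odot> (S Lb \<odot> L Lc)) \<odot> tp (S La \<odot> (S Lb \<odot> L Lc))"
    unfolding conj_gram[symmetric] conj_gram[of Lb "L Lc", symmetric] S_def[symmetric] ..
  show ?thesis
    unfolding tr_SYSY
    by (rule gram2_mean[OF u S_def])
      (use tr_le[of "[Ld, La, Lb, Lc, Lb, La]"] tr_le[of "[Ld, Lc]"]
        tr_le[of "[Ld, La, Lb, Lc, Lb, La, Ld, Lc]"] in \<open>simp_all add: mm_assoc\<close>)
qed

lemma one_le: "1 \<le> real (n i)" "1 \<le> K * p"
proof -
  show "1 \<le> real (n i)" using n[of i] by simp
  have "1 * 1 \<le> K * p" using K p by (intro mult_mono) auto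
  then show "1 \<le> K * p" by simp
qed

text \<open>Squared mean plus variance; the variance term 2 n K p is absorbed because n K p \<ge>
  1.\<close>

lemma SY_square: "mean_le (\<mu> Ld) (\<lambda>d. (tr p (S Lc \<odot> Y d))\<^sup>2) (3 * (real (n Ld) * (K * p))\<^sup>2)"
  unfolding tr_SY
proof (rule mean_le_mono[OF wish_square[OF S_def]])
  let ?Z = "S La \<odot> S Lb \<odot> S Lc"
  have "\<bar>tr p (S Ld \<odot> ?Z)\<bar> \<le> K * p" using word_le[of "[Ld, La, Lb, Lc]"] by simp
  then have "\<bar>real (n Ld) * tr p (S Ld \<odot> ?Z)\<bar> \<le> real (n Ld) * (K * p)" unfolding abs_mult by (intro mult_mono) auto
  then have 1: "(real (n Ld) * tr p (S Ld \<odot> ?Z))\<^sup>2 \<le> (real (n Ld) * (K * p))\<^sup>2"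
    using abs_le_square_iff[of "real (n Ld) * tr p (S Ld \<odot> ?Z)" "real (n Ld) * (K * p)"] by linarith
  have "tr p (S Ld \<odot> ?Z \<odot> S Ld \<odot> tp ?Z) \<le> K * p"
    using tr_le[of "[Ld, La, Lb, Lc, Ld, Lc, Lb, La]"] by (simp add: tp_mm tp_S mm_assoc)
  then have "2 * real (n Ld) * tr p (S Ld \<odot> ?Z \<odot> S Ld \<odot> tp ?Z) \<le> 2 * real (n Ld) * (K * p)"
    by (intro mult_left_mono) auto
  moreover have "1 * (real (n Ld) * (K * p)) \<le> (real (n Ld) * (K * p)) * (real (n Ld) * (K * p))"
    using mult_mono[OF one_le(1)[of Ld] one_le(2)] one_le by (intro mult_right_mono) auto
  ultimately have 2: "2 * real (n Ld) * tr p (S Ld \<odot> ?Z \<odot> S Ld \<odot> tp ?Z) \<le> 2 * (real (n Ld) * (K * p))\<^sup>2"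
    unfolding power2_eq_square by linarith
  show "(real (n Ld) * tr p (S Ld \<odot> ?Z))\<^sup>2 + 2 * real (n Ld) * tr p (S Ld \<odot> ?Z \<odot> S Ld \<odot> tp ?Z) \<le> 3 * (real (n Ld) * (K * p))\<^sup>2"
    using 1 2 by linarith
  show "(\<lambda>d. (tr p (T Ld d \<odot> ?Z))\<^sup>2) \<in> borel_measurable (\<mu> Ld)"
    by (intro all_moments_measurable garr.all_moments_power am1)
qed simp

lemma SX_square: "mean_le \<mu>2 (\<lambda>y. (tr p (S Lb \<odot> X y))\<^sup>2) (11 * K\<^sup>2 * (real (n Lc) * real (n Ld) * p)\<^sup>2)"
proof -
  have sq: "real a \<le> (real a)\<^sup>2" for a :: nat
    by (cases a) (auto simp: power2_eq_square)
  let ?h = "\<lambda>d. (real (n Lc))\<^sup>2 * (tr p (S Lc \<odot> Y d))\<^sup>2 + 2 * real (n Lc) * tr p (S Lc \<odot> Y d \<odot> S Lc \<odot> tp (Y d))"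
  have m: "mean_le (\<mu> Ld) ?h ((real (n Lc))\<^sup>2 * (3 * (real (n Ld) * (K * p))\<^sup>2) + 2 * real (n Lc) * (4 * K\<^sup>2 * real (n Ld) * (real p)\<^sup>2))"
    by (intro mean_le_add mean_le_cmult SY_square SYSY_mean) auto
  have "mean_le \<mu>2 (\<lambda>y. (tr p (S Lb \<odot> X y))\<^sup>2)
      ((real (n Lc))\<^sup>2 * (3 * (real (n Ld) * (K * p))\<^sup>2) + 2 * real (n Lc) * (4 * K\<^sup>2 * real (n Ld) * (real p)\<^sup>2))"
    unfolding tr_SX
  proof (rule mean_le_pair[OF prob_\<mu> prob_\<mu> _ _ m])
    show "(\<lambda>y. (tr p (T Lc (fst y) \<odot> Y (snd y)))\<^sup>2) \<in> borel_measurable \<mu>2"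
      unfolding Y_def by (intro all_moments_measurable p2.all_moments_power am2)
    show "mean_le (\<mu> Lc) (\<lambda>x. (tr p (T Lc (fst (x, d)) \<odot> Y (snd (x, d))))\<^sup>2) (?h d)" for d
      using wish_square[OF S_def, of "n Lc" Lc "Y d"] by (simp add: power_mult_distrib)
  qed
  \<comment> \<open>11 is 3 from \<open>SY_square\<close> plus 2 * 4 from \<open>SYSY_mean\<close>,
    merged by n \<le> n^2.\<close>
  moreover have "(real (n Lc))\<^sup>2 * (3 * (real (n Ld) * (K * p))\<^sup>2) + 2 * real (n Lc) * (4 * K\<^sup>2 * real (n Ld) * (real p)\<^sup>2)
      \<le> 11 * K\<^sup>2 * (real (n Lc) * real (n Ld) * p)\<^sup>2"
  proof -
    have "real (n Lc) * real (n Ld) \<le> (real (n Lc))\<^sup>2 * (real (n Ld))\<^sup>2" by (intro mult_mono sq) auto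
    then have "8 * (K\<^sup>2 * (real p)\<^sup>2) * (real (n Lc) * real (n Ld)) \<le> 8 * (K\<^sup>2 * (real p)\<^sup>2) * ((real (n Lc))\<^sup>2 * (real (n Ld))\<^sup>2)"
      by (intro mult_left_mono) auto
    then show ?thesis by (simp add: power_mult_distrib mult_ac)
  qed
  ultimately show ?thesis by (rule mean_le_weaken)
qed

text \<open>Against the size n_b n_c n_d p^4 of the main variance term, the two summands are smaller
  by the factors n_c n_d / p^2 and n_b / p.\<close>

lemma SQSQ_mean:
  "mean_le \<mu>3 (\<lambda>z. \<bar>tr p (S La \<odot> Q z \<odot> S La \<odot> Q z)\<bar>)
    (11 * K\<^sup>2 * real (n Lb) * (real (n Lc) * real (n Ld) * p)\<^sup>2 + 48 * K ^ 3 * (real (n Lb))\<^sup>2 * real (n Lc) * real (n Ld) * real p ^ 3)"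
proof -
  let ?x2 = "\<lambda>y. tr p (S Lb \<odot> X y \<odot> S Lb \<odot> tp (X y))"
  let ?c = "16 * K ^ 3 * real (n Lc) * real (n Ld) * real p ^ 3"
  let ?h = "\<lambda>y. real (n Lb) * ((tr p (S Lb \<odot> X y))\<^sup>2 + 2 * ?x2 y) + (real (n Lb))\<^sup>2 * ?x2 y"
  have m: "mean_le \<mu>2 ?h (real (n Lb) * (11 * K\<^sup>2 * (real (n Lc) * real (n Ld) * p)\<^sup>2 + 2 * ?c) + (real (n Lb))\<^sup>2 * ?c)"
    by (intro mean_le_add mean_le_cmult SX_square SXSX_mean) auto
  show ?thesis
    unfolding tr_SQSQ
  proof (rule mean_le_mono[OF mean_le_pair[OF prob_\<mu> prob_\<mu>2 _ _ m]])
    show meas: "(\<lambda>z. \<bar>tr p (T Lb (fst z) \<odot> X (snd z) \<odot> T Lb (fst z) \<odot> X (snd z))\<bar>) \<in> borel_measurable \<mu>3"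
      unfolding X_def by (intro all_moments_measurable all_moments_abs am3)
    then show "(\<lambda>z. \<bar>tr p (T Lb (fst z) \<odot> X (snd z) \<odot> T Lb (fst z) \<odot> X (snd z))\<bar>) \<in> borel_measurable \<mu>3" .
    show "mean_le (\<mu> Lb) (\<lambda>x. \<bar>tr p (T Lb (fst (x, y)) \<odot> X (snd (x, y)) \<odot> T Lb (fst (x, y)) \<odot> X (snd (x, y)))\<bar>) (?h y)" for y
      unfolding fst_conv snd_conv by (rule wish2_self[OF S_def])
    \<comment> \<open>Through 2 n_b + n_b^2 \<le> 3 n_b^2 the constant 16 becomes 48.\<close>
    have "real (n Lb) \<le> (real (n Lb))\<^sup>2" using one_le(1)[of Lb] by (simp add: power2_eq_square)
    moreover have "0 \<le> ?c" using K by simp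
    ultimately have "real (n Lb) * ?c \<le> (real (n Lb))\<^sup>2 * ?c" by (rule mult_right_mono)
    then show "real (n Lb) * (11 * K\<^sup>2 * (real (n Lc) * real (n Ld) * p)\<^sup>2 + 2 * ?c) + (real (n Lb))\<^sup>2 * ?c
      \<le> 11 * K\<^sup>2 * real (n Lb) * (real (n Lc) * real (n Ld) * p)\<^sup>2 + 48 * K ^ 3 * (real (n Lb))\<^sup>2 * real (n Lc) * real (n Ld) * real p ^ 3"
      by (simp add: distrib_left mult_ac)
  qed simp
qed

text \<open>T_b, T_c and T_d are replaced in turn by their means n S. Each replacement costs a
  conditional standard deviation, whose own mean is bounded by \<open>mean_le_sqrt\<close>.\<close>

lemma SQ_mean:
  "mean_le \<mu>3 (\<lambda>z. \<bar>tr p (S La \<odot> Q z) - real (n Lb) * real (n Lc) * real (n Ld) * \<tau>4\<bar>)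
    (sqrt (2 * real (n Lb) * (16 * K ^ 3 * real (n Lc) * real (n Ld) * real p ^ 3))
      + (real (n Lb) * sqrt (2 * real (n Lc) * (4 * K\<^sup>2 * real (n Ld) * (real p)\<^sup>2)) + real (n Lb) * real (n Lc) * sqrt (2 * real (n Ld) * (K * p))))"
proof -
  let ?e1 = "\<lambda>z. \<bar>tr p (T Lb (fst z) \<odot> X (snd z)) - real (n Lb) * tr p (S Lb \<odot> X (snd z))\<bar>"
  let ?e2 = "\<lambda>y. \<bar>tr p (T Lc (fst y) \<odot> Y (snd y)) - real (n Lc) * tr p (S Lc \<odot> Y (snd y))\<bar>"
  let ?e3 = "\<lambda>d. \<bar>tr p (T Ld d \<odot> (S La \<odot> S Lb \<odot> S Lc)) - real (n Ld) * \<tau>4\<bar>"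
  have pos: "0 < real (n i)" for i using n[of i] by simp
  have 1: "mean_le \<mu>3 ?e1 (sqrt (2 * real (n Lb) * (16 * K ^ 3 * real (n Lc) * real (n Ld) * real p ^ 3)))"
  proof (rule mean_le_pair[OF prob_\<mu> prob_\<mu>2])
    show "?e1 \<in> borel_measurable \<mu>3"
      unfolding X_def by (intro all_moments_measurable all_moments_abs p3.all_moments_diff all_moments_mult am3)
    show "mean_le (\<mu> Lb) (\<lambda>x. ?e1 (x, y)) (sqrt (2 * real (n Lb) * tr p (S Lb \<odot> X y \<odot> S Lb \<odot> tp (X y))))" for y
      unfolding fst_conv snd_conv by (rule wish_deviation[OF S_def])
    show "mean_le \<mu>2 (\<lambda>y. sqrt (2 * real (n Lb) * tr p (S Lb \<odot> X y \<odot> S Lb \<odot> tp (X y))))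
      (sqrt (2 * real (n Lb) * (16 * K ^ 3 * real (n Lc) * real (n Ld) * real p ^ 3)))"
      by (intro mean_le_sqrt prob_\<mu>2 mean_le_cmult SXSX_mean) (use K p pos in auto)
  qed
  have 2: "mean_le \<mu>2 ?e2 (sqrt (2 * real (n Lc) * (4 * K\<^sup>2 * real (n Ld) * (real p)\<^sup>2)))"
  proof (rule mean_le_pair[OF prob_\<mu> prob_\<mu>])
    show "?e2 \<in> borel_measurable \<mu>2"
      unfolding Y_def by (intro all_moments_measurable all_moments_abs p2.all_moments_diff all_moments_mult am2)
    show "mean_le (\<mu> Lc) (\<lambda>x. ?e2 (x, d)) (sqrt (2 * real (n Lc) * tr p (S Lc \<odot> Y d \<odot> S Lc \<odot> tp (Y d))))" for d
      unfolding fst_conv snd_conv by (rule wish_deviation[OF S_def])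
    show "mean_le (\<mu> Ld) (\<lambda>d. sqrt (2 * real (n Lc) * tr p (S Lc \<odot> Y d \<odot> S Lc \<odot> tp (Y d))))
      (sqrt (2 * real (n Lc) * (4 * K\<^sup>2 * real (n Ld) * (real p)\<^sup>2)))"
      by (intro mean_le_sqrt prob_\<mu> mean_le_cmult SYSY_mean) (use K p pos in auto)
  qed
  have 3: "mean_le (\<mu> Ld) ?e3 (sqrt (2 * real (n Ld) * (K * p)))"
    unfolding \<tau>4_def
  proof (rule mean_le_mono[OF wish_deviation[OF S_def]])
    let ?Z = "S La \<odot> S Lb \<odot> S Lc"
    have "tr p (S Ld \<odot> ?Z \<odot> S Ld \<odot> tp ?Z) \<le> K * p"
      using tr_le[of "[Ld, La, Lb, Lc, Ld, Lc, Lb, La]"] by (simp add: tp_mm tp_S mm_assoc)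
    then show "sqrt (2 * real (n Ld) * tr p (S Ld \<odot> ?Z \<odot> S Ld \<odot> tp ?Z)) \<le> sqrt (2 * real (n Ld) * (K * p))"
      by (intro real_sqrt_le_mono mult_left_mono) auto
    show "(\<lambda>d. \<bar>tr p (T Ld d \<odot> ?Z) - real (n Ld) * tr p (S Ld \<odot> ?Z)\<bar>) \<in> borel_measurable (\<mu> Ld)"
      by (intro all_moments_measurable all_moments_abs garr.all_moments_diff am1)
  qed simp
  have "mean_le \<mu>3 (\<lambda>z. ?e1 z + (real (n Lb) * ?e2 (snd z) + real (n Lb) * real (n Lc) * ?e3 (snd (snd z))))
    (sqrt (2 * real (n Lb) * (16 * K ^ 3 * real (n Lc) * real (n Ld) * real p ^ 3))
      + (real (n Lb) * sqrt (2 * real (n Lc) * (4 * K\<^sup>2 * real (n Ld) * (real p)\<^sup>2)) + real (n Lb) * real (n Lc) * sqrt (2 * real (n Ld) * (K * p))))"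
    by (intro mean_le_add mean_le_cmult 1 mean_le_pair_snd[OF prob_\<mu> prob_\<mu>2 2]
        mean_le_pair_snd[OF prob_\<mu> prob_\<mu>2 mean_le_pair_snd[OF prob_\<mu> prob_\<mu> 3]]) auto
  then show ?thesis
  proof (rule mean_le_mono)
    show "(\<lambda>z. \<bar>tr p (S La \<odot> Q z) - real (n Lb) * real (n Lc) * real (n Ld) * \<tau>4\<bar>) \<in> borel_measurable \<mu>3"
      unfolding Q_def by (intro all_moments_measurable all_moments_abs p3.all_moments_diff am3)
    fix z
    let ?w1 = "tr p (T Lb (fst z) \<odot> X (snd z))" and ?w2 = "tr p (S Lb \<odot> X (snd z))"
      and ?w3 = "tr p (S Lc \<odot> Y (snd (snd z)))"
    have dec: "?w1 - real (n Lb) * real (n Lc) * real (n Ld) * \<tau>4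
      = (?w1 - real (n Lb) * ?w2) + (real (n Lb) * (?w2 - real (n Lc) * ?w3) + real (n Lb) * real (n Lc) * (?w3 - real (n Ld) * \<tau>4))"
      by (simp add: algebra_simps)
    show "\<bar>tr p (S La \<odot> Q z) - real (n Lb) * real (n Lc) * real (n Ld) * \<tau>4\<bar>
      \<le> ?e1 z + (real (n Lb) * ?e2 (snd z) + real (n Lb) * real (n Lc) * ?e3 (snd (snd z)))"
      unfolding tr_SQ dec tr_SX[symmetric] tr_SY[symmetric] by (rule abs_weighted_sum_le) auto
  qed simp
qed

end

lemma exp_diff_le:
  fixes x y :: real
  assumes "0 \<le> x" "0 \<le> y"
  shows "\<bar>exp (- x) - exp (- y)\<bar> \<le> \<bar>x - y\<bar>"
proof -
  have *: "exp (- x) - exp (- y) \<le> y - x" if "0 \<le> x" "x \<le> y" for x y :: real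
  proof -
    have "exp (- x) - exp (- y) = exp (- x) * (1 - exp (- (y - x)))"
      by (simp add: right_diff_distrib exp_add[symmetric])
    also have "\<dots> \<le> 1 * (y - x)"
    proof (rule mult_mono)
      show "1 - exp (- (y - x)) \<le> y - x" using exp_ge_add_one_self[of "- (y - x)"] by linarith
    qed (use that in auto)
    finally show ?thesis by simp
  qed
  show ?thesis
  proof (cases "x \<le> y")
    case True
    then show ?thesis using *[OF assms(1) True] by simp
  next
    case False
    then have "y \<le> x" by simp
    then show ?thesis using *[OF assms(2) \<open>y \<le> x\<close>] by simp
  qed
qed

lemma iexp_diff_le: "cmod (iexp x - 1) \<le> \<bar>x\<bar>"
  using iexp_approx1[of x 0] by simp

section \<open>From the conditional to the unconditional characteristic function\<close>

context four_wishart
begin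

abbreviation \<mu>4 where "\<mu>4 \<equiv> \<mu> La \<Otimes>\<^sub>M \<mu>3"

lemma prob_\<mu>4: "prob_space \<mu>4" by (intro prob_space_pair prob_\<mu> prob_\<mu>3)

sublocale p4: prob_space \<mu>4 by (rule prob_\<mu>4)

definition stat :: "real \<Rightarrow> _ \<Rightarrow> real" where "stat c z = c * tr p (T La (fst z) \<odot> Q (snd z))"

definition stat_mean :: "real \<Rightarrow> real" where
  "stat_mean c = c * (real (n La) * real (n Lb) * real (n Lc) * real (n Ld) * \<tau>4)"

lemma am_T4: "all_moments \<mu>4 (\<lambda>z. T La (fst z) r s)" "all_moments \<mu>4 (\<lambda>z. T Lb (fst (snd z)) r s)"
  "all_moments \<mu>4 (\<lambda>z. T Lc (fst (snd (snd z))) r s)" "all_moments \<mu>4 (\<lambda>z. T Ld (snd (snd (snd z))) r s)"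
  by (rule all_moments_fst[OF prob_\<mu> prob_\<mu>3 all_moments_wish], rule all_moments_snd[OF prob_\<mu> prob_\<mu>3 am_T3(1)],
      rule all_moments_snd[OF prob_\<mu> prob_\<mu>3 am_T3(2)], rule all_moments_snd[OF prob_\<mu> prob_\<mu>3 am_T3(3)])

lemma all_moments_stat: "all_moments \<mu>4 (stat c)"
  unfolding stat_def Q_def
  by (intro all_moments_mult p4.all_moments_const p4.all_moments_tr p4.all_moments_mm am_T4)

lemma integral_stat: "(LINT z|\<mu>4. stat c z) = stat_mean c"
proof -
  have "(LINT z|\<mu>4. stat c z) = (LINT y|\<mu>3. LINT a|\<mu> La. stat c (a, y))"
    by (rule integral_pair_swap_snd[OF prob_\<mu> prob_\<mu>3 all_moments_integrable[OF all_moments_stat]])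
  also have "\<dots> = (LINT y|\<mu>3. c * (real (n La) * tr p (T Lb (fst y) \<odot> X (snd y))))"
    by (simp add: stat_def wish_integral[OF S_def] tr_SQ)
  also have "\<dots> = c * (real (n La) * (LINT y|\<mu>3. tr p (T Lb (fst y) \<odot> X (snd y))))"
    by simp
  also have "(LINT y|\<mu>3. tr p (T Lb (fst y) \<odot> X (snd y))) = (LINT y|\<mu>2. LINT b|\<mu> Lb. tr p (T Lb b \<odot> X y))"
    by (subst integral_pair_swap_snd[OF prob_\<mu> prob_\<mu>2])
      (unfold X_def, intro all_moments_integrable am3, simp)
  also have "\<dots> = (LINT y|\<mu>2. real (n Lb) * tr p (T Lc (fst y) \<odot> Y (snd y)))"
    by (simp add: wish_integral[OF S_def] tr_SX)
  also have "\<dots> = real (n Lb) * (LINT y|\<mu>2. tr p (T Lc (fst y) \<odot> Y (snd y)))"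
    by simp
  also have "(LINT y|\<mu>2. tr p (T Lc (fst y) \<odot> Y (snd y))) = (LINT d|\<mu> Ld. LINT x|\<mu> Lc. tr p (T Lc x \<odot> Y d))"
    by (subst integral_pair_swap_snd[OF prob_\<mu> prob_\<mu>])
      (unfold Y_def, intro all_moments_integrable am2, simp)
  also have "\<dots> = (LINT d|\<mu> Ld. real (n Lc) * tr p (T Ld d \<odot> (S La \<odot> S Lb \<odot> S Lc)))"
    by (simp add: wish_integral[OF S_def] tr_SY)
  also have "\<dots> = real (n Lc) * (real (n Ld) * \<tau>4)"
    by (simp add: wish_integral[OF S_def] \<tau>4_def)
  finally show ?thesis by (simp add: stat_mean_def)
qed

text \<open>The conditional variance of \<open>stat c\<close> given T_b, T_c, T_d;
  \<open>V_limit\<close> is the deterministic value, still depending on p, around which it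
  concentrates.\<close>

definition V :: "real \<Rightarrow> _ \<Rightarrow> real" where "V c z = c\<^sup>2 * real (n La) * (tr p (S La \<odot> Q z \<odot> S La \<odot> Q z) + tr p (S La \<odot> Q z \<odot> S La \<odot> tp (Q z)))"

definition V_limit :: "real \<Rightarrow> real" where
  "V_limit c = c\<^sup>2 * real (n La) * (real (n Lb) * real (n Lc) * real (n Ld) * (\<tau> Lb La * \<tau> Lc Lb * \<tau> Ld Lc * \<tau> Ld La))"

lemma V_nonneg: "0 \<le> V c z"
  unfolding V_def using SQSQ_nonneg[of z] by simp

lemma V_limit_nonneg: "0 \<le> V_limit c"
  by (simp add: V_limit_def \<tau>_nonneg)

lemma all_moments_V: "all_moments \<mu>3 (V c)"
  unfolding V_def tp_Q unfolding Q_def by (intro all_moments_mult all_moments_add am3)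

text \<open>The conditional mean of \<open>stat c\<close> given T_b, T_c, T_d, minus its
  unconditional mean.\<close>

definition R :: "real \<Rightarrow> _ \<Rightarrow> real" where "R c z = c * real (n La) * (tr p (S La \<odot> Q z) - real (n Lb) * real (n Lc) * real (n Ld) * \<tau>4)"

lemma all_moments_R: "all_moments \<mu>3 (R c)"
  unfolding R_def Q_def by (intro all_moments_mult p3.all_moments_diff am3)

text \<open>Given T_b, T_c, T_d, the characteristic function is \<open>iexp (t * R c y)\<close>
  times that of a centered quadratic form. Three errors add up: the conditional limit theorem, the
  passage from V to \<open>V_limit\<close> under the 1-Lipschitz map exp (- x), and the phase, at
  most |t R|. All are linear in |V - V_limit| and |R|, so the two mean bounds suffice.\<close>

lemma stat_char_le:
  fixes c t \<eta> \<rho> :: real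
  assumes n: "0 < n La"
    and V: "mean_le \<mu>3 (\<lambda>z. \<bar>V c z - V_limit c\<bar>) \<eta>" and R: "mean_le \<mu>3 (\<lambda>z. \<bar>R c z\<bar>) \<rho>"
  shows "cmod ((CLINT z|\<mu>4. iexp (t * (stat c z - stat_mean c))) - exp (- (t\<^sup>2 * V_limit c) / 2))
    \<le> clt_rate t (n La) * (V_limit c + \<eta>) + (t\<^sup>2 / 2 * \<eta> + \<bar>t\<bar> * \<rho>)"
proof -
  let ?\<psi> = "complex_of_real (exp (- (t\<^sup>2 * V_limit c) / 2))"
  define \<Phi> where "\<Phi> y = (CLINT a|\<mu> La. iexp (t * (stat c (a, y) - stat_mean c)))" for y
  interpret pa: prob_space "\<mu> La" by (rule prob_\<mu>)
  interpret P: pair_prob_space "\<mu> La" \<mu>3 ..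
  have ms [measurable]: "stat c \<in> borel_measurable \<mu>4" by (rule all_moments_measurable[OF all_moments_stat])
  have int: "integrable \<mu>4 (\<lambda>z. iexp (t * (stat c z - stat_mean c)))"
    by (rule p4.integrable_const_bound[where B = 1]) auto
  then have int': "integrable \<mu>4 (\<lambda>(a, y). iexp (t * (stat c (a, y) - stat_mean c)))"
    by (simp add: case_prod_beta')
  have I: "(CLINT z|\<mu>4. iexp (t * (stat c z - stat_mean c))) = (CLINT y|\<mu>3. \<Phi> y)"
    unfolding \<Phi>_def using P.integral_snd[OF int'] by (simp add: case_prod_beta')
  have int\<Phi>: "integrable \<mu>3 \<Phi>"
    unfolding \<Phi>_def using P.integrable_snd[OF int'] by simp
  have rate: "0 \<le> clt_rate t (n La)" by (simp add: clt_rate_def)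
  have \<psi>1: "cmod ?\<psi> \<le> 1" using V_limit_nonneg[of c] by simp
  let ?g = "\<lambda>y. clt_rate t (n La) * (V_limit c + \<bar>V c y - V_limit c\<bar>) + (t\<^sup>2 / 2 * \<bar>V c y - V_limit c\<bar> + \<bar>t\<bar> * \<bar>R c y\<bar>)"
  have pw: "cmod (\<Phi> y - ?\<psi>) \<le> ?g y" for y
  proof -
    define \<phi> where "\<phi> = (CLINT a|\<mu> La. iexp (t * (c * (tr p (T La a \<odot> Q y) - real (n La) * tr p (S La \<odot> Q y)))))"
    have "\<Phi> y = (CLINT a|\<mu> La. iexp (t * R c y) * iexp (t * (c * (tr p (T La a \<odot> Q y) - real (n La) * tr p (S La \<odot> Q y)))))"
      unfolding \<Phi>_def
      by (intro Bochner_Integration.integral_cong refl)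
        (simp add: exp_add[symmetric] stat_def stat_mean_def R_def algebra_simps)
    then have \<Phi>: "\<Phi> y = iexp (t * R c y) * \<phi>" by (simp add: \<phi>_def)
    have V_eq: "V c y = c\<^sup>2 * real (n La) * (tr p (S La \<odot> Q y \<odot> S La \<odot> Q y) + tr p (S La \<odot> Q y \<odot> S La \<odot> tp (Q y)))"
      by (simp add: V_def)
    have a: "cmod (\<phi> - exp (- (t\<^sup>2 * V c y) / 2)) \<le> clt_rate t (n La) * V c y"
      unfolding \<phi>_def V_eq by (rule wish_char[OF S_def n])
    have "\<bar>exp (- (t\<^sup>2 * V c y / 2)) - exp (- (t\<^sup>2 * V_limit c / 2))\<bar> \<le> \<bar>t\<^sup>2 * V c y / 2 - t\<^sup>2 * V_limit c / 2\<bar>"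
      using V_nonneg[of c y] V_limit_nonneg[of c] by (intro exp_diff_le) auto
    also have "\<dots> = t\<^sup>2 / 2 * \<bar>V c y - V_limit c\<bar>"
      by (simp add: abs_mult[symmetric] right_diff_distrib diff_divide_distrib[symmetric] del: abs_mult)
        (simp add: abs_mult right_diff_distrib[symmetric])
    finally have b: "cmod (of_real (exp (- (t\<^sup>2 * V c y) / 2)) - ?\<psi>) \<le> t\<^sup>2 / 2 * \<bar>V c y - V_limit c\<bar>"
      by (simp only: of_real_diff[symmetric] norm_of_real real_norm_def minus_divide_left)
    have d: "cmod ((iexp (t * R c y) - 1) * ?\<psi>) \<le> \<bar>t\<bar> * \<bar>R c y\<bar>"
    proof -
      have "cmod ((iexp (t * R c y) - 1) * ?\<psi>) \<le> \<bar>t * R c y\<bar> * 1"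
        unfolding norm_mult by (intro mult_mono iexp_diff_le \<psi>1) auto
      then show ?thesis by (simp add: abs_mult)
    qed
    have e: "cmod (iexp (t * R c y) * (\<phi> - ?\<psi>)) = cmod (\<phi> - ?\<psi>)"
      by (simp add: norm_mult)
    have "\<Phi> y - ?\<psi> = iexp (t * R c y) * (\<phi> - ?\<psi>) + (iexp (t * R c y) - 1) * ?\<psi>"
      unfolding \<Phi> by (simp add: algebra_simps)
    then have "cmod (\<Phi> y - ?\<psi>) \<le> cmod (\<phi> - ?\<psi>) + \<bar>t\<bar> * \<bar>R c y\<bar>"
      using norm_triangle_ineq[of "iexp (t * R c y) * (\<phi> - ?\<psi>)" "(iexp (t * R c y) - 1) * ?\<psi>"] d e by simp
    moreover have "cmod (\<phi> - ?\<psi>) \<le> clt_rate t (n La) * V c y + t\<^sup>2 / 2 * \<bar>V c y - V_limit c\<bar>"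
      using norm_triangle_ineq[of "\<phi> - exp (- (t\<^sup>2 * V c y) / 2)" "of_real (exp (- (t\<^sup>2 * V c y) / 2)) - ?\<psi>"] a b
      by simp
    moreover have "clt_rate t (n La) * V c y \<le> clt_rate t (n La) * (V_limit c + \<bar>V c y - V_limit c\<bar>)"
      using rate by (intro mult_left_mono) auto
    ultimately show ?thesis by linarith
  qed
  let ?B = "clt_rate t (n La) * (V_limit c + \<eta>) + (t\<^sup>2 / 2 * \<eta> + \<bar>t\<bar> * \<rho>)"
  have g: "mean_le \<mu>3 ?g ?B"
    by (intro mean_le_add mean_le_cmult mean_le_const prob_\<mu>3 V_limit_nonneg V R rate) auto
  have i1: "integrable \<mu>3 (\<lambda>y. \<Phi> y - ?\<psi>)" by (intro Bochner_Integration.integrable_diff int\<Phi>) simp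
  have "(\<integral>\<^sup>+y. ennreal (cmod (\<Phi> y - ?\<psi>)) \<partial>\<mu>3) \<le> (\<integral>\<^sup>+y. ennreal (?g y) \<partial>\<mu>3)"
    by (intro nn_integral_mono ennreal_leI pw)
  also have "\<dots> \<le> ennreal ?B" using g by (simp only: mean_le_def)
  finally have "ennreal (LINT y|\<mu>3. cmod (\<Phi> y - ?\<psi>)) \<le> ennreal ?B"
    by (subst nn_integral_eq_integral[symmetric]) (use i1 in auto)
  moreover have "0 \<le> ?B" using g by (simp only: mean_le_def)
  ultimately have "(LINT y|\<mu>3. cmod (\<Phi> y - ?\<psi>)) \<le> ?B" by (simp only: ennreal_le_iff)
  with integral_norm_bound have bound: "cmod (CLINT y|\<mu>3. \<Phi> y - ?\<psi>) \<le> ?B" by (rule order_trans)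
  have eq: "(CLINT y|\<mu>3. \<Phi> y) - ?\<psi> = (CLINT y|\<mu>3. \<Phi> y - ?\<psi>)"
    using int\<Phi> p3.prob_space by simp
  show ?thesis unfolding I eq by (rule bound)
qed

end

section \<open>Explicit error terms\<close>

context four_wishart_bounds
begin

definition V_error :: "real \<Rightarrow> real" where
  "V_error c = c\<^sup>2 * real (n La) * (11 * K\<^sup>2 * real (n Lb) * (real (n Lc) * real (n Ld) * p)\<^sup>2 + 48 * K ^ 3 * (real (n Lb))\<^sup>2 * real (n Lc) * real (n Ld) * real p ^ 3
    + 16 * K ^ 3 * real p ^ 3 * (dev Lb * (real (n Lc) * real (n Ld)) + dev Lc * (real (n Lb) * real (n Ld)) + dev Ld * (real (n Lb) * real (n Lc))))"

definition R_error :: "real \<Rightarrow> real" where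
  "R_error c = \<bar>c\<bar> * real (n La) * (sqrt (2 * real (n Lb) * (16 * K ^ 3 * real (n Lc) * real (n Ld) * real p ^ 3))
      + (real (n Lb) * sqrt (2 * real (n Lc) * (4 * K\<^sup>2 * real (n Ld) * (real p)\<^sup>2)) + real (n Lb) * real (n Lc) * sqrt (2 * real (n Ld) * (K * p))))"

lemma V_mean: "mean_le \<mu>3 (\<lambda>z. \<bar>V c z - V_limit c\<bar>) (V_error c)"
  unfolding V_error_def
proof (rule mean_le_mono[OF mean_le_cmult[OF mean_le_add[OF SQSQ_mean W_mean]]])
  show "(\<lambda>z. \<bar>V c z - V_limit c\<bar>) \<in> borel_measurable \<mu>3"
    by (intro all_moments_measurable all_moments_abs p3.all_moments_diff all_moments_V p3.all_moments_const)
  show "\<bar>V c z - V_limit c\<bar> \<le> c\<^sup>2 * real (n La) * (\<bar>tr p (S La \<odot> Q z \<odot> S La \<odot> Q z)\<bar>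
      + \<bar>tr p (S La \<odot> Q z \<odot> S La \<odot> tp (Q z)) - real (n Lb) * real (n Lc) * real (n Ld) * (\<tau> Lb La * \<tau> Lc Lb * \<tau> Ld Lc * \<tau> Ld La)\<bar>)" for z
  proof -
    have "\<bar>k * (x + y) - k * w\<bar> \<le> k * (\<bar>x\<bar> + \<bar>y - w\<bar>)" if "0 \<le> k" for k x y w :: real
    proof -
      have "\<bar>k * (x + y) - k * w\<bar> = k * \<bar>x + (y - w)\<bar>"
        using that by (simp add: abs_mult right_diff_distrib[symmetric] add_diff_eq)
      also have "\<dots> \<le> k * (\<bar>x\<bar> + \<bar>y - w\<bar>)" by (intro mult_left_mono that abs_triangle_ineq)
      finally show ?thesis .
    qed
    then show ?thesis unfolding V_def V_limit_def by simp
  qed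
qed auto

lemma R_mean: "mean_le \<mu>3 (\<lambda>z. \<bar>R c z\<bar>) (R_error c)"
  unfolding R_error_def
proof (rule mean_le_mono[OF mean_le_cmult[OF SQ_mean]])
  show "(\<lambda>z. \<bar>R c z\<bar>) \<in> borel_measurable \<mu>3"
    by (intro all_moments_measurable all_moments_abs all_moments_R)
  show "\<bar>R c z\<bar> \<le> \<bar>c\<bar> * real (n La) * \<bar>tr p (S La \<odot> Q z) - real (n Lb) * real (n Lc) * real (n Ld) * \<tau>4\<bar>" for z
    by (simp add: R_def abs_mult)
qed auto

lemma stat_char_bound:
  fixes c t :: real
  shows
  "cmod ((CLINT z|\<mu>4. iexp (t * (stat c z - stat_mean c))) - exp (- (t\<^sup>2 * V_limit c) / 2))
    \<le> clt_rate t (n La) * (V_limit c + V_error c) + (t\<^sup>2 / 2 * V_error c + \<bar>t\<bar> * R_error c)"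
  by (rule stat_char_le[OF n V_mean R_mean])

end

section \<open>The multivariate normal and Wishart distributions\<close>

text \<open>The change of variable y = - m + z / sqrt a, with the standard normal density restored
  at the cost of sqrt (2 pi).\<close>

lemma nn_integral_gaussian_substitution:
  fixes a m :: real
  assumes a: "0 < a" and [measurable]: "f \<in> borel_measurable borel"
  shows "(\<integral>\<^sup>+y. f y * ennreal (exp (- (a * (y + m)\<^sup>2) / 2)) \<partial>lborel)
    = ennreal (sqrt (2 * pi) / sqrt a) * (\<integral>\<^sup>+z. f (- m + z / sqrt a) \<partial>std_normal_distribution)"
proof -
  have "(\<integral>\<^sup>+y. f y * ennreal (exp (- (a * (y + m)\<^sup>2) / 2)) \<partial>lborel)
      = ennreal \<bar>1 / sqrt a\<bar> * (\<integral>\<^sup>+z. f (- m + 1 / sqrt a * z) * ennreal (exp (- (a * ((- m + 1 / sqrt a * z) + m)\<^sup>2) / 2)) \<partial>lborel)"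
    by (rule nn_integral_real_affine) (use a in auto)
  also have "(\<integral>\<^sup>+z. f (- m + 1 / sqrt a * z) * ennreal (exp (- (a * ((- m + 1 / sqrt a * z) + m)\<^sup>2) / 2)) \<partial>lborel)
      = (\<integral>\<^sup>+z. ennreal (sqrt (2 * pi)) * (ennreal (std_normal_density z) * f (- m + z / sqrt a)) \<partial>lborel)"
  proof (rule nn_integral_cong)
    fix z
    have "a * ((- m + 1 / sqrt a * z) + m)\<^sup>2 = z\<^sup>2" using a by (simp add: power_divide)
    moreover have "ennreal (exp (- z\<^sup>2 / 2)) = ennreal (sqrt (2 * pi)) * ennreal (std_normal_density z)"
      by (subst ennreal_mult[symmetric]) (auto simp: std_normal_density_def)
    ultimately show "f (- m + 1 / sqrt a * z) * ennreal (exp (- (a * ((- m + 1 / sqrt a * z) + m)\<^sup>2) / 2))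
        = ennreal (sqrt (2 * pi)) * (ennreal (std_normal_density z) * f (- m + z / sqrt a))"
      by (simp only:) (simp add: mult_ac)
  qed
  also have "\<dots> = ennreal (sqrt (2 * pi)) * (\<integral>\<^sup>+z. f (- m + z / sqrt a) \<partial>std_normal_distribution)"
    by (simp add: nn_integral_cmult nn_integral_density)
  also have "ennreal \<bar>1 / sqrt a\<bar> * \<dots> = ennreal (sqrt (2 * pi) / sqrt a) * (\<integral>\<^sup>+z. f (- m + z / sqrt a) \<partial>std_normal_distribution)"
    using a by (simp add: mult.assoc[symmetric] ennreal_mult[symmetric])
  finally show ?thesis .
qed

lemma measurable_lin [measurable]: "lin p L \<in> measurable (gauss p) (\<Pi>\<^sub>M r\<in>{..<p}. borel)"
  unfolding lin_def by (rule measurable_restrict) auto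

lemma measurable_bil [measurable]: "(\<lambda>x. bil p P x x) \<in> borel_measurable (\<Pi>\<^sub>M r\<in>{..<p}. borel)"
  unfolding bil_def by (intro borel_measurable_sum borel_measurable_times measurable_component_singleton borel_measurable_const) auto

interpretation lborels: product_sigma_finite "\<lambda>_. lborel :: real measure"
  by standard

lemma bil_Suc:
  assumes "tp P = P" "P p p = a" "a \<noteq> 0"
  defines "P' \<equiv> \<lambda>r s. P r s - P p r * P p s / a"
  shows "bil (Suc p) P x x = bil p P' x x + a * (x p + (\<Sum>s<p. P p s * x s) / a)\<^sup>2"
proof -
  let ?q = "\<Sum>s<p. P p s * x s"
  have sym: "P r p = P p r" for r using fun_cong[OF fun_cong[OF assms(1)], of r p] by (simp add: tp_def)
  have "bil p P' x x = bil p P x x - (\<Sum>r<p. \<Sum>s<p. (P p r * x r) * (P p s * x s) / a)"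
    by (simp add: bil_def P'_def sum_subtractf[symmetric] algebra_simps)
  also have "(\<Sum>r<p. \<Sum>s<p. (P p r * x r) * (P p s * x s) / a) = ?q\<^sup>2 / a"
    by (simp add: power2_eq_square sum_product sum_divide_distrib)
  finally have 1: "bil p P' x x = bil p P x x - ?q\<^sup>2 / a" .
  have "bil (Suc p) P x x = bil p P x x + x p * ?q + ?q * x p + a * (x p)\<^sup>2"
  proof -
    have c1: "(\<Sum>r<p. x r * P r p * x p) = ?q * x p"
      unfolding sum_distrib_right sym by (intro sum.cong refl) (simp add: mult_ac)
    have c2: "(\<Sum>s<p. x p * P p s * x s) = x p * ?q"
      unfolding sum_distrib_left by (intro sum.cong refl) (simp add: mult_ac)
    have "bil (Suc p) P x x = (bil p P x x + (\<Sum>r<p. x r * P r p * x p)) + ((\<Sum>s<p. x p * P p s * x s) + x p * P p p * x p)"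
      by (simp add: bil_def sum.distrib)
    then show ?thesis unfolding c1 c2 assms(2) by (simp add: power2_eq_square)
  qed
  then show ?thesis unfolding 1 using assms(3) by (simp add: power2_eq_square field_simps)
qed

lemma bil_cong: "(\<And>r. r < p \<Longrightarrow> x r = y r) \<Longrightarrow> bil p P x x = bil p P y y"
  unfolding bil_def by (intro sum.cong refl) simp

text \<open>Completing the square in the last coordinate: the inductive step passes to the Schur complement.\<close>

lemma gaussian_density_factorization:
  assumes "tp P = P" and "\<And>x. (\<exists>r<p. x r \<noteq> 0) \<Longrightarrow> 0 < bil p P x x"
  shows "\<exists>L c. 0 < c \<and> (\<forall>g. bil p P (lin p L g) (lin p L g) = (\<Sum>r<p. (g r)\<^sup>2)) \<and>
    (\<forall>f\<in>borel_measurable (\<Pi>\<^sub>M r\<in>{..<p}. borel).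
      (\<integral>\<^sup>+x. f x * ennreal (exp (- bil p P x x / 2)) \<partial>(\<Pi>\<^sub>M r\<in>{..<p}. lborel))
        = ennreal c * (\<integral>\<^sup>+g. f (lin p L g) \<partial>gauss p))"
  using assms
proof (induction p arbitrary: P)
  case 0
  \<comment> \<open>In dimension 0 the product space has a single point, this
    \<open>undefined\<close> function, and both integrals are the value of \<open>f\<close>
    there.\<close>
  have "lin 0 (\<lambda>_ _. 0) g = (\<lambda>_. undefined)" for g by (simp add: lin_def restrict_def)
  then show ?case
    by (intro exI[of _ "\<lambda>_ _. 0"] exI[of _ 1])
      (auto simp: bil_def gauss_def lborels.nn_integral_empty gauss.emeasure_space_1[of 0, unfolded gauss_def, simplified])
next
  case (Suc p)
  define a where "a = P p p"
  define P' where "P' r s = P r s - P p r * P p s / a" for r s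
  define m where "m x = (\<Sum>s<p. P p s * x s) / a" for x
  have a: "0 < a"
  proof -
    have "bil (Suc p) P (\<lambda>r. if r = p then 1 else 0) (\<lambda>r. if r = p then 1 else 0) = a"
      by (simp add: bil_def a_def)
    then show ?thesis using Suc.prems(2)[of "\<lambda>r. if r = p then 1 else 0"] by auto
  qed
  have bilS: "bil (Suc p) P x x = bil p P' x x + a * (x p + m x)\<^sup>2" for x
    unfolding m_def P'_def using a by (intro bil_Suc[OF Suc.prems(1)]) (auto simp: a_def)
  have m_upd: "m (x(p := y)) = m x" for x y by (simp add: m_def)
  have tpP': "tp P' = P'"
    using fun_cong[OF fun_cong[OF Suc.prems(1)]] by (intro ext) (simp add: tp_def P'_def mult.commute)
  have pd: "0 < bil p P' x x" if "\<exists>r<p. x r \<noteq> 0" for x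
  proof -
    \<comment> \<open>The last coordinate - m x makes the completed square vanish, so positivity
      passes to the Schur complement.\<close>
    have "0 < bil (Suc p) P (x(p := - m x)) (x(p := - m x))"
      using that by (intro Suc.prems(2)) (metis fun_upd_other less_SucI less_irrefl)
    also have "\<dots> = bil p P' (x(p := - m x)) (x(p := - m x))" by (simp add: bilS m_upd)
    also have "\<dots> = bil p P' x x" by (rule bil_cong) simp
    finally show ?thesis .
  qed
  from Suc.IH[OF tpP' pd] obtain L' c' where c': "0 < c'"
    and L': "\<And>g. bil p P' (lin p L' g) (lin p L' g) = (\<Sum>r<p. (g r)\<^sup>2)"
    and IH: "\<And>f. f \<in> borel_measurable (\<Pi>\<^sub>M r\<in>{..<p}. borel) \<Longrightarrow>
      (\<integral>\<^sup>+x. f x * ennreal (exp (- bil p P' x x / 2)) \<partial>(\<Pi>\<^sub>M r\<in>{..<p}. lborel)) = ennreal c' * (\<integral>\<^sup>+g. f (lin p L' g) \<partial>gauss p)"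
    by blast
  \<comment> \<open>L stays lower triangular. Its new last row makes the last coordinate of L g
    equal to - m (L' g) + g_p / sqrt a: conditionally Gaussian with mean - m and variance 1 /
    a.\<close>
  define L where "L r s = (if r < p then (if s < p then L' r s else 0)
    else (if s < p then - (\<Sum>t<p. P p t * L' t s) / a else 1 / sqrt a))" for r s
  have lin_eq: "lin (Suc p) L g = (lin p L' g)(p := - m (lin p L' g) + g p / sqrt a)" for g
  proof
    fix r
    consider "r < p" | "r = p" | "p < r" by linarith
    then show "lin (Suc p) L g r = ((lin p L' g)(p := - m (lin p L' g) + g p / sqrt a)) r"
    proof cases
      case 2
      have "m (lin p L' g) = (\<Sum>t<p. \<Sum>s<p. P p t * L' t s * g s) / a"
        by (simp add: m_def lin_def sum_distrib_left mult.assoc)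
      also have "\<dots> = (\<Sum>s<p. \<Sum>t<p. P p t * L' t s * g s) / a" by (subst sum.swap) rule
      also have "\<dots> = (\<Sum>s<p. (\<Sum>t<p. P p t * L' t s) / a * g s)"
        by (simp add: sum_divide_distrib sum_distrib_right)
      finally show ?thesis using 2 by (simp add: lin_def L_def sum_negf)
    qed (auto simp: lin_def L_def)
  qed
  have L: "bil (Suc p) P (lin (Suc p) L g) (lin (Suc p) L g) = (\<Sum>r<Suc p. (g r)\<^sup>2)" for g
  proof -
    have "bil (Suc p) P (lin (Suc p) L g) (lin (Suc p) L g)
        = bil p P' (lin (Suc p) L g) (lin (Suc p) L g) + a * (g p / sqrt a)\<^sup>2"
      unfolding bilS by (simp add: lin_eq m_upd)
    also have "bil p P' (lin (Suc p) L g) (lin (Suc p) L g) = bil p P' (lin p L' g) (lin p L' g)"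
      by (rule bil_cong) (simp add: lin_eq)
    finally show ?thesis using a by (simp add: L' power_divide)
  qed
  have lS: "{..<Suc p} = insert p {..<p}" by auto
  have sets_PiM_lborel: "sets (\<Pi>\<^sub>M r\<in>I. lborel) = sets (\<Pi>\<^sub>M r\<in>I. borel)" for I :: "nat set"
    by (intro sets_PiM_cong) auto
  let ?k = "sqrt (2 * pi) / sqrt a"
  have "(\<integral>\<^sup>+x. f x * ennreal (exp (- bil (Suc p) P x x / 2)) \<partial>(\<Pi>\<^sub>M r\<in>{..<Suc p}. lborel))
      = ennreal (c' * ?k) * (\<integral>\<^sup>+g. f (lin (Suc p) L g) \<partial>gauss (Suc p))"
    if f: "f \<in> borel_measurable (\<Pi>\<^sub>M r\<in>{..<Suc p}. borel)" for f
  proof -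
    have [measurable]: "f \<in> borel_measurable (\<Pi>\<^sub>M r\<in>{..<Suc p}. borel)" by fact
    \<comment> \<open>\<open>f\<close> with its last coordinate integrated out; \<open>?k\<close> is
      the mass of that one-dimensional Gaussian integral.\<close>
    define f1 where "f1 x = ennreal ?k * (\<integral>\<^sup>+z. f (x(p := - m x + z / sqrt a)) \<partial>std_normal_distribution)" for x
    have mm [measurable]: "m \<in> borel_measurable (\<Pi>\<^sub>M r\<in>{..<p}. borel)"
      unfolding m_def by measurable
    have upd: "(\<lambda>w. (fst w)(p := - m (fst w) + snd w / sqrt a))
        \<in> measurable ((\<Pi>\<^sub>M r\<in>{..<p}. borel) \<Otimes>\<^sub>M std_normal_distribution) (\<Pi>\<^sub>M r\<in>{..<Suc p}. borel)"
      using measurable_compose[OF _ measurable_add_dim[of p "{..<p}" "\<lambda>_. borel"],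
          of "\<lambda>w. (fst w, - m (fst w) + snd w / sqrt a)" "(\<Pi>\<^sub>M r\<in>{..<p}. borel) \<Otimes>\<^sub>M std_normal_distribution"]
      unfolding lS by simp
    have f1: "f1 \<in> borel_measurable (\<Pi>\<^sub>M r\<in>{..<p}. borel)"
      unfolding f1_def
      using measurable_compose[OF upd f]
      by (intro borel_measurable_times_ennreal borel_measurable_const std_normal.borel_measurable_nn_integral)
        (simp add: case_prod_beta')
    have slice: "(\<lambda>y. f (x(p := y))) \<in> borel_measurable borel" if "x \<in> space (\<Pi>\<^sub>M r\<in>{..<p}. borel)" for x
    proof -
      have "(\<lambda>y. (x, y)) \<in> measurable borel ((\<Pi>\<^sub>M r\<in>{..<p}. borel) \<Otimes>\<^sub>M borel)" using that by measurable
      from measurable_compose[OF this measurable_add_dim[of p "{..<p}" "\<lambda>_. borel"]]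
      have "(\<lambda>y. x(p := y)) \<in> measurable borel (\<Pi>\<^sub>M r\<in>{..<Suc p}. borel)" by (simp add: lS)
      then show ?thesis by (rule measurable_compose[OF _ f])
    qed
    have "(\<integral>\<^sup>+x. f x * ennreal (exp (- bil (Suc p) P x x / 2)) \<partial>(\<Pi>\<^sub>M r\<in>{..<Suc p}. lborel))
        = (\<integral>\<^sup>+x. \<integral>\<^sup>+y. f (x(p := y)) * ennreal (exp (- bil (Suc p) P (x(p := y)) (x(p := y)) / 2)) \<partial>lborel \<partial>(\<Pi>\<^sub>M r\<in>{..<p}. lborel))"
      unfolding lS
    proof (rule lborels.product_nn_integral_insert)
      have "(\<lambda>x. f x * ennreal (exp (- bil (Suc p) P x x / 2))) \<in> borel_measurable (\<Pi>\<^sub>M r\<in>{..<Suc p}. borel)"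
        by measurable
      then show "(\<lambda>x. f x * ennreal (exp (- bil (Suc p) P x x / 2))) \<in> borel_measurable (\<Pi>\<^sub>M r\<in>insert p {..<p}. lborel)"
        by (simp add: measurable_cong_sets[OF sets_PiM_lborel refl] lS)
    qed auto
    also have "\<dots> = (\<integral>\<^sup>+x. f1 x * ennreal (exp (- bil p P' x x / 2)) \<partial>(\<Pi>\<^sub>M r\<in>{..<p}. lborel))"
    proof (rule nn_integral_cong)
      fix x assume "x \<in> space (\<Pi>\<^sub>M r\<in>{..<p}. lborel :: real measure)"
      then have x: "x \<in> space (\<Pi>\<^sub>M r\<in>{..<p}. borel :: real measure)" by (simp add: space_PiM)
      note [measurable] = slice[OF x]
      have e: "ennreal (exp (- bil (Suc p) P (x(p := y)) (x(p := y)) / 2))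
          = ennreal (exp (- bil p P' x x / 2)) * ennreal (exp (- (a * (y + m x)\<^sup>2) / 2))" for y
      proof -
        have "bil p P' (x(p := y)) (x(p := y)) = bil p P' x x" by (rule bil_cong) simp
        then show ?thesis
          by (simp add: bilS m_upd ennreal_mult[symmetric] exp_add[symmetric] add_divide_distrib[symmetric])
      qed
      have "(\<integral>\<^sup>+y. f (x(p := y)) * ennreal (exp (- bil (Suc p) P (x(p := y)) (x(p := y)) / 2)) \<partial>lborel)
          = (\<integral>\<^sup>+y. ennreal (exp (- bil p P' x x / 2)) * (f (x(p := y)) * ennreal (exp (- (a * (y + m x)\<^sup>2) / 2))) \<partial>lborel)"
        unfolding e by (simp add: mult_ac)
      also have "\<dots> = ennreal (exp (- bil p P' x x / 2)) * (\<integral>\<^sup>+y. f (x(p := y)) * ennreal (exp (- (a * (y + m x)\<^sup>2) / 2)) \<partial>lborel)"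
        by (rule nn_integral_cmult) simp
      also have "(\<integral>\<^sup>+y. f (x(p := y)) * ennreal (exp (- (a * (y + m x)\<^sup>2) / 2)) \<partial>lborel) = f1 x"
        unfolding f1_def by (rule nn_integral_gaussian_substitution[OF a]) simp
      also have "ennreal (exp (- bil p P' x x / 2)) * f1 x = f1 x * ennreal (exp (- bil p P' x x / 2))"
        by (rule mult.commute)
      finally show "(\<integral>\<^sup>+y. f (x(p := y)) * ennreal (exp (- bil (Suc p) P (x(p := y)) (x(p := y)) / 2)) \<partial>lborel)
          = f1 x * ennreal (exp (- bil p P' x x / 2))" .
    qed
    also have "\<dots> = ennreal c' * (\<integral>\<^sup>+g. f1 (lin p L' g) \<partial>gauss p)" by (rule IH[OF f1])
    also have "(\<integral>\<^sup>+g. f1 (lin p L' g) \<partial>gauss p)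
        = ennreal ?k * (\<integral>\<^sup>+g. \<integral>\<^sup>+z. f ((lin p L' g)(p := - m (lin p L' g) + z / sqrt a)) \<partial>std_normal_distribution \<partial>gauss p)"
      unfolding f1_def
    proof (rule nn_integral_cmult)
      have "(\<lambda>w. (lin p L' (fst w), snd w)) \<in> measurable (gauss p \<Otimes>\<^sub>M std_normal_distribution) ((\<Pi>\<^sub>M r\<in>{..<p}. borel) \<Otimes>\<^sub>M std_normal_distribution)"
        by measurable
      from measurable_compose[OF measurable_compose[OF this upd] f]
      show "(\<lambda>g. \<integral>\<^sup>+z. f ((lin p L' g)(p := - m (lin p L' g) + z / sqrt a)) \<partial>std_normal_distribution) \<in> borel_measurable (gauss p)"
        by (intro std_normal.borel_measurable_nn_integral) (simp add: case_prod_beta')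
    qed
    also have "(\<integral>\<^sup>+g. \<integral>\<^sup>+z. f ((lin p L' g)(p := - m (lin p L' g) + z / sqrt a)) \<partial>std_normal_distribution \<partial>gauss p)
        = (\<integral>\<^sup>+g. f (lin (Suc p) L g) \<partial>gauss (Suc p))"
    proof -
      have "lin p L' (g(p := z)) = lin p L' g" for g z
        unfolding lin_def by (intro restrict_ext sum.cong refl) simp
      then have "f ((lin p L' g)(p := - m (lin p L' g) + z / sqrt a)) = f (lin (Suc p) L (g(p := z)))" for g z
        by (simp add: lin_eq)
      moreover have "(\<lambda>g. f (lin (Suc p) L g)) \<in> borel_measurable (Pi\<^sub>M (insert p {..<p}) (\<lambda>_. std_normal_distribution))"
        using measurable_compose[OF measurable_lin[of "Suc p" L] f] by (simp add: gauss_def lS)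
      ultimately show ?thesis
        unfolding gauss_def lS using std_normals.product_nn_integral_insert[of "{..<p}" p "\<lambda>g. f (lin (Suc p) L g)"]
        by simp
    qed
    finally have "(\<integral>\<^sup>+x. f x * ennreal (exp (- bil (Suc p) P x x / 2)) \<partial>(\<Pi>\<^sub>M r\<in>{..<Suc p}. lborel))
      = ennreal c' * (ennreal ?k * (\<integral>\<^sup>+g. f (lin (Suc p) L g) \<partial>gauss (Suc p)))" .
    moreover have "ennreal (c' * ?k) = ennreal c' * ennreal ?k"
      using c' a by (intro ennreal_mult) auto
    ultimately show ?thesis by (simp only: mult.assoc)
  qed
  moreover have "0 < c' * ?k" using c' a by simp
  ultimately show ?case using L by blast
qed

definition fun_of_mat :: "nat \<Rightarrow> real mat \<Rightarrow> nat \<Rightarrow> nat \<Rightarrow> real" where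
  "fun_of_mat p A r s = (if r < p \<and> s < p then A $$ (r, s) else 0)"

lemma scalar_prod_mult_mat_vec_eq_bil:
  assumes "A \<in> carrier_mat p p"
  shows "scalar_prod (Matrix.vec p x) (A *\<^sub>v Matrix.vec p x) = bil p (fun_of_mat p A) x x"
proof -
  have "scalar_prod (Matrix.vec p x) (A *\<^sub>v Matrix.vec p x) = (\<Sum>r<p. x r * (\<Sum>s<p. A $$ (r, s) * x s))"
    using assms by (simp add: scalar_prod_def lessThan_atLeast0)
  then show ?thesis by (simp add: bil_eq_lin fun_of_mat_def)
qed

text \<open>A kernel vector would contradict definiteness, so the inverse exists. The transpose of
  \<open>B\<close> is a left inverse and hence equals \<open>B\<close>, and x' B x = y' S y for y =
  B x.\<close>

lemma pos_def_mat_inverse: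
  assumes S: "pos_def_mat p S"
  defines "B \<equiv> the (mat_inverse S)"
  shows "B \<in> carrier_mat p p" "S * B = 1\<^sub>m p" "transpose_mat B = B"
    and "x \<in> carrier_vec p \<Longrightarrow> x \<noteq> 0\<^sub>v p \<Longrightarrow> 0 < scalar_prod x (B *\<^sub>v x)"
proof -
  have c: "S \<in> carrier_mat p p" and t: "transpose_mat S = S"
    and pd: "\<And>x. x \<in> carrier_vec p \<Longrightarrow> x \<noteq> 0\<^sub>v p \<Longrightarrow> scalar_prod x (S *\<^sub>v x) > 0"
    using S by (auto simp: pos_def_mat_def)
  have "Determinant.det S \<noteq> 0"
  proof
    assume "Determinant.det S = 0"
    then obtain v where "v \<in> carrier_vec p" "v \<noteq> 0\<^sub>v p" "S *\<^sub>v v = 0\<^sub>v p"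
      unfolding det_0_iff_vec_prod_zero_field[OF c] by blast
    then show False using pd[of v] by simp
  qed
  then have "S \<in> Units (ring_mat TYPE(real) p ())" by (rule det_non_zero_imp_unit[OF c])
  then have "mat_inverse S \<noteq> None" using mat_inverse(1)[OF c, where b = "()"] by blast
  then obtain B' where "mat_inverse S = Some B'" by blast
  with mat_inverse(2)[OF c this] have B: "S * B = 1\<^sub>m p" "B * S = 1\<^sub>m p" "B \<in> carrier_mat p p"
    by (auto simp: B_def)
  then show "B \<in> carrier_mat p p" "S * B = 1\<^sub>m p" by auto
  have tB: "transpose_mat B \<in> carrier_mat p p" using B by simp
  have tBS: "transpose_mat B * S = 1\<^sub>m p"
    using transpose_mult[OF c B(3)] B(1) t by simp
  have "transpose_mat B * (S * B) = (transpose_mat B * S) * B"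
    by (rule assoc_mult_mat[OF tB c B(3), symmetric])
  then have "transpose_mat B * (S * B) = B" unfolding tBS using B(3) by simp
  then show "transpose_mat B = B" using B(1) tB by simp
  assume x: "x \<in> carrier_vec p" "x \<noteq> 0\<^sub>v p"
  define y where "y = B *\<^sub>v x"
  have y: "y \<in> carrier_vec p" using B(3) x by (simp add: y_def)
  have Sy: "S *\<^sub>v y = x"
    unfolding y_def using assoc_mult_mat_vec[OF c B(3) x(1)] B(1) x by simp
  have "y \<noteq> 0\<^sub>v p" using Sy c x(2) by auto
  then have "0 < scalar_prod y (S *\<^sub>v y)" using pd y by blast
  also have "\<dots> = scalar_prod x (B *\<^sub>v x)"
    using Sy x y by (simp add: y_def comm_scalar_prod)
  finally show "0 < scalar_prod x (B *\<^sub>v x)" .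
qed

lemma bil_unit:
  assumes "r < p" "s < p"
  shows "bil p C (\<lambda>i. if i = r then 1 else 0) (\<lambda>i. if i = s then 1 else 0) = C r s"
proof -
  have "bil p C (\<lambda>i. if i = r then 1 else 0) (\<lambda>i. if i = s then 1 else 0)
      = (\<Sum>i<p. C i s * (if i = r then 1 else 0))"
    unfolding bil_eq_lin by (intro sum.cong refl) (simp only: sum_if_eq_less[OF assms(2)] mult.commute)
  then show ?thesis by (simp only: sum_if_eq_less[OF assms(1)])
qed

lemma bil_add: "bil p C (\<lambda>i. x i + y i) (\<lambda>i. x i + y i) = bil p C x x + bil p C x y + bil p C y x + bil p C y y"
  by (simp add: bil_def sum.distrib algebra_simps)

text \<open>Polarization: unit vectors give the diagonal, sums of two unit vectors the other
  entries.\<close>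

lemma bil_eq_sum_squares_imp:
  assumes sym: "tp C = C" and sq: "\<And>g. bil p C g g = (\<Sum>r<p. (g r)\<^sup>2)" and rs: "r < p" "s < p"
  shows "C r s = (if r = s then 1 else 0)"
proof -
  have diag: "C i i = 1" if "i < p" for i
  proof -
    have "C i i = (\<Sum>r<p. (if r = i then 1 else 0 :: real)\<^sup>2)"
      using sq[of "\<lambda>r. if r = i then 1 else 0"] bil_unit[OF that that] by simp
    also have "\<dots> = (\<Sum>r<p. if r = i then 1 else 0)" by (intro sum.cong) auto
    finally show ?thesis using that by simp
  qed
  show ?thesis
  proof (cases "r = s")
    case False
    have "(\<Sum>i<p. ((if i = r then 1 else 0) + (if i = s then 1 else 0 :: real))\<^sup>2)
        = (\<Sum>i<p. (if i = r then 1 else 0) + (if i = s then 1 else 0))"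
      using False by (intro sum.cong) auto
    also have "\<dots> = 2" using rs by (simp add: sum.distrib)
    finally have "C r r + C r s + C s r + C s s = 2"
      using sq[of "\<lambda>i. (if i = r then 1 else 0) + (if i = s then 1 else 0)"] rs
      by (simp only: bil_add bil_unit)
    moreover have "C s r = C r s" using fun_cong[OF fun_cong[OF sym], of r s] by (simp add: tp_def)
    ultimately show ?thesis using diag rs False by simp
  qed (use diag rs in simp)
qed

text \<open>Factoring the inverse of \<open>S\<close> shows the density to be a constant multiple of
  the law of L g. The constant is left unevaluated, as 1/q times k, and total mass 1 fixes it; that
  premise will come from the Wishart law. Finiteness is recorded so that products of the measure
  make sense beforehand.\<close>

lemma mv_normal_eq_distr:
  assumes S: "pos_def_mat p S"
  shows "\<exists>L. emeasure (mv_normal p S) (space (mv_normal p S)) \<noteq> \<top>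
    \<and> (emeasure (mv_normal p S) (space (mv_normal p S)) = 1 \<longrightarrow>
        mv_normal p S = distr (gauss p) (\<Pi>\<^sub>M r\<in>{..<p}. lborel) (lin p L))
    \<and> (\<forall>r<p. \<forall>s<p. mm p L (tp L) r s = S $$ (r, s))"
proof -
  have c: "S \<in> carrier_mat p p" using S by (simp add: pos_def_mat_def)
  define B where "B = the (mat_inverse S)"
  note B = pos_def_mat_inverse[OF S, folded B_def]
  define P where "P = fun_of_mat p B"
  have tpP: "tp P = P"
  proof (intro ext)
    fix r s
    show "tp P r s = P r s"
    proof (cases "r < p \<and> s < p")
      case True
      then have "transpose_mat B $$ (r, s) = B $$ (s, r)" using B(1) by simp
      then show ?thesis using True B(3) by (simp add: tp_def P_def fun_of_mat_def)
    qed (auto simp: tp_def P_def fun_of_mat_def)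
  qed
  have quad: "scalar_prod (Matrix.vec p x) (B *\<^sub>v Matrix.vec p x) = bil p P x x" for x
    unfolding P_def by (rule scalar_prod_mult_mat_vec_eq_bil[OF B(1)])
  have pd: "0 < bil p P x x" if "\<exists>r<p. x r \<noteq> 0" for x
  proof -
    have "Matrix.vec p x \<noteq> 0\<^sub>v p"
    proof
      assume "Matrix.vec p x = 0\<^sub>v p"
      then have "x r = 0" if "r < p" for r using that by (metis index_vec index_zero_vec(1))
      with that show False by blast
    qed
    then show ?thesis using B(4)[of "Matrix.vec p x"] by (simp add: quad)
  qed
  from gaussian_density_factorization[OF tpP pd] obtain L k where k: "0 < k"
    and L: "\<And>g. bil p P (lin p L g) (lin p L g) = (\<Sum>r<p. (g r)\<^sup>2)"
    and nn: "\<And>f. f \<in> borel_measurable (\<Pi>\<^sub>M r\<in>{..<p}. borel) \<Longrightarrow>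
      (\<integral>\<^sup>+x. f x * ennreal (exp (- bil p P x x / 2)) \<partial>(\<Pi>\<^sub>M r\<in>{..<p}. lborel)) = ennreal k * (\<integral>\<^sup>+g. f (lin p L g) \<partial>gauss p)"
    by blast
  let ?M = "\<Pi>\<^sub>M r\<in>{..<p}. lborel :: real measure"
  have sets_M: "sets ?M = sets (\<Pi>\<^sub>M r\<in>{..<p}. borel)" by (intro sets_PiM_cong) auto
  have lin_meas: "lin p L \<in> measurable (gauss p) ?M"
    by (subst measurable_cong_sets[OF refl sets_M]) (rule measurable_lin)
  define q where "q = sqrt ((2 * pi) ^ p * Determinant.det S)"
  have dens: "mv_normal p S = density ?M (\<lambda>x. ennreal (exp (- bil p P x x / 2) / q))"
    unfolding mv_normal_def B_def[symmetric] quad q_def by simp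
  have bil_meas: "(\<lambda>x. bil p P x x) \<in> borel_measurable ?M"
    by (subst measurable_cong_sets[OF sets_M refl]) (rule measurable_bil)
  have em: "emeasure (mv_normal p S) A = ennreal (1 / q) * (ennreal k * emeasure (distr (gauss p) ?M (lin p L)) A)"
    if A: "A \<in> sets ?M" for A
  proof -
    have "emeasure (mv_normal p S) A = (\<integral>\<^sup>+x. ennreal (exp (- bil p P x x / 2) / q) * indicator A x \<partial>?M)"
      unfolding dens using A bil_meas by (intro emeasure_density) auto
    also have "\<dots> = (\<integral>\<^sup>+x. ennreal (1 / q) * (indicator A x * ennreal (exp (- bil p P x x / 2))) \<partial>?M)"
    proof (rule nn_integral_cong)
      fix x
      have "ennreal (exp (- bil p P x x / 2) / q) = ennreal (1 / q) * ennreal (exp (- bil p P x x / 2))"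
        by (subst ennreal_mult''[symmetric]) (auto simp: field_simps)
      then show "ennreal (exp (- bil p P x x / 2) / q) * indicator A x
          = ennreal (1 / q) * (indicator A x * ennreal (exp (- bil p P x x / 2)))" by (simp add: mult_ac)
    qed
    also have "\<dots> = ennreal (1 / q) * (\<integral>\<^sup>+x. indicator A x * ennreal (exp (- bil p P x x / 2)) \<partial>?M)"
      using A bil_meas by (intro nn_integral_cmult) auto
    also have "(\<integral>\<^sup>+x. indicator A x * ennreal (exp (- bil p P x x / 2)) \<partial>?M) = ennreal k * (\<integral>\<^sup>+g. indicator A (lin p L g) \<partial>gauss p)"
      using A sets_M by (intro nn) auto
    also have "(\<integral>\<^sup>+g. indicator A (lin p L g) \<partial>gauss p) = emeasure (distr (gauss p) ?M (lin p L)) A"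
      using A lin_meas by (subst nn_integral_distr[symmetric, of "lin p L" "gauss p" ?M "indicator A"]) auto
    finally show ?thesis .
  qed
  have sp: "space (mv_normal p S) = space ?M" unfolding dens by simp
  have "prob_space (distr (gauss p) ?M (lin p L))" by (rule gauss.prob_space_distr[OF lin_meas])
  then have "emeasure (distr (gauss p) ?M (lin p L)) (space ?M) = 1"
    using prob_space.emeasure_space_1[of "distr (gauss p) ?M (lin p L)"] by simp
  with em[of "space ?M"] have const: "emeasure (mv_normal p S) (space (mv_normal p S)) = ennreal (1 / q) * ennreal k"
    by (simp add: sp)
  have "mv_normal p S = distr (gauss p) ?M (lin p L)" if mass: "emeasure (mv_normal p S) (space (mv_normal p S)) = 1"
  proof (rule measure_eqI)
    show "sets (mv_normal p S) = sets (distr (gauss p) ?M (lin p L))" unfolding dens by simp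
    fix A assume "A \<in> sets (mv_normal p S)"
    then have "A \<in> sets ?M" unfolding dens by simp
    from em[OF this] const mass show "emeasure (mv_normal p S) A = emeasure (distr (gauss p) ?M (lin p L)) A"
      by (simp add: mult.assoc[symmetric])
  qed
  moreover have "emeasure (mv_normal p S) (space (mv_normal p S)) \<noteq> \<top>"
    unfolding const by (simp add: ennreal_mult_eq_top_iff)
  moreover have "mm p L (tp L) r s = S $$ (r, s)" if "r < p" "s < p" for r s
  proof -
    define C where "C = mm p (tp L) (mm p P L)"
    have "tp C = C" by (simp add: C_def tp_mm tpP mm_assoc)
    moreover have "bil p C g g = (\<Sum>r<p. (g r)\<^sup>2)" for g
      unfolding C_def bil_lin[symmetric] by (rule L)
    ultimately have C: "C r s = (if r = s then 1 else 0)" if "r < p" "s < p" for r s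
      using that by (rule bil_eq_sum_squares_imp)
    define Lm where "Lm = Matrix.mat p p (\<lambda>(r, s). L r s)"
    have Lm: "Lm \<in> carrier_mat p p" by (simp add: Lm_def)
    \<comment> \<open>L' B L = 1 is rearranged to (L L') B = 1, and since B is the inverse of S this
      forces L L' = S.\<close>
    have "transpose_mat Lm * (B * Lm) = 1\<^sub>m p"
    proof (rule eq_matI)
      fix r s assume "r < dim_row (1\<^sub>m p :: real mat)" "s < dim_col (1\<^sub>m p :: real mat)"
      then have rs: "r < p" "s < p" by auto
      have "(transpose_mat Lm * (B * Lm)) $$ (r, s) = (\<Sum>t<p. L t r * (\<Sum>u<p. B $$ (t, u) * L u s))"
        using rs B(1) by (simp add: Lm_def scalar_prod_def lessThan_atLeast0)
      also have "\<dots> = C r s" by (simp add: C_def mm_def tp_def P_def fun_of_mat_def)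
      finally show "(transpose_mat Lm * (B * Lm)) $$ (r, s) = 1\<^sub>m p $$ (r, s)" using C[OF rs] rs by simp
    qed (use Lm B(1) in auto)
    then have "(transpose_mat Lm * B) * Lm = 1\<^sub>m p" using Lm B(1) by (simp add: assoc_mult_mat[of _ p p])
    then have "Lm * (transpose_mat Lm * B) = 1\<^sub>m p"
      by (rule mat_mult_left_right_inverse[rotated 2]) (use Lm B(1) in auto)
    then have "(Lm * transpose_mat Lm) * B = 1\<^sub>m p" using Lm B(1) by (simp add: assoc_mult_mat[of _ p p])
    moreover have "B * S = 1\<^sub>m p" by (rule mat_mult_left_right_inverse[OF c B(1) B(2)])
    ultimately have "Lm * transpose_mat Lm = S"
      using Lm B(1) c assoc_mult_mat[of "Lm * transpose_mat Lm" p p B p S p] by simp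
    then have "S $$ (r, s) = (Lm * transpose_mat Lm) $$ (r, s)" by simp
    also have "\<dots> = (\<Sum>t<p. L r t * L s t)" using that by (simp add: Lm_def scalar_prod_def lessThan_atLeast0)
    finally show ?thesis by (simp add: mm_def tp_def)
  qed
  ultimately show ?thesis by blast
qed

section \<open>Matrix-valued random variables and the Wishart law\<close>

definition mat_of :: "nat \<Rightarrow> (nat \<Rightarrow> nat \<Rightarrow> real) \<Rightarrow> real mat" where
  "mat_of p A = Matrix.mat p p (\<lambda>(r, s). A r s)"

lemma mat_of_carrier [simp]: "mat_of p A \<in> carrier_mat p p"
  by (simp add: mat_of_def)

lemma mat_of_mult: "mat_of p A * mat_of p B = mat_of p (mm p A B)"
  by (rule eq_matI) (auto simp: mat_of_def mm_def scalar_prod_def lessThan_atLeast0)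

lemma mat_trace_mat_of: "mat_trace (mat_of p A) = tr p A"
  by (simp add: mat_trace_def mat_of_def tr_def)

lemma mat_of_fun_of_mat: "A \<in> carrier_mat p p \<Longrightarrow> mat_of p (fun_of_mat p A) = A"
  by (rule eq_matI) (auto simp: mat_of_def fun_of_mat_def)

lemma space_mat_borel: "space (mat_borel p) = carrier_mat p p"
  by (simp add: mat_borel_def)

lemma measurable_mat_borel:
  assumes "\<And>x. x \<in> space M \<Longrightarrow> f x \<in> carrier_mat p p"
    and "\<And>r s. r < p \<Longrightarrow> s < p \<Longrightarrow> (\<lambda>x. f x $$ (r, s)) \<in> borel_measurable M"
  shows "f \<in> measurable M (mat_borel p)"
  unfolding mat_borel_def
proof (rule measurable_vimage_algebra2)
  show "f \<in> space M \<rightarrow> carrier_mat p p" using assms(1) by blast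
  show "(\<lambda>x. \<lambda>rs\<in>{..<p} \<times> {..<p}. f x $$ rs) \<in> measurable M (\<Pi>\<^sub>M rs\<in>{..<p} \<times> {..<p}. borel)"
    by (rule measurable_restrict) (use assms(2) in auto)
qed

lemma measurable_mat_entry: "r < p \<Longrightarrow> s < p \<Longrightarrow> (\<lambda>A. A $$ (r, s)) \<in> borel_measurable (mat_borel p)"
proof -
  assume rs: "r < p" "s < p"
  have "(\<lambda>A. \<lambda>rs\<in>{..<p} \<times> {..<p}. A $$ rs) \<in> measurable (mat_borel p) (\<Pi>\<^sub>M rs\<in>{..<p} \<times> {..<p}. borel)"
    unfolding mat_borel_def by (rule measurable_vimage_algebra1) (auto simp: space_PiM)
  from measurable_compose[OF this measurable_component_singleton[of "(r, s)"]] rs show ?thesis by simp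
qed

lemma measurable_fun_of_mat: "(\<lambda>A. fun_of_mat p A r s) \<in> borel_measurable (mat_borel p)"
  unfolding fun_of_mat_def using measurable_mat_entry[of r p s] by (cases "r < p \<and> s < p") auto

lemma borel_measurable_mm:
  "(\<And>r s. (\<lambda>x. A x r s) \<in> borel_measurable M) \<Longrightarrow> (\<And>r s. (\<lambda>x. B x r s) \<in> borel_measurable M) \<Longrightarrow>
    (\<lambda>x. mm p (A x) (B x) r s) \<in> borel_measurable M"
  unfolding mm_def by (intro borel_measurable_sum borel_measurable_times) auto

lemma borel_measurable_tr:
  "(\<And>r s. (\<lambda>x. A x r s) \<in> borel_measurable M) \<Longrightarrow> (\<lambda>x. tr p (A x)) \<in> borel_measurable M"
  unfolding tr_def by (intro borel_measurable_sum) auto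

lemma trace_stat_mat_of:
  assumes "\<And>i. T i = mat_of p (A i)"
  shows "trace_stat p n T = tr p (mm p (A La) (mm p (A Lb) (mm p (A Lc) (A Ld))))
     / (real p ^ 2 * sqrt (real (n La) * real (n Lb) * real (n Lc) * real (n Ld)))"
  unfolding trace_stat_def assms mat_of_mult mat_trace_mat_of mm_assoc ..

lemma measurable_trace_stat:
  "trace_stat p n \<in> borel_measurable (\<Pi>\<^sub>M i\<in>UNIV. mat_borel p)"
proof (subst measurable_cong)
  fix T assume "T \<in> space (\<Pi>\<^sub>M i\<in>(UNIV :: label set). mat_borel p)"
  then have "T i \<in> carrier_mat p p" for i by (auto simp: space_PiM space_mat_borel)
  then have "T i = mat_of p (fun_of_mat p (T i))" for i by (simp add: mat_of_fun_of_mat)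
  from trace_stat_mat_of[OF this]
  show "trace_stat p n T = tr p (mm p (fun_of_mat p (T La)) (mm p (fun_of_mat p (T Lb)) (mm p (fun_of_mat p (T Lc)) (fun_of_mat p (T Ld)))))
     / (real p ^ 2 * sqrt (real (n La) * real (n Lb) * real (n Lc) * real (n Ld)))" .
next
  have "(\<lambda>T. fun_of_mat p (T i) r s) \<in> borel_measurable (\<Pi>\<^sub>M i\<in>UNIV. mat_borel p)" for i :: label and r s
  proof -
    have "(\<lambda>T. T i) \<in> measurable (\<Pi>\<^sub>M i\<in>(UNIV :: label set). mat_borel p) (mat_borel p)"
      by (rule measurable_component_singleton) simp
    then show ?thesis by (rule measurable_compose[OF _ measurable_fun_of_mat])
  qed
  then show "(\<lambda>T. tr p (mm p (fun_of_mat p (T La)) (mm p (fun_of_mat p (T Lb)) (mm p (fun_of_mat p (T Lc)) (fun_of_mat p (T Ld)))))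
     / (real p ^ 2 * sqrt (real (n La) * real (n Lb) * real (n Lc) * real (n Ld)))) \<in> borel_measurable (\<Pi>\<^sub>M i\<in>(UNIV :: label set). mat_borel p)"
    by (intro borel_measurable_divide borel_measurable_const borel_measurable_tr borel_measurable_mm)
qed

lemma sets_mv_normal: "sets (mv_normal p S) = sets (\<Pi>\<^sub>M r\<in>{..<p}. lborel)"
  by (simp add: mv_normal_def)

lemma measurable_sum_outer:
  assumes "\<And>i. sets (N i) = sets (\<Pi>\<^sub>M r\<in>{..<p}. borel :: real measure)"
  shows "(\<lambda>v. Matrix.mat p p (\<lambda>(r, s). \<Sum>i<n. v i r * v i s)) \<in> measurable (\<Pi>\<^sub>M i\<in>{..<n}. N i) (mat_borel p)"
proof (rule measurable_mat_borel)
  have "(\<lambda>v. v i r) \<in> borel_measurable (\<Pi>\<^sub>M i\<in>{..<n}. N i)" if "i < n" "r < p" for i r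
  proof -
    have "(\<lambda>v. v i) \<in> measurable (\<Pi>\<^sub>M i\<in>{..<n}. N i) (\<Pi>\<^sub>M r\<in>{..<p}. borel)"
      by (subst measurable_cong_sets[OF refl assms[of i, symmetric]], rule measurable_component_singleton)
        (use that in simp)
    from measurable_compose[OF this measurable_component_singleton[of r]] that show ?thesis by simp
  qed
  then show "(\<lambda>v. Matrix.mat p p (\<lambda>(r, s). \<Sum>i<n. v i r * v i s) $$ (r, s)) \<in> borel_measurable (\<Pi>\<^sub>M i\<in>{..<n}. N i)"
    if "r < p" "s < p" for r s
    using that by simp
qed simp

text \<open>The Wishart measure has the total mass of n copies of the normal measure, that is its
  n-th power. This is 1, and n > 0, so the normal measure itself has mass 1 and is the law of L g;
  the representation then follows by pushing the array forward vector by vector.\<close>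

lemma wishart_eq_distr:
  assumes n: "0 < n" and S: "pos_def_mat p S" and W: "prob_space (wishart p n S)"
  shows "\<exists>L. wishart p n S = distr (garr n p) (mat_borel p) (\<lambda>v. mat_of p (wish n p L v))
    \<and> (\<forall>r<p. \<forall>s<p. mm p L (tp L) r s = S $$ (r, s))"
proof -
  let ?N = "mv_normal p S" and ?outer = "\<lambda>v. Matrix.mat p p (\<lambda>(r, s). \<Sum>i<n. v i r * v i s)"
  have setsN: "sets ?N = sets (\<Pi>\<^sub>M r\<in>{..<p}. borel :: real measure)"
    unfolding sets_mv_normal by (intro sets_PiM_cong) auto
  from mv_normal_eq_distr[OF S] obtain L where fin: "emeasure ?N (space ?N) \<noteq> \<top>"
    and eq: "emeasure ?N (space ?N) = 1 \<Longrightarrow> ?N = distr (gauss p) (\<Pi>\<^sub>M r\<in>{..<p}. lborel) (lin p L)"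
    and L: "\<forall>r<p. \<forall>s<p. mm p L (tp L) r s = S $$ (r, s)" by blast
  interpret N: finite_measure ?N by (rule finite_measureI) (simp add: fin)
  interpret NN: product_sigma_finite "\<lambda>_ :: nat. ?N" by standard
  have outer: "?outer \<in> measurable (\<Pi>\<^sub>M i\<in>{..<n}. ?N) (mat_borel p)"
    by (rule measurable_sum_outer[OF setsN])
  have "1 = emeasure (wishart p n S) (space (wishart p n S))" using prob_space.emeasure_space_1[OF W] by simp
  also have "\<dots> = emeasure (\<Pi>\<^sub>M i\<in>{..<n}. ?N) (?outer -` space (mat_borel p) \<inter> space (\<Pi>\<^sub>M i\<in>{..<n}. ?N))"
    unfolding wishart_def using outer by (simp add: emeasure_distr)
  also have "?outer -` space (mat_borel p) \<inter> space (\<Pi>\<^sub>M i\<in>{..<n}. ?N) = space (\<Pi>\<^sub>M i\<in>{..<n}. ?N)"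
    using measurable_space[OF outer] by blast
  also have "emeasure (\<Pi>\<^sub>M i\<in>{..<n}. ?N) (space (\<Pi>\<^sub>M i\<in>{..<n}. ?N)) = emeasure ?N (space ?N) ^ n"
    unfolding space_PiM by (subst NN.emeasure_PiM) auto
  finally have pow: "emeasure ?N (space ?N) ^ n = 1" ..
  have one: "emeasure ?N (space ?N) = 1"
  proof -
    obtain x where x: "emeasure ?N (space ?N) = ennreal x" "0 \<le> x"
      using fin by (cases "emeasure ?N (space ?N)") auto
    then have "ennreal (x ^ n) = ennreal 1" using pow by (simp add: ennreal_power)
    then have "x ^ n = 1" using x(2) by (subst (asm) ennreal_inj) auto
    then have "x = 1" using x(2) n by (metis power_eq_1_iff abs_of_nonneg less_irrefl real_norm_def)
    then show ?thesis using x by simp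
  qed
  have probN: "prob_space ?N" by (rule prob_spaceI) (rule one)
  have linN: "lin p L \<in> measurable (gauss p) ?N"
    by (subst measurable_cong_sets[OF refl setsN]) (rule measurable_lin)
  have "distr (gauss p) ?N (lin p L) = distr (gauss p) (\<Pi>\<^sub>M r\<in>{..<p}. lborel) (lin p L)"
    by (rule distr_cong) (simp_all add: sets_mv_normal)
  then have distrN: "distr (gauss p) ?N (lin p L) = ?N" using eq[OF one] by simp
  have "(\<Pi>\<^sub>M i\<in>{..<n}. ?N) = distr (garr n p) (\<Pi>\<^sub>M i\<in>{..<n}. ?N) (compose {..<n} (lin p L))"
    using distr_PiM_finite_prob_space'[of "{..<n}" "\<lambda>_. gauss p" "\<lambda>_. ?N" "lin p L"]
    by (simp add: prob_space_gauss probN linN distrN garr_def)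
  then have "wishart p n S = distr (distr (garr n p) (\<Pi>\<^sub>M i\<in>{..<n}. ?N) (compose {..<n} (lin p L))) (mat_borel p) ?outer"
    unfolding wishart_def by simp
  also have "\<dots> = distr (garr n p) (mat_borel p) (?outer \<circ> compose {..<n} (lin p L))"
  proof (rule distr_distr[OF outer])
    show "compose {..<n} (lin p L) \<in> measurable (garr n p) (\<Pi>\<^sub>M i\<in>{..<n}. ?N)"
      unfolding compose_def by (intro measurable_restrict measurable_compose[OF measurable_garr linN]) simp
  qed
  also have "?outer \<circ> compose {..<n} (lin p L) = (\<lambda>v. mat_of p (wish n p L v))"
    by (simp add: fun_eq_iff mat_of_def wish_def compose_def)
  finally show ?thesis using L by blast
qed

section \<open>The joint law of the four matrices\<close>

lemma UNIV_label: "(UNIV :: label set) = {La, Lb, Lc, Ld}"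
  by (auto intro: label.exhaust)

lemma all_label: "(\<forall>i. P i) \<longleftrightarrow> P La \<and> P Lb \<and> P Lc \<and> P Ld"
proof
  assume *: "P La \<and> P Lb \<and> P Lc \<and> P Ld"
  show "\<forall>i. P i"
  proof
    fix i show "P i" using * by (cases i) auto
  qed
qed auto

instance label :: finite
  by standard (simp add: UNIV_label)

context four_wishart
begin

definition joint :: "_ \<Rightarrow> label \<Rightarrow> real mat" where
  "joint z i = (case i of La \<Rightarrow> mat_of p (T La (fst z)) | Lb \<Rightarrow> mat_of p (T Lb (fst (snd z)))
    | Lc \<Rightarrow> mat_of p (T Lc (fst (snd (snd z)))) | Ld \<Rightarrow> mat_of p (T Ld (snd (snd (snd z)))))"

lemma measurable_mat_of_T: "(\<lambda>v. mat_of p (T i v)) \<in> measurable (\<mu> i) (mat_borel p)"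
  by (rule measurable_mat_borel) (auto simp: mat_of_def intro: all_moments_measurable all_moments_wish)

lemma measurable_joint: "joint \<in> measurable \<mu>4 (\<Pi>\<^sub>M i\<in>UNIV. mat_borel p)"
proof (rule measurable_PiM_single')
  fix i
  show "(\<lambda>z. joint z i) \<in> measurable \<mu>4 (mat_borel p)"
    unfolding joint_def
    by (cases i) (auto intro!: measurable_compose[OF _ measurable_mat_of_T])
qed (auto simp: space_mat_borel joint_def split: label.split)

text \<open>Checked on boxes, whose preimages under \<open>joint\<close> are again boxes in the
  nested product \<open>\<mu>4\<close>.\<close>

lemma distr_joint:
  "distr \<mu>4 (\<Pi>\<^sub>M i\<in>UNIV. mat_borel p) joint = (\<Pi>\<^sub>M i\<in>UNIV. distr (\<mu> i) (mat_borel p) (\<lambda>v. mat_of p (T i v)))"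
proof -
  let ?D = "\<lambda>i. distr (\<mu> i) (mat_borel p) (\<lambda>v. mat_of p (T i v))"
  have pD: "prob_space (?D i)" for i
    by (rule prob_space.prob_space_distr[OF prob_\<mu> measurable_mat_of_T])
  interpret D: product_prob_space ?D UNIV
    by (rule product_prob_spaceI) (rule pD)
  show ?thesis
  proof (rule D.PiM_eqI)
    show "sets (distr \<mu>4 (\<Pi>\<^sub>M i\<in>UNIV. mat_borel p) joint) = sets (\<Pi>\<^sub>M i\<in>UNIV. ?D i)"
      by (simp cong: sets_PiM_cong)
    fix A assume "\<And>i. i \<in> UNIV \<Longrightarrow> A i \<in> sets (?D i)"
    then have A: "A i \<in> sets (mat_borel p)" for i by simp
    define B where "B i = (\<lambda>v. mat_of p (T i v)) -` A i \<inter> space (\<mu> i)" for i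
    have B: "B i \<in> sets (\<mu> i)" for i
      unfolding B_def by (rule measurable_sets[OF measurable_mat_of_T A])
    have eB: "emeasure (?D i) (A i) = emeasure (\<mu> i) (B i)" for i
      unfolding B_def by (rule emeasure_distr[OF measurable_mat_of_T A])
    have "joint -` (Pi\<^sub>E UNIV A) \<inter> space \<mu>4 = B La \<times> (B Lb \<times> (B Lc \<times> B Ld))"
    proof (rule Set.set_eqI)
      fix z
      have "(\<forall>i. joint z i \<in> A i) \<longleftrightarrow> joint z La \<in> A La \<and> joint z Lb \<in> A Lb \<and> joint z Lc \<in> A Lc \<and> joint z Ld \<in> A Ld"
        by (rule all_label)
      then show "z \<in> joint -` (Pi\<^sub>E UNIV A) \<inter> space \<mu>4 \<longleftrightarrow> z \<in> B La \<times> (B Lb \<times> (B Lc \<times> B Ld))"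
        by (cases z) (auto simp: joint_def B_def space_pair_measure PiE_UNIV_domain Pi_iff)
    qed
    moreover have "Pi\<^sub>E UNIV A \<in> sets (\<Pi>\<^sub>M i\<in>(UNIV :: label set). mat_borel p)"
      by (intro sets_PiM_I_finite A) auto
    ultimately have "emeasure (distr \<mu>4 (\<Pi>\<^sub>M i\<in>UNIV. mat_borel p) joint) (Pi\<^sub>E UNIV A)
        = emeasure \<mu>4 (B La \<times> (B Lb \<times> (B Lc \<times> B Ld)))"
      by (simp add: emeasure_distr measurable_joint)
    also have "\<dots> = emeasure (\<mu> La) (B La) * (emeasure (\<mu> Lb) (B Lb) * (emeasure (\<mu> Lc) (B Lc) * emeasure (\<mu> Ld) (B Ld)))"
      using B by (simp add: p3.emeasure_pair_measure_Times p2.emeasure_pair_measure_Times garr.emeasure_pair_measure_Times)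
    also have "\<dots> = (\<Prod>i\<in>UNIV. emeasure (?D i) (A i))"
      unfolding eB by (simp add: UNIV_label)
    finally show "emeasure (distr \<mu>4 (\<Pi>\<^sub>M i\<in>UNIV. mat_borel p) joint) (Pi\<^sub>E UNIV A) = (\<Prod>i\<in>UNIV. emeasure (?D i) (A i))" .
  qed simp
qed

definition scale :: real where
  "scale = 1 / (real p ^ 2 * sqrt (real (n La) * real (n Lb) * real (n Lc) * real (n Ld)))"

lemma trace_stat_joint: "trace_stat p n (joint z) = stat scale z"
proof -
  have "joint z i = mat_of p (case i of La \<Rightarrow> T La (fst z) | Lb \<Rightarrow> T Lb (fst (snd z))
    | Lc \<Rightarrow> T Lc (fst (snd (snd z))) | Ld \<Rightarrow> T Ld (snd (snd (snd z))))" for i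
    by (cases i) (simp_all add: joint_def)
  from trace_stat_mat_of[OF this, of n] show ?thesis
    by (simp add: stat_def Q_def scale_def)
qed

text \<open>By independence the joint law on \<open>\<Omega>\<close> is the product of the
  marginals, which is also the law of \<open>joint\<close>; expectations can therefore be computed
  over Gaussian arrays.\<close>

lemma integral_transfer:
  fixes h :: "(label \<Rightarrow> real mat) \<Rightarrow> 'b::{banach, second_countable_topology}"
  assumes \<Omega>: "prob_space \<Omega>" and ind: "prob_space.indep_vars \<Omega> (\<lambda>_. mat_borel p) Tm UNIV"
    and law: "\<And>i. distr \<Omega> (mat_borel p) (Tm i) = distr (\<mu> i) (mat_borel p) (\<lambda>v. mat_of p (T i v))"
    and h: "h \<in> borel_measurable (\<Pi>\<^sub>M i\<in>UNIV. mat_borel p)"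
  shows "integral\<^sup>L \<Omega> (\<lambda>\<omega>. h (\<lambda>i. Tm i \<omega>)) = integral\<^sup>L \<mu>4 (\<lambda>z. h (joint z))"
proof -
  interpret \<Omega>: prob_space \<Omega> by fact
  have Tm: "Tm i \<in> measurable \<Omega> (mat_borel p)" for i
    using ind unfolding \<Omega>.indep_vars_def by auto
  have "distr \<Omega> (\<Pi>\<^sub>M i\<in>UNIV. mat_borel p) (\<lambda>\<omega>. \<lambda>i\<in>UNIV. Tm i \<omega>) = (\<Pi>\<^sub>M i\<in>UNIV. distr \<Omega> (mat_borel p) (Tm i))"
    using ind Tm by (subst (asm) \<Omega>.indep_vars_iff_distr_eq_PiM) auto
  also have "\<dots> = distr \<mu>4 (\<Pi>\<^sub>M i\<in>UNIV. mat_borel p) joint"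
    unfolding law distr_joint ..
  finally have eq: "distr \<Omega> (\<Pi>\<^sub>M i\<in>UNIV. mat_borel p) (\<lambda>\<omega>. \<lambda>i\<in>UNIV. Tm i \<omega>) = distr \<mu>4 (\<Pi>\<^sub>M i\<in>UNIV. mat_borel p) joint" .
  have XX: "(\<lambda>\<omega>. \<lambda>i\<in>UNIV. Tm i \<omega>) \<in> measurable \<Omega> (\<Pi>\<^sub>M i\<in>UNIV. mat_borel p)"
    by (intro measurable_restrict Tm)
  have "integral\<^sup>L \<Omega> (\<lambda>\<omega>. h (\<lambda>i. Tm i \<omega>)) = integral\<^sup>L (distr \<Omega> (\<Pi>\<^sub>M i\<in>UNIV. mat_borel p) (\<lambda>\<omega>. \<lambda>i\<in>UNIV. Tm i \<omega>)) h"
    using integral_distr[OF XX h] by (simp add: restrict_def)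
  also have "\<dots> = integral\<^sup>L \<mu>4 (\<lambda>z. h (joint z))"
    unfolding eq by (rule integral_distr[OF measurable_joint h])
  finally show ?thesis .
qed

lemma char_trace_stat:
  assumes \<Omega>: "prob_space \<Omega>" and ind: "prob_space.indep_vars \<Omega> (\<lambda>_. mat_borel p) Tm UNIV"
    and law: "\<And>i. distr \<Omega> (mat_borel p) (Tm i) = distr (\<mu> i) (mat_borel p) (\<lambda>v. mat_of p (T i v))"
  defines "D \<equiv> distr \<Omega> borel (\<lambda>\<omega>. trace_stat p n (\<lambda>i. Tm i \<omega>)
      - prob_space.expectation \<Omega> (\<lambda>\<omega>'. trace_stat p n (\<lambda>i. Tm i \<omega>')))"
  shows "real_distribution D"
    and "char D t = (CLINT z|\<mu>4. iexp (t * (stat scale z - stat_mean scale)))"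
proof -
  interpret \<Omega>: prob_space \<Omega> by fact
  have Tm: "Tm i \<in> measurable \<Omega> (mat_borel p)" for i
    using ind unfolding \<Omega>.indep_vars_def by auto
  have XX: "(\<lambda>\<omega> i. Tm i \<omega>) \<in> measurable \<Omega> (\<Pi>\<^sub>M i\<in>UNIV. mat_borel p)"
    using measurable_restrict[of UNIV Tm \<Omega> "\<lambda>_. mat_borel p", OF Tm] by (simp add: restrict_def)
  have ts: "(\<lambda>\<omega>. trace_stat p n (\<lambda>i. Tm i \<omega>)) \<in> borel_measurable \<Omega>"
    by (rule measurable_compose[OF XX measurable_trace_stat])
  have E: "integral\<^sup>L \<Omega> (\<lambda>\<omega>. trace_stat p n (\<lambda>i. Tm i \<omega>)) = stat_mean scale"
    using integral_transfer[OF \<Omega> ind law measurable_trace_stat[of p n]]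
    by (simp add: trace_stat_joint integral_stat)
  have m: "(\<lambda>\<omega>. trace_stat p n (\<lambda>i. Tm i \<omega>) - stat_mean scale) \<in> borel_measurable \<Omega>"
    using ts by simp
  show "real_distribution D"
    unfolding D_def E by (rule \<Omega>.real_distribution_distr[OF m])
  have "char D t = integral\<^sup>L \<Omega> (\<lambda>\<omega>. iexp (t * (trace_stat p n (\<lambda>i. Tm i \<omega>) - stat_mean scale)))"
    unfolding D_def E char_def by (rule integral_distr[OF m]) simp
  also have "\<dots> = (CLINT z|\<mu>4. iexp (t * (trace_stat p n (joint z) - stat_mean scale)))"
    using measurable_trace_stat[of p n] by (intro integral_transfer[OF \<Omega> ind law]) simp
  finally show "char D t = (CLINT z|\<mu>4. iexp (t * (stat scale z - stat_mean scale)))"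
    by (simp only: trace_stat_joint)
qed

end

section \<open>The errors after normalization\<close>

context four_wishart_bounds
begin

lemma scale_square: "scale\<^sup>2 * real (n La) = 1 / (real p ^ 4 * (real (n Lb) * real (n Lc) * real (n Ld)))"
proof -
  have "0 < real (n i)" for i using n[of i] by simp
  then have "(sqrt (real (n La) * real (n Lb) * real (n Lc) * real (n Ld)))\<^sup>2 = real (n La) * real (n Lb) * real (n Lc) * real (n Ld)"
    by (intro real_sqrt_pow2) simp
  then show ?thesis using n[of La]
    by (simp add: scale_def power_divide power_mult_distrib power_mult[symmetric])
qed

text \<open>The degrees of freedom cancel, and p^4 is shared out, one p to each of the four
  traces.\<close>

lemma V_limit_scale: "V_limit scale = (\<tau> Lb La / p) * (\<tau> Lc Lb / p) * (\<tau> Ld Lc / p) * (\<tau> Ld La / p)"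
proof -
  have "0 < real (n i)" for i using n[of i] by simp
  then have "real (n Lb) \<noteq> 0" "real (n Lc) \<noteq> 0" "real (n Ld) \<noteq> 0" by (auto simp: less_imp_neq[symmetric])
  then show ?thesis
    unfolding V_limit_def scale_square by (simp add: field_simps power4_eq_xxxx)
qed

lemma dev_div: "dev i / (real (n i) * p) = 9 * sqrt K * sqrt (n i / p) + 2 * K / sqrt (n i) + n i / p"
proof -
  \<comment> \<open>With the square roots of n and p as variables the claim becomes, apart from sqrt
    K, a rational identity.\<close>
  define a b where "a = sqrt (n i)" and "b = sqrt p"
  have pos: "0 < a" "0 < b" using n[of i] p by (auto simp: a_def b_def)
  have sq: "real (n i) = a * a" "real p = b * b" by (simp_all add: a_def b_def)
  show ?thesis
    unfolding dev_def real_sqrt_mult real_sqrt_divide a_def[symmetric] b_def[symmetric] unfolding sq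
    using pos by (simp add: field_simps power2_eq_square real_sqrt_mult)
qed

lemma V_error_scale:
  "V_error scale = 11 * K\<^sup>2 * (n Lc / p) * (n Ld / p) + 48 * K ^ 3 * (n Lb / p)
    + 16 * K ^ 3 * (dev Lb / (real (n Lb) * p) + dev Lc / (real (n Lc) * p) + dev Ld / (real (n Ld) * p))"
proof -
  have "0 < real (n i)" for i using n[of i] by simp
  then have nz: "real (n Lb) \<noteq> 0" "real (n Lc) \<noteq> 0" "real (n Ld) \<noteq> 0" "real p \<noteq> 0" using p by (auto simp: less_imp_neq[symmetric])
  have alg: "1 / (P ^ 4 * (b * c * d)) * (11 * K\<^sup>2 * b * (c * d * P)\<^sup>2 + 48 * K ^ 3 * b\<^sup>2 * c * d * P ^ 3
      + 16 * K ^ 3 * P ^ 3 * (x * (c * d) + y * (b * d) + z * (b * c)))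
    = 11 * K\<^sup>2 * (c / P) * (d / P) + 48 * K ^ 3 * (b / P) + 16 * K ^ 3 * (x / (b * P) + y / (c * P) + z / (d * P))"
    if "b \<noteq> 0" "c \<noteq> 0" "d \<noteq> 0" "P \<noteq> 0" for b c d P x y z :: real
    using that by (simp add: field_simps power2_eq_square power3_eq_cube power4_eq_xxxx)
  show ?thesis
    unfolding V_error_def scale_square by (rule alg[OF nz])
qed

lemma R_error_scale:
  "R_error scale = sqrt (32 * K ^ 3) * sqrt (n La / p) + sqrt 8 * K * (sqrt (n La / p) * sqrt (n Lb / p))
    + sqrt (2 * K) * (sqrt (n La / p) * sqrt (n Lb / p) * sqrt (n Lc / p))"
proof -
  define P a b c d where defs: "P = sqrt p" "a = sqrt (n La)" "b = sqrt (n Lb)" "c = sqrt (n Lc)" "d = sqrt (n Ld)"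
  have pos: "0 < P" "0 < a" "0 < b" "0 < c" "0 < d" using n p by (auto simp: defs)
  have sq: "real p = P * P" "real (n La) = a * a" "real (n Lb) = b * b" "real (n Lc) = c * c" "real (n Ld) = d * d"
    by (simp_all add: defs)
  have K0: "0 \<le> K" using K by simp
  have s1: "sqrt (2 * real (n Lb) * (16 * K ^ 3 * real (n Lc) * real (n Ld) * real p ^ 3)) = sqrt (32 * K ^ 3) * (b * c * d * P ^ 3)"
  proof -
    have "2 * real (n Lb) * (16 * K ^ 3 * real (n Lc) * real (n Ld) * real p ^ 3) = (32 * K ^ 3) * (b * c * d * P ^ 3)\<^sup>2"
      unfolding sq by (simp add: power2_eq_square power3_eq_cube)
    then show ?thesis using pos by (simp only: real_sqrt_mult real_sqrt_abs) simp
  qed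
  have s2: "sqrt (2 * real (n Lc) * (4 * K\<^sup>2 * real (n Ld) * (real p)\<^sup>2)) = sqrt 8 * (K * c * d * P\<^sup>2)"
  proof -
    have "2 * real (n Lc) * (4 * K\<^sup>2 * real (n Ld) * (real p)\<^sup>2) = 8 * (K * c * d * P\<^sup>2)\<^sup>2"
      unfolding sq by (simp add: power2_eq_square)
    then show ?thesis using pos K0 by (simp only: real_sqrt_mult real_sqrt_abs) simp
  qed
  have s3: "sqrt (2 * real (n Ld) * (K * p)) = sqrt (2 * K) * (d * P)"
  proof -
    have "2 * real (n Ld) * (K * p) = (2 * K) * (d * P)\<^sup>2"
      unfolding sq by (simp add: power2_eq_square)
    then show ?thesis using pos by (simp only: real_sqrt_mult real_sqrt_abs) simp
  qed
  have sc: "\<bar>scale\<bar> = 1 / (P ^ 4 * (a * b * c * d))"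
  proof -
    have "sqrt (real (n La) * real (n Lb) * real (n Lc) * real (n Ld)) = a * b * c * d"
      by (simp add: defs real_sqrt_mult)
    moreover have "real p ^ 2 = P ^ 4" unfolding sq by (simp add: power2_eq_square power4_eq_xxxx)
    ultimately show ?thesis unfolding scale_def using pos by simp
  qed
  have dv: "sqrt (n La / p) = a / P" "sqrt (n Lb / p) = b / P" "sqrt (n Lc / p) = c / P"
    by (simp_all add: defs real_sqrt_divide)
  have alg: "1 / (P ^ 4 * (a * b * c * d)) * (a * a) * (u * (b * c * d * P ^ 3) + (b * b * (v * (K * c * d * P\<^sup>2)) + b * b * (c * c) * (w * (d * P))))
    = u * (a / P) + v * K * (a / P * (b / P)) + w * (a / P * (b / P) * (c / P))" for u v w :: real
    using pos by (simp add: field_simps power2_eq_square power3_eq_cube power4_eq_xxxx)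
  show ?thesis
    unfolding R_error_def s1 s2 s3 sc dv unfolding sq by (rule alg)
qed

end

section \<open>The limit theorem\<close>

text \<open>The law is the image of the standard normal law under multiplication by
  \<open>s\<close>.\<close>

lemma char_normal:
  assumes s: "0 < s"
  shows "real_distribution (density lborel (\<lambda>x. ennreal (normal_density 0 s x)))"
    and "char (density lborel (\<lambda>x. ennreal (normal_density 0 s x))) t = complex_of_real (exp (- (t\<^sup>2 * s\<^sup>2) / 2))"
proof -
  have "distributed std_normal_distribution lborel (\<lambda>x. x) std_normal_density"
    unfolding distributed_def by (simp add: distr_id2)
  from std_normal.normal_density_affine[OF this, of s 0] s
  have "distributed std_normal_distribution lborel (\<lambda>x. s * x) (normal_density 0 s)" by simp
  then have "distr std_normal_distribution lborel (\<lambda>x. s * x) = density lborel (\<lambda>x. ennreal (normal_density 0 s x))"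
    by (simp add: distributed_def)
  moreover have "distr std_normal_distribution lborel (\<lambda>x. s * x) = distr std_normal_distribution borel (\<lambda>x. s * x)"
    by (rule distr_cong) auto
  ultimately have eq: "density lborel (\<lambda>x. ennreal (normal_density 0 s x)) = distr std_normal_distribution borel (\<lambda>x. s * x)"
    by simp
  show "real_distribution (density lborel (\<lambda>x. ennreal (normal_density 0 s x)))"
    unfolding eq by (rule std_normal.real_distribution_distr) simp
  have "char (density lborel (\<lambda>x. ennreal (normal_density 0 s x))) t = char std_normal_distribution (s * t)"
    unfolding eq char_def by (subst integral_distr) (simp_all add: mult_ac)
  then show "char (density lborel (\<lambda>x. ennreal (normal_density 0 s x))) t = complex_of_real (exp (- (t\<^sup>2 * s\<^sup>2) / 2))"
    by (simp add: char_std_normal_distribution power_mult_distrib mult_ac)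
qed

text \<open>Nothing is assumed about the model at p = 0, so Levy's theorem is applied to the
  sequence shifted by one.\<close>

lemma weak_conv_m_Suc:
  assumes "weak_conv_m (\<lambda>k. M (Suc k)) M'"
  shows "weak_conv_m M M'"
  using assms unfolding weak_conv_m_def weak_conv_def by (auto intro: LIMSEQ_imp_Suc)

lemma tendsto_inverse_sqrt:
  fixes f :: "nat \<Rightarrow> real"
  assumes "filterlim f at_top sequentially"
  shows "(\<lambda>k. c / sqrt (f k)) \<longlonglongrightarrow> 0"
  by (rule real_tendsto_divide_at_top[OF tendsto_const filterlim_compose[OF sqrt_at_top assms]])

lemma clt_rate_tendsto_0:
  assumes "filterlim (\<lambda>k. real (N k)) at_top sequentially"
  shows "(\<lambda>k. clt_rate t (N k)) \<longlonglongrightarrow> 0"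
proof -
  have 1: "(\<lambda>k. c / sqrt (N k)) \<longlonglongrightarrow> 0" for c by (rule tendsto_inverse_sqrt[OF assms])
  have 2: "(\<lambda>k. (t ^ 4 / 8) / real (N k)) \<longlonglongrightarrow> 0" by (rule real_tendsto_divide_at_top[OF tendsto_const assms])
  have "(\<lambda>k. (\<bar>t\<bar> ^ 3 / 12) / sqrt (N k) + sqrt (2 * ((9 * \<bar>t\<bar> ^ 3) / sqrt (N k) + (t ^ 4 / 8) / real (N k))))
      \<longlonglongrightarrow> 0 + sqrt (2 * (0 + 0))"
    by (intro tendsto_intros 1 2)
  then show ?thesis by (simp add: clt_rate_def)
qed

context four_wishart
begin

lemma mat_word_eq:
  assumes M: "\<And>i. M i \<in> carrier_mat p p" and S: "\<And>i r s. r < p \<Longrightarrow> s < p \<Longrightarrow> S i r s = M i $$ (r, s)"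
    and w: "w \<noteq> []"
  shows "mat_word p M w = mat_of p (word w)"
proof -
  have MS: "M i = mat_of p (S i)" for i
    using M[of i] S by (intro eq_matI) (auto simp: mat_of_def)
  show ?thesis using w
  proof (induction w rule: word.induct)
    case (2 i)
    then show ?case by (simp add: mat_word_def MS right_mult_one_mat[OF mat_of_carrier])
  next
    case (3 i j w)
    then show ?case by (simp add: mat_word_def MS mat_of_mult)
  qed simp
qed

lemma tr_word_eq:
  assumes "\<And>i. M i \<in> carrier_mat p p" "\<And>i r s. r < p \<Longrightarrow> s < p \<Longrightarrow> S i r s = M i $$ (r, s)" "w \<noteq> []"
  shows "tr p (word w) = mat_trace (mat_word p M w)"
  using mat_word_eq[OF assms] by (simp add: mat_trace_mat_of)

end

text \<open>This and the next two definitions give the normalized errors as functions of real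
  arguments m = n and x = n / p. They make sense outside the locale, where p is fixed, so their
  limits can be taken from n tending to infinity and n / p tending to 0.\<close>

definition dev_rate :: "real \<Rightarrow> real \<Rightarrow> real \<Rightarrow> real" where
  "dev_rate K m x = 9 * sqrt K * sqrt x + 2 * K / sqrt m + x"

definition V_rate :: "real \<Rightarrow> (label \<Rightarrow> real) \<Rightarrow> (label \<Rightarrow> real) \<Rightarrow> real" where
  "V_rate K m x = 11 * K\<^sup>2 * x Lc * x Ld + 48 * K ^ 3 * x Lb
    + 16 * K ^ 3 * (dev_rate K (m Lb) (x Lb) + dev_rate K (m Lc) (x Lc) + dev_rate K (m Ld) (x Ld))"

definition R_rate :: "real \<Rightarrow> (label \<Rightarrow> real) \<Rightarrow> real" where
  "R_rate K x = sqrt (32 * K ^ 3) * sqrt (x La) + sqrt 8 * K * (sqrt (x La) * sqrt (x Lb))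
    + sqrt (2 * K) * (sqrt (x La) * sqrt (x Lb) * sqrt (x Lc))"

lemma (in four_wishart_bounds) char_trace_stat_le:
  assumes \<Omega>: "prob_space \<Omega>" and ind: "prob_space.indep_vars \<Omega> (\<lambda>_. mat_borel p) Tm UNIV"
    and law: "\<And>i. distr \<Omega> (mat_borel p) (Tm i) = distr (\<mu> i) (mat_borel p) (\<lambda>v. mat_of p (T i v))"
    and S: "\<And>i. M i \<in> carrier_mat p p" "\<And>i r s. r < p \<Longrightarrow> s < p \<Longrightarrow> S i r s = M i $$ (r, s)"
  defines "D \<equiv> distr \<Omega> borel (\<lambda>\<omega>. trace_stat p n (\<lambda>i. Tm i \<omega>)
      - prob_space.expectation \<Omega> (\<lambda>\<omega>'. trace_stat p n (\<lambda>i. Tm i \<omega>')))"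
    and "m \<equiv> \<lambda>i j. mat_trace (mat_word p M [i, j]) / p"
  shows "cmod (char D t - complex_of_real (exp (- (t\<^sup>2 * (m Lb La * m Lc Lb * m Ld Lc * m Ld La)) / 2)))
    \<le> clt_rate t (n La) * (m Lb La * m Lc Lb * m Ld Lc * m Ld La + V_rate K (\<lambda>i. n i) (\<lambda>i. n i / p))
      + (t\<^sup>2 / 2 * V_rate K (\<lambda>i. n i) (\<lambda>i. n i / p) + \<bar>t\<bar> * R_rate K (\<lambda>i. n i / p))"
proof -
  have m: "\<tau> i j / p = m i j" for i j
    using tr_word_eq[OF S, of "[i, j]"] by (simp add: m_def \<tau>_def)
  have V: "V_error scale = V_rate K (\<lambda>i. n i) (\<lambda>i. n i / p)"
    unfolding V_error_scale dev_div V_rate_def dev_rate_def ..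
  have R: "R_error scale = R_rate K (\<lambda>i. n i / p)"
    unfolding R_error_scale R_rate_def ..
  show ?thesis
    using stat_char_bound[of t scale]
    unfolding D_def char_trace_stat(2)[OF \<Omega> ind law] V R V_limit_scale m .
qed

text \<open>Supplies the single constant \<open>K\<close>: there are finitely many words of bounded
  length, and convergent sequences are bounded over all p.\<close>

lemma bounded_family:
  fixes f :: "'a \<Rightarrow> nat \<Rightarrow> real"
  assumes "finite W" "\<And>w. w \<in> W \<Longrightarrow> convergent (f w)"
  shows "\<exists>K\<ge>1. \<forall>w\<in>W. \<forall>k. \<bar>f w k\<bar> \<le> K"
  using assms
proof (induction W rule: finite_induct)
  case empty
  then show ?case by (intro exI[of _ 1]) simp
next
  case (insert w W)
  then obtain K where K: "1 \<le> K" "\<forall>w\<in>W. \<forall>k. \<bar>f w k\<bar> \<le> K" by auto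
  have "Bseq (f w)" using insert.prems by (intro convergent_imp_Bseq) auto
  then obtain K' where K': "\<And>k. \<bar>f w k\<bar> \<le> K'" unfolding Bseq_def by auto
  then have "\<bar>f v k\<bar> \<le> max K K'" if "v \<in> insert w W" for v k
    using K that by (auto intro: order_trans[OF _ max.cobounded1] order_trans[OF _ max.cobounded2])
  then show ?case using K(1) by (intro exI[of _ "max K K'"]) auto
qed

theorem theorem2p2:
  fixes \<delta> :: real
    and n :: "label \<Rightarrow> nat \<Rightarrow> nat"
    and S :: "label \<Rightarrow> nat \<Rightarrow> real mat"
    and \<sigma> :: "label list \<Rightarrow> real"
    and \<Omega> :: "nat \<Rightarrow> 'w measure"
    and T :: "label \<Rightarrow> nat \<Rightarrow> 'w \<Rightarrow> real mat"
  assumes delta: "0 < \<delta>" "\<delta> < 1"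
    and n_pos: "\<And>i p. p > 0 \<Longrightarrow> n i p > 0"
    and n_order: "\<And>i. (\<lambda>p. real (n i p)) \<in> \<Theta>(\<lambda>p. real p powr \<delta>)"
    and S_pos_def: "\<And>i p. p > 0 \<Longrightarrow> pos_def_mat p (S i p)"
    and moment_lim: "\<And>w. 2 \<le> length w \<Longrightarrow> length w \<le> 16 \<Longrightarrow>
          (\<lambda>p. mat_trace (mat_word p (\<lambda>i. S i p) w) / real p) \<longlonglongrightarrow> \<sigma> w"
    and moment_pos: "\<And>i j. \<sigma> [i, j] > 0"
    and prob: "\<And>p. p > 0 \<Longrightarrow> prob_space (\<Omega> p)"
    and indep: "\<And>p. p > 0 \<Longrightarrow>
          prob_space.indep_vars (\<Omega> p) (\<lambda>_. mat_borel p) (\<lambda>i. T i p) (UNIV :: label set)"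
    and law: "\<And>i p. p > 0 \<Longrightarrow> distr (\<Omega> p) (mat_borel p) (T i p) = wishart p (n i p) (S i p)"
  shows "weak_conv_m
      (\<lambda>p. distr (\<Omega> p) borel (\<lambda>\<omega>.
          trace_stat p (\<lambda>i. n i p) (\<lambda>i. T i p \<omega>)
          - prob_space.expectation (\<Omega> p) (\<lambda>\<omega>'. trace_stat p (\<lambda>i. n i p) (\<lambda>i. T i p \<omega>'))))
      (density lborel (\<lambda>x. ennreal (normal_density 0
          (sqrt (\<sigma> [La, Lb] * \<sigma> [La, Ld] * \<sigma> [Lb, Lc] * \<sigma> [Lc, Ld])) x)))"
proof -
  define v where "v = \<sigma> [La, Lb] * \<sigma> [La, Ld] * \<sigma> [Lb, Lc] * \<sigma> [Lc, Ld]"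
  have v: "0 < v" using moment_pos by (simp add: v_def)
  define D where "D p = distr (\<Omega> p) borel (\<lambda>\<omega>. trace_stat p (\<lambda>i. n i p) (\<lambda>i. T i p \<omega>)
      - prob_space.expectation (\<Omega> p) (\<lambda>\<omega>'. trace_stat p (\<lambda>i. n i p) (\<lambda>i. T i p \<omega>')))" for p
  have carrier: "S i p \<in> carrier_mat p p" if "0 < p" for i p
    using S_pos_def[OF that] by (simp add: pos_def_mat_def)
  define P where "P i p L \<longleftrightarrow>
      wishart p (n i p) (S i p) = distr (garr (n i p) p) (mat_borel p) (\<lambda>v. mat_of p (wish (n i p) p L v))
      \<and> (\<forall>r<p. \<forall>s<p. mm p L (tp L) r s = S i p $$ (r, s))" for i p L
  have ex: "\<exists>L. P i p L" if p: "0 < p" for i p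
    unfolding P_def
  proof (rule wishart_eq_distr[OF n_pos[OF p] S_pos_def[OF p]])
    interpret \<Omega>: prob_space "\<Omega> p" by (rule prob[OF p])
    have "T i p \<in> measurable (\<Omega> p) (mat_borel p)"
      using indep[OF p] unfolding \<Omega>.indep_vars_def by auto
    then show "prob_space (wishart p (n i p) (S i p))"
      unfolding law[OF p, symmetric] by (rule \<Omega>.prob_space_distr)
  qed
  define L where "L i p = (SOME L. P i p L)" for i p
  have "P i p (L i p)" if "0 < p" for i p
    unfolding L_def by (rule someI_ex[OF ex[OF that]])
  then have L: "\<And>i p. 0 < p \<Longrightarrow>
      wishart p (n i p) (S i p) = distr (garr (n i p) p) (mat_borel p) (\<lambda>v. mat_of p (wish (n i p) p (L i p) v))"
    "\<And>i p r s. 0 < p \<Longrightarrow> r < p \<Longrightarrow> s < p \<Longrightarrow> mm p (L i p) (tp (L i p)) r s = S i p $$ (r, s)"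
    by (auto simp: P_def)
  define W where "W = {w :: label list. 2 \<le> length w \<and> length w \<le> 16}"
  have "finite W"
    by (rule finite_subset[OF _ finite_lists_length_le[of "UNIV :: label set" 16]]) (auto simp: W_def)
  moreover have "convergent (\<lambda>p. mat_trace (mat_word p (\<lambda>i. S i p) w) / real p)" if "w \<in> W" for w
    using moment_lim[of w] that by (auto simp: W_def convergent_def)
  ultimately obtain K where K: "1 \<le> K"
    and K_le: "\<And>w p. w \<in> W \<Longrightarrow> \<bar>mat_trace (mat_word p (\<lambda>i. S i p) w) / real p\<bar> \<le> K"
    using bounded_family[of W "\<lambda>w p. mat_trace (mat_word p (\<lambda>i. S i p) w) / real p"] by blast
  \<comment> \<open>The lower half of \<Theta> together with \<delta> > 0.\<close>
  have n_inf: "filterlim (\<lambda>p. real (n i p)) at_top sequentially" for i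
  proof -
    have "(\<lambda>p. real p powr \<delta>) \<in> O(\<lambda>p. real (n i p))"
      using n_order[of i] by (simp add: bigtheta_def bigomega_iff_bigo)
    then obtain c where c: "0 < c" and ev: "\<forall>\<^sub>F p in sequentially. norm (real p powr \<delta>) \<le> c * norm (real (n i p))"
      by (elim landau_o.bigE)
    have "filterlim (\<lambda>p :: nat. real p powr \<delta> / c) at_top sequentially"
      using delta(1) c by real_asymp
    then show ?thesis
    proof (rule filterlim_at_top_mono)
      show "\<forall>\<^sub>F p in sequentially. real p powr \<delta> / c \<le> real (n i p)"
        using ev by eventually_elim (use c in \<open>simp add: field_simps\<close>)
    qed
  qed
  \<comment> \<open>The upper half of \<Theta> together with \<delta> < 1.\<close>
  have ratio: "(\<lambda>p. real (n i p) / real p) \<longlonglongrightarrow> 0" for i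
  proof -
    have "(\<lambda>p. real (n i p)) \<in> O(\<lambda>p. real p powr \<delta>)" using n_order[of i] by (rule bigthetaD1)
    moreover have "(\<lambda>p :: nat. real p powr \<delta>) \<in> o(\<lambda>p. real p)"
      using delta by real_asymp
    ultimately have "(\<lambda>p. real (n i p)) \<in> o(\<lambda>p. real p)" by (rule landau_o.big_small_trans)
    then show ?thesis by (rule smalloD_tendsto)
  qed
  define m where "m i j p = mat_trace (mat_word p (\<lambda>i. S i p) [i, j]) / real p" for i j p
  have m_lim: "m i j \<longlonglongrightarrow> \<sigma> [i, j]" for i j
    unfolding m_def using moment_lim[of "[i, j]"] by simp
  define u where "u p = m Lb La p * m Lc Lb p * m Ld Lc p * m Ld La p" for p
  have u_lim: "u \<longlonglongrightarrow> v"
  proof -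
    \<comment> \<open>The peeling delivers the labels as ba, cb, dc, da; symmetry of the two-letter
      traces in the limit brings them into the order of the statement.\<close>
    have sym: "\<sigma> [i, j] = \<sigma> [j, i]" for i j
    proof (rule LIMSEQ_unique[OF m_lim[of i j]])
      have "m i j p = m j i p" for p
      proof (cases "0 < p")
        case True
        interpret four_wishart p "\<lambda>i. n i p" "\<lambda>i. L i p" .
        have "tr p (word [i, j]) = tr p (word [j, i])" by (simp add: tr_comm)
        then show ?thesis
          using tr_word_eq[of "\<lambda>i. S i p" "[i, j]"] tr_word_eq[of "\<lambda>i. S i p" "[j, i]"] carrier[OF True] L(2)[OF True]
          by (simp add: S_def m_def)
      qed (simp add: m_def)
      then show "m i j \<longlonglongrightarrow> \<sigma> [j, i]" using m_lim[of j i] by presburger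
    qed
    have "u \<longlonglongrightarrow> \<sigma> [Lb, La] * \<sigma> [Lc, Lb] * \<sigma> [Ld, Lc] * \<sigma> [Ld, La]"
      unfolding u_def by (intro tendsto_mult m_lim)
    then show ?thesis unfolding v_def by (simp add: sym[of Lb La] sym[of Lc Lb] sym[of Ld Lc] sym[of Ld La] mult_ac)
  qed
  define V where "V p = V_rate K (\<lambda>i. real (n i p)) (\<lambda>i. real (n i p) / real p)" for p
  define R where "R p = R_rate K (\<lambda>i. real (n i p) / real p)" for p
  have V_lim: "V \<longlonglongrightarrow> 0"
  proof -
    have d: "(\<lambda>p. dev_rate K (real (n i p)) (real (n i p) / real p)) \<longlonglongrightarrow> 9 * sqrt K * sqrt 0 + 0 + 0" for i
      unfolding dev_rate_def by (intro tendsto_intros ratio tendsto_inverse_sqrt n_inf)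
    have "V \<longlonglongrightarrow> 11 * K\<^sup>2 * 0 * 0 + 48 * K ^ 3 * 0 + 16 * K ^ 3 * ((9 * sqrt K * sqrt 0 + 0 + 0)
        + (9 * sqrt K * sqrt 0 + 0 + 0) + (9 * sqrt K * sqrt 0 + 0 + 0))"
      unfolding V_def V_rate_def by (intro tendsto_add tendsto_mult tendsto_const ratio d)
    then show ?thesis by simp
  qed
  have R_lim: "R \<longlonglongrightarrow> 0"
  proof -
    have "R \<longlonglongrightarrow> sqrt (32 * K ^ 3) * sqrt 0 + sqrt 8 * K * (sqrt 0 * sqrt 0) + sqrt (2 * K) * (sqrt 0 * sqrt 0 * sqrt 0)"
      unfolding R_def R_rate_def by (intro tendsto_add tendsto_mult tendsto_const tendsto_real_sqrt ratio)
    then show ?thesis by simp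
  qed
  \<comment> \<open>n / p drops below 1 for each label, and simultaneously because there are only
    four labels.\<close>
  have n_le: "\<forall>\<^sub>F p in sequentially. \<forall>i. n i p \<le> p"
  proof -
    have "\<forall>\<^sub>F p in sequentially. n i p \<le> p" for i
    proof -
      have "\<forall>\<^sub>F p in sequentially. real (n i p) / real p < 1" by (rule order_tendstoD(2)[OF ratio]) simp
      then show ?thesis using eventually_gt_at_top[of 0] by eventually_elim (simp add: field_simps)
    qed
    then show ?thesis by (simp add: eventually_all_finite)
  qed
  have char_bound: "\<forall>\<^sub>F p in sequentially. cmod (char (D p) t - complex_of_real (exp (- (t\<^sup>2 * u p) / 2)))
      \<le> clt_rate t (n La p) * (u p + V p) + (t\<^sup>2 / 2 * V p + \<bar>t\<bar> * R p)" for t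
    using n_le eventually_gt_at_top[of 0]
  proof eventually_elim
    case (elim p)
    interpret fw: four_wishart p "\<lambda>i. n i p" "\<lambda>i. L i p" .
    have S_eq: "fw.S i r s = S i p $$ (r, s)" if "r < p" "s < p" for i r s
      using L(2)[OF elim(2) that] by (simp add: fw.S_def)
    interpret four_wishart_bounds p "\<lambda>i. n i p" "\<lambda>i. L i p" K
    proof
      show "0 < p" "1 \<le> K" by fact+
      show "0 < n i p" "n i p \<le> p" for i using n_pos[OF elim(2)] elim(1) by auto
      fix w :: "label list" assume w: "2 \<le> length w" "length w \<le> 16"
      then have "w \<noteq> []" by auto
      then have "tr p (fw.word w) = mat_trace (mat_word p (\<lambda>i. S i p) w)"
        using carrier[OF elim(2)] S_eq by (intro fw.tr_word_eq) auto
      then show "\<bar>tr p (fw.word w)\<bar> \<le> K * real p"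
        using K_le[of w p] w elim(2) by (simp add: W_def field_simps abs_divide)
    qed
    have "distr (\<Omega> p) (mat_borel p) (T i p) = distr (garr (n i p) p) (mat_borel p) (\<lambda>v. mat_of p (wish (n i p) p (L i p) v))" for i
      using law[OF elim(2)] L(1)[OF elim(2)] by simp
    from char_trace_stat_le[OF prob[OF elim(2)] indep[OF elim(2)] this carrier[OF elim(2)] S_eq]
    show ?case unfolding D_def u_def m_def V_def R_def .
  qed
  have D_dist: "real_distribution (D (Suc k))" for k
  proof -
    interpret fw: four_wishart "Suc k" "\<lambda>i. n i (Suc k)" "\<lambda>i. L i (Suc k)" .
    have "distr (\<Omega> (Suc k)) (mat_borel (Suc k)) (T i (Suc k)) = distr (garr (n i (Suc k)) (Suc k)) (mat_borel (Suc k))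
        (\<lambda>v. mat_of (Suc k) (wish (n i (Suc k)) (Suc k) (L i (Suc k)) v))" for i
      using law[of "Suc k"] L(1)[of "Suc k"] by simp
    from fw.char_trace_stat(1)[OF prob indep this] show ?thesis by (simp add: D_def)
  qed
  have s: "0 < sqrt v" using v by simp
  have "weak_conv_m D (density lborel (\<lambda>x. ennreal (normal_density 0 (sqrt v) x)))"
  proof (rule weak_conv_m_Suc, rule levy_continuity[OF D_dist char_normal(1)[OF s]])
    fix t
    let ?B = "\<lambda>p. clt_rate t (n La p) * (u p + V p) + (t\<^sup>2 / 2 * V p + \<bar>t\<bar> * R p)"
    have "?B \<longlonglongrightarrow> 0 * (v + 0) + (t\<^sup>2 / 2 * 0 + \<bar>t\<bar> * 0)"
      by (intro tendsto_add tendsto_mult tendsto_const clt_rate_tendsto_0 n_inf u_lim V_lim R_lim)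
    then have "?B \<longlonglongrightarrow> 0" by simp
    then have diff: "(\<lambda>p. char (D p) t - complex_of_real (exp (- (t\<^sup>2 * u p) / 2))) \<longlonglongrightarrow> 0"
      using char_bound by (rule Lim_null_comparison[rotated])
    \<comment> \<open>The comparison law still has variance \<open>u p\<close>; continuity of exp
      moves it to the limit \<open>v\<close>.\<close>
    have "(\<lambda>p. complex_of_real (exp (- (t\<^sup>2 * u p) / 2))) \<longlonglongrightarrow> complex_of_real (exp (- (t\<^sup>2 * v) / 2))"
      by (intro tendsto_intros u_lim) simp
    from tendsto_add[OF diff this] have "(\<lambda>p. char (D p) t) \<longlonglongrightarrow> complex_of_real (exp (- (t\<^sup>2 * v) / 2))" by simp
    then have "(\<lambda>k. char (D (Suc k)) t) \<longlonglongrightarrow> complex_of_real (exp (- (t\<^sup>2 * v) / 2))" by (rule LIMSEQ_Suc)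
    then show "(\<lambda>k. char (D (Suc k)) t) \<longlonglongrightarrow> char (density lborel (\<lambda>x. ennreal (normal_density 0 (sqrt v) x))) t"
      unfolding char_normal(2)[OF s] using v by simp
  qed
  then show ?thesis unfolding D_def v_def .
qed

end
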